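(* Fix an integer $t\ge3$, let $p=p(n)\in(0,1)$ with $p\to 0$, $d=np$, and suppose $n d^t\ll d^{2t}$. Then, for $\mathbb{G}_n\stackrel{d}{=}\mathbb{G}(n,p)$, $$\mathbb{E}[\mathrm{Hom}(C_{2t},\mathbb{G}_n)]=(1+o(1))\,d^{2t}.$$ If moreover $d\le n^{1/2}(\log n)^{-\omega(1)}$ and $\lim_{n\to\infty}\log d/\log n=\alpha$, then for any $\hat\delta>0$, $$\lim_{n\to\infty}-\frac{\log\mathbb{P}\left(\mathrm{Hom}(C_{2t},\mathbb{G}_n)\ge(1+\hat\delta)d^{2t}\right)}{d^2\log(1/p)}=\frac12\,\hat\delta^{1/t}\cdot\min\left\{2^{1-1/t}\cdot\frac{\alpha}{1-\alpha},\,1\right\}.$$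
   Context: $\mathbb{G}(n,p)$ is the Erdős–Rényi random graph on $[n]$ with edge probability $p$; $C_{s}$ is the cycle graph of length $s$. For graphs $H,G$, $\mathrm{Hom}(H,G)=\sum_{\varphi}\prod_{(x,y)\in E(H)}a^G_{\varphi(x),\varphi(y)}$, where the sum is over all maps $\varphi:V(H)\to V(G)$ and $(a^G_{u,v})$ is the adjacency matrix of $G$. For positive sequences, $a_n\ll b_n$ means $a_n/b_n\to0$. The condition $d\le n^{1/2}(\log n)^{-\omega(1)}$ means $d\le n^{1/2}(\log n)^{-c_n}$ for some $c_n\to\infty$. *)

theory Defs
  imports "HOL-Probability.Probability"
begin

text \<open>A simple graph is a pair of a vertex set and a set of two-element sets of vertices.\<close>

type_synonym 'a graph = "'a set \<times> 'a set set"

definition verts :: "'a graph \<Rightarrow> 'a set" where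
  "verts G = fst G"

definition edges :: "'a graph \<Rightarrow> 'a set set" where
  "edges G = snd G"

definition adj :: "'a graph \<Rightarrow> 'a \<Rightarrow> 'a \<Rightarrow> real" where
  "adj G u v = (if {u, v} \<in> edges G then 1 else 0)"

text \<open>The product has one factor for each undirected edge of \<open>H\<close>, listed with its smaller
  endpoint first; since \<open>adj G\<close> is symmetric, the choice of orientation is immaterial.\<close>

definition Hom :: "'a::linorder graph \<Rightarrow> 'b graph \<Rightarrow> real" where
  "Hom H G = (\<Sum>\<phi> \<in> verts H \<rightarrow>\<^sub>E verts G.
      \<Prod>(x, y) \<in> {(x, y). x < y \<and> {x, y} \<in> edges H}. adj G (\<phi> x) (\<phi> y))"

text \<open>This is a simple graph, and the cycle of length \<open>s\<close>, for \<open>s \<ge> 3\<close>.\<close>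

definition cycle_graph :: "nat \<Rightarrow> nat graph" where
  "cycle_graph s = ({..<s}, {{i, Suc i mod s} | i. i < s})"

definition all_pairs :: "nat \<Rightarrow> nat set set" where
  "all_pairs n = {e. e \<subseteq> {1..n} \<and> card e = 2}"

definition erdos_renyi :: "nat \<Rightarrow> real \<Rightarrow> nat graph pmf" where
  "erdos_renyi n p =
     map_pmf (\<lambda>X. ({1..n}, {e \<in> all_pairs n. X e}))
       (Pi_pmf (all_pairs n) False (\<lambda>_. bernoulli_pmf p))"

definition much_less :: "(nat \<Rightarrow> real) \<Rightarrow> (nat \<Rightarrow> real) \<Rightarrow> bool" (infix "\<lless>" 50) where
  "a \<lless> b \<longleftrightarrow> (\<lambda>n. a n / b n) \<longlonglongrightarrow> 0"

end

theory Submission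
  imports Defs "HOL-Real_Asymp.Real_Asymp"
begin

text \<open>The homomorphism count is the trace of the \<open>2 * t\<close>-th power of the adjacency matrix. For the
  lower bound on the tail one plants either a clique or a star; the rest of the graph still
  contributes almost \<open>d ^ (2 * t)\<close>, because even cycles satisfy Sidorenko's inequality and the
  number of edges is concentrated.

  For the upper bound, a moment of order \<open>d\<^sup>2 * ln n\<close> shows that the tail event forces a
  seed: a subgraph with \<open>O(d\<^sup>2 * ln n)\<close> edges whose presence raises the conditional mean almost to
  the level \<open>(1 + \<delta>) * d ^ (2 * t)\<close>. By the triangle inequality for the Schatten norm, walks that
  mix seed edges with random ones are negligible, so the seed itself has almost
  \<open>\<delta> * d ^ (2 * t)\<close> closed walks. Deleting edges that lie in few closed walks leaves a core, in which
  the end points of each edge have degree product at least \<open>d\<^sup>2\<close> up to logarithms. There are so few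
  pairs with this property that an edge between two vertices of large degree costs its full
  probability \<open>p\<close>, while an edge to a vertex of small degree hangs on one of few hubs and costs
  about \<open>1 / d\<close>. By pigeonhole some gap in the degree scale is almost empty, so these two kinds of
  edges hardly interact; with \<open>a\<close> and \<open>b\<close> edges of the two kinds the core has at most about
  \<open>(2 * a) ^ t + 2 * b ^ t\<close> closed walks, and a union bound over cores finishes the proof.\<close>

text \<open>The obstacle is the logarithm. A moment of order d^2 ln n yields only seeds with
  \<open>R\<close> = O(d^2 ln n) edges, so in units of d^2 everything about a seed is known up to
  powers of \<rho> = 2R/d^2, which is of order ln n. Each loss is therefore arranged as a power of
  \<rho> times something that beats every power of ln n: d^2/n, by the upper assumption on d; a
  negative power of d, because n d^t << d^(2t) forces d >= n^(1/t) eventually; or a small negative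
  power of n that is put into the weights of the union bound. Hence the degree scales are spaced by
  a power of d, and cores are counted by generating functions with free weights. The quantity n d^t
  in the hypothesis is the size of the noise trace: a closed walk of length 2t that uses each of its
  edges twice has at most t edges and t + 1 vertices, and n^(t+1) p^t = n d^t. The price of a star
  edge is that of a free choice: b leaves have probability about (np/b)^b, and with b of order d^2
  the base is of order 1/d.\<close>

subsection \<open>Random subsets and planted seeds\<close>

text \<open>Expectation over a random subset of \<open>N\<close> that contains each element
  independently with probability \<open>p\<close>, as a finite sum; integrals enter only with
  \<open>erdos_renyi_expectation\<close>.\<close>

definition subset_mean :: "real \<Rightarrow> 'a set \<Rightarrow> ('a set \<Rightarrow> real) \<Rightarrow> real" where
  "subset_mean p N f = (\<Sum>E\<in>Pow N. p ^ card E * (1 - p) ^ card (N - E) * f E)"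

lemma subset_mean_cong: "(\<And>E. E \<subseteq> N \<Longrightarrow> f E = g E) \<Longrightarrow> subset_mean p N f = subset_mean p N g"
  by (auto simp: subset_mean_def intro!: sum.cong)

lemma subset_mean_mono:
  assumes "0 \<le> p" "p \<le> 1" "\<And>E. E \<subseteq> N \<Longrightarrow> f E \<le> g E"
  shows "subset_mean p N f \<le> subset_mean p N g"
  unfolding subset_mean_def using assms by (intro sum_mono mult_left_mono) auto

lemma subset_mean_add: "subset_mean p N (\<lambda>E. f E + g E) = subset_mean p N f + subset_mean p N g"
  by (simp add: subset_mean_def sum.distrib algebra_simps)

lemma subset_mean_diff: "subset_mean p N (\<lambda>E. f E - g E) = subset_mean p N f - subset_mean p N g"
  by (simp add: subset_mean_def sum_subtractf algebra_simps)

lemma subset_mean_cmult: "subset_mean p N (\<lambda>E. c * f E) = c * subset_mean p N f"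
  by (simp add: subset_mean_def sum_distrib_left algebra_simps)

lemma subset_mean_sum: "subset_mean p N (\<lambda>E. \<Sum>i\<in>A. f i E) = (\<Sum>i\<in>A. subset_mean p N (f i))"
  unfolding subset_mean_def by (simp add: sum_distrib_left sum.swap[of _ A])

lemma subset_mean_nonneg:
  assumes "0 \<le> p" "p \<le> 1" "\<And>E. E \<subseteq> N \<Longrightarrow> 0 \<le> f E"
  shows "0 \<le> subset_mean p N f"
  unfolding subset_mean_def using assms by (intro sum_nonneg mult_nonneg_nonneg) auto

text \<open>Independence of the elements: multiplying out chooses one summand per element, and the
  elements for which the first summand is chosen form the random subset.\<close>

lemma subset_mean_prod:
  assumes "finite N"
  shows "subset_mean p N (\<lambda>E. \<Prod>e\<in>N. g e (e \<in> E)) = (\<Prod>e\<in>N. p * g e True + (1 - p) * g e False)"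
proof -
  have "(\<Prod>e\<in>N. p * g e True + (1 - p) * g e False) =
     (\<Sum>X\<in>Pow N. (\<Prod>e\<in>X. p * g e True) * (\<Prod>e\<in>N-X. (1 - p) * g e False))"
    by (rule prod_add[OF assms])
  also have "\<dots> = subset_mean p N (\<lambda>E. \<Prod>e\<in>N. g e (e \<in> E))"
    unfolding subset_mean_def
  proof (rule sum.cong[OF refl])
    fix X assume X: "X \<in> Pow N"
    have "(\<Prod>e\<in>N. g e (e \<in> X)) = (\<Prod>e\<in>N-X. g e (e \<in> X)) * (\<Prod>e\<in>X. g e (e \<in> X))"
      using X assms by (intro prod.subset_diff) auto
    also have "(\<Prod>e\<in>N-X. g e (e \<in> X)) = (\<Prod>e\<in>N-X. g e False)"
      by (rule prod.cong) auto
    also have "(\<Prod>e\<in>X. g e (e \<in> X)) = (\<Prod>e\<in>X. g e True)"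
      by (rule prod.cong) auto
    finally show "(\<Prod>e\<in>X. p * g e True) * (\<Prod>e\<in>N-X. (1 - p) * g e False) =
        p ^ card X * (1 - p) ^ card (N - X) * (\<Prod>e\<in>N. g e (e \<in> X))"
      by (simp add: prod.distrib)
  qed
  finally show ?thesis by simp
qed

lemma subset_mean_superset:
  assumes "finite N" "S \<subseteq> N"
  shows "subset_mean p N (\<lambda>E. of_bool (S \<subseteq> E)) = p ^ card S"
proof -
  have "subset_mean p N (\<lambda>E. of_bool (S \<subseteq> E)) =
      subset_mean p N (\<lambda>E. \<Prod>e\<in>N. (\<lambda>e b. of_bool (e \<in> S \<longrightarrow> b)) e (e \<in> E))"
  proof (rule subset_mean_cong)
    fix E assume "E \<subseteq> N"
    show "(of_bool (S \<subseteq> E) :: real) = (\<Prod>e\<in>N. (\<lambda>e b. of_bool (e \<in> S \<longrightarrow> b)) e (e \<in> E))"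
    proof (cases "S \<subseteq> E")
      case True
      then show ?thesis by (subst prod.neutral) auto
    next
      case False
      then show ?thesis using assms by (subst prod_zero) auto
    qed
  qed
  also have "\<dots> = (\<Prod>e\<in>N. if e \<in> S then p else 1)"
    by (subst subset_mean_prod[OF assms(1)], rule prod.cong) auto
  also have "\<dots> = p ^ card S"
    using assms by (simp add: prod.If_cases Int_absorb1)
  finally show ?thesis .
qed

lemma subset_mean_const: "finite N \<Longrightarrow> subset_mean p N (\<lambda>E. c) = c"
  using subset_mean_superset[of N "{}" p] subset_mean_cmult[of p N c "\<lambda>_. 1"] by simp

lemma subset_mean_indep:
  assumes "finite A" "finite B" "A \<inter> B = {}"
  shows "subset_mean p (A \<union> B) (\<lambda>E. f (E \<inter> A) * g (E \<inter> B)) = subset_mean p A f * subset_mean p B g"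
proof -
  have "subset_mean p A f * subset_mean p B g = (\<Sum>(E,F)\<in>Pow A \<times> Pow B.
     (p ^ card E * (1 - p) ^ card (A - E) * f E) * (p ^ card F * (1 - p) ^ card (B - F) * g F))"
    by (simp add: subset_mean_def sum_product sum.cartesian_product)
  also have "\<dots> = (\<Sum>E\<in>Pow (A \<union> B). p ^ card E * (1 - p) ^ card (A \<union> B - E) * (f (E \<inter> A) * g (E \<inter> B)))"
  proof (rule sum.reindex_bij_witness[of _ "\<lambda>E. (E \<inter> A, E \<inter> B)" "\<lambda>(E, F). E \<union> F"], goal_cases)
    case (1 a)
    then show ?case using assms(3) by auto
  next
    case (2 a)
    then show ?case by auto
  next
    case (3 b)
    then show ?case by auto
  next
    case (4 b)
    then show ?case by auto
  next
    case (5 a)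
    obtain E F where a: "a = (E, F)" "E \<subseteq> A" "F \<subseteq> B" using 5 by auto
    have fin: "finite E" "finite F" using a assms finite_subset by blast+
    have "card (E \<union> F) = card E + card F"
      using a assms fin by (intro card_Un_disjoint) auto
    moreover have "A \<union> B - (E \<union> F) = (A - E) \<union> (B - F)" using a assms by auto
    then have "card (A \<union> B - (E \<union> F)) = card (A - E) + card (B - F)"
      using a assms by (simp, intro card_Un_disjoint) auto
    moreover have "(E \<union> F) \<inter> A = E" "(E \<union> F) \<inter> B = F" using a assms by auto
    ultimately show ?case by (simp add: a(1) power_add)
  qed
  finally show ?thesis by (simp add: subset_mean_def)
qed

lemma subset_mean_markov:
  assumes "finite N" "0 \<le> p" "p \<le> 1" "c > 0" "\<And>E. E \<subseteq> N \<Longrightarrow> 0 \<le> f E"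
  shows "subset_mean p N (\<lambda>E. of_bool (c \<le> f E)) \<le> subset_mean p N f / c"
proof -
  have "subset_mean p N (\<lambda>E. of_bool (c \<le> f E)) \<le> subset_mean p N (\<lambda>E. (1 / c) * f E)"
    using assms by (intro subset_mean_mono) (auto simp: of_bool_def field_simps)
  then show ?thesis by (simp only: subset_mean_cmult) simp
qed

text \<open>Chebyshev's inequality for the binomial law. It serves only to make a tail probability
  at most 1/2.\<close>

lemma subset_mean_card_tail:
  assumes "finite N" "0 < p" "p \<le> 1" "0 < x" "N \<noteq> {}"
  shows "subset_mean p N (\<lambda>E. of_bool (real (card E) \<le> (1 - x) * (real (card N) * p))) \<le> 1 / (x\<^sup>2 * (real (card N) * p))"
proof -
  define m where "m = real (card N) * p"
  have m: "m > 0" using assms by (simp add: m_def card_gt_0_iff)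
  have c: "subset_mean p N (\<lambda>E. real (card E)) = m"
  proof -
    have "subset_mean p N (\<lambda>E. real (card E)) = subset_mean p N (\<lambda>E. \<Sum>e\<in>N. of_bool ({e} \<subseteq> E))"
    proof (rule subset_mean_cong)
      fix E assume "E \<subseteq> N"
      then have "E = N \<inter> {e. e \<in> E}" by auto
      then show "real (card E) = (\<Sum>e\<in>N. of_bool ({e} \<subseteq> E))"
        using assms(1) by (simp add: of_bool_def sum.If_cases)
    qed
    also have "\<dots> = m"
      unfolding subset_mean_sum m_def using assms(1) by (subst sum.cong[OF refl subset_mean_superset]) auto
    finally show ?thesis .
  qed
  have c2: "subset_mean p N (\<lambda>E. (real (card E))\<^sup>2) \<le> m\<^sup>2 + m"
  proof -
    have "subset_mean p N (\<lambda>E. (real (card E))\<^sup>2) = subset_mean p N (\<lambda>E. \<Sum>e\<in>N. \<Sum>e'\<in>N. of_bool ({e,e'} \<subseteq> E))"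
    proof (rule subset_mean_cong)
      fix E assume "E \<subseteq> N"
      then have "E = N \<inter> {e. e \<in> E}" by auto
      then have "real (card E) = (\<Sum>e\<in>N. of_bool (e \<in> E))"
        using assms(1) by (simp add: of_bool_def sum.If_cases)
      then show "(real (card E))\<^sup>2 = (\<Sum>e\<in>N. \<Sum>e'\<in>N. of_bool ({e,e'} \<subseteq> E))"
        by (simp add: power2_eq_square sum_product of_bool_conj)
    qed
    also have "\<dots> = (\<Sum>e\<in>N. \<Sum>e'\<in>N. p ^ card {e,e'})"
      unfolding subset_mean_sum using assms(1) by (intro sum.cong refl subset_mean_superset) auto
    \<comment> \<open>Distinct elements contribute p^2; on the diagonal p is bounded by p^2 +
      p.\<close>
    also have "\<dots> \<le> (\<Sum>e\<in>N. \<Sum>e'\<in>N. p\<^sup>2 + (if e' = e then p else 0))"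
      using assms by (intro sum_mono) (auto simp: card_insert_if power2_eq_square)
    also have "\<dots> = m\<^sup>2 + m"
      using assms(1) by (simp add: sum.distrib m_def power2_eq_square algebra_simps)
    finally show ?thesis .
  qed
  have "subset_mean p N (\<lambda>E. of_bool (real (card E) \<le> (1 - x) * m)) \<le>
      subset_mean p N (\<lambda>E. of_bool ((x * m)\<^sup>2 \<le> (real (card E) - m)\<^sup>2))"
  proof (rule subset_mean_mono)
    fix E assume "E \<subseteq> N"
    show "of_bool (real (card E) \<le> (1 - x) * m) \<le> (of_bool ((x * m)\<^sup>2 \<le> (real (card E) - m)\<^sup>2) :: real)"
    proof (cases "real (card E) \<le> (1 - x) * m")
      case True
      then have "x * m \<le> m - real (card E)" by (simp add: algebra_simps)
      then have "(x * m)\<^sup>2 \<le> (m - real (card E))\<^sup>2"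
        using assms m by (intro power_mono) auto
      then show ?thesis by (simp add: power2_commute)
    qed auto
  qed (use assms in auto)
  also have "\<dots> \<le> subset_mean p N (\<lambda>E. (real (card E) - m)\<^sup>2) / (x * m)\<^sup>2"
    using assms m by (intro subset_mean_markov) auto
  also have "subset_mean p N (\<lambda>E. (real (card E) - m)\<^sup>2) =
      subset_mean p N (\<lambda>E. ((real (card E))\<^sup>2 + m\<^sup>2) - (2 * m) * real (card E))"
    by (rule subset_mean_cong) (simp add: power2_eq_square algebra_simps)
  also have "\<dots> = subset_mean p N (\<lambda>E. (real (card E))\<^sup>2) + m\<^sup>2 - 2 * m * m"
    using assms(1) by (simp only: subset_mean_diff subset_mean_add subset_mean_cmult subset_mean_const c)
  also have "\<dots> / (x * m)\<^sup>2 \<le> m / (x * m)\<^sup>2"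
    using c2 by (intro divide_right_mono) (auto simp: power2_eq_square)
  also have "\<dots> = 1 / (x\<^sup>2 * m)" using m assms by (simp add: power2_eq_square)
  finally show ?thesis unfolding m_def .
qed

text \<open>The sets \<open>S i\<close> are revealed one at a time; as long as the revealed ones do not form a seed,
  the conditional mean of the sum is at most \<open>y\<close>.\<close>

lemma seedless_moment:
  fixes S :: "'i \<Rightarrow> 'a set"
  assumes "finite N" "finite J" "0 \<le> p" "p \<le> 1" "0 \<le> y"
    and S: "\<And>i. i \<in> J \<Longrightarrow> S i \<subseteq> N" "\<And>i. i \<in> J \<Longrightarrow> card (S i) \<le> r"
    and Z: "\<And>E T. E \<subseteq> N \<Longrightarrow> Z E \<Longrightarrow> T \<subseteq> E \<Longrightarrow> card T \<le> r * l \<Longrightarrow> (\<Sum>i\<in>J. p ^ card (S i - T)) \<le> y"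
  shows "T \<subseteq> N \<Longrightarrow> card T + r * k \<le> r * l \<Longrightarrow>
    subset_mean p N (\<lambda>E. of_bool (T \<subseteq> E) * (of_bool (Z E) * (\<Sum>i\<in>J. of_bool (S i \<subseteq> E)) ^ k)) \<le> p ^ card T * y ^ k"
proof (induction k arbitrary: T)
  case 0
  have "subset_mean p N (\<lambda>E. of_bool (T \<subseteq> E) * (of_bool (Z E) * (\<Sum>i\<in>J. of_bool (S i \<subseteq> E)) ^ 0))
      \<le> subset_mean p N (\<lambda>E. of_bool (T \<subseteq> E))"
    using assms by (intro subset_mean_mono) auto
  then show ?case using subset_mean_superset[OF assms(1) 0(1)] by simp
next
  case (Suc k)
  show ?case
  proof (cases "(\<Sum>i\<in>J. p ^ card (S i - T)) \<le> y")
    \<comment> \<open>Here \<open>T\<close> is itself a seed, small enough by the budget in the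
      second premise, so no \<open>E\<close> with \<open>Z E\<close> contains it and the integrand
      vanishes.\<close>
    case False
    have "subset_mean p N (\<lambda>E. of_bool (T \<subseteq> E) * (of_bool (Z E) * (\<Sum>i\<in>J. of_bool (S i \<subseteq> E)) ^ Suc k)) = subset_mean p N (\<lambda>E. 0)"
      using Z[of _ T] Suc.prems False by (intro subset_mean_cong) auto
    also have "\<dots> = 0" by (simp add: subset_mean_def)
    finally show ?thesis using assms by simp
  next
    case True
    have "subset_mean p N (\<lambda>E. of_bool (T \<subseteq> E) * (of_bool (Z E) * (\<Sum>i\<in>J. of_bool (S i \<subseteq> E)) ^ Suc k)) =
      subset_mean p N (\<lambda>E. \<Sum>i\<in>J. of_bool (T \<union> S i \<subseteq> E) * (of_bool (Z E) * (\<Sum>i\<in>J. of_bool (S i \<subseteq> E)) ^ k))"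
      by (rule subset_mean_cong) (auto simp: sum_distrib_left sum_distrib_right intro!: sum.cong)
    also have "\<dots> \<le> (\<Sum>i\<in>J. p ^ card (T \<union> S i) * y ^ k)"
      unfolding subset_mean_sum
    proof (rule sum_mono)
      fix i assume i: "i \<in> J"
      have "card (T \<union> S i) + r * k \<le> card T + card (S i) + r * k" using card_Un_le by simp
      also have "\<dots> \<le> r * l" using S(2)[OF i] Suc.prems(2) by simp
      finally show "subset_mean p N (\<lambda>E. of_bool (T \<union> S i \<subseteq> E) * (of_bool (Z E) * (\<Sum>i\<in>J. of_bool (S i \<subseteq> E)) ^ k))
         \<le> p ^ card (T \<union> S i) * y ^ k"
        using S(1)[OF i] Suc.prems(1) by (intro Suc.IH) auto
    qed
    \<comment> \<open>The exponent splits as \<open>card T + card (S i - T)\<close>; the last sum is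
      the mean of the next factor conditional on \<open>T\<close> being present.\<close>
    also have "\<dots> = p ^ card T * y ^ k * (\<Sum>i\<in>J. p ^ card (S i - T))"
      unfolding sum_distrib_left
    proof (rule sum.cong[OF refl])
      fix i assume i: "i \<in> J"
      have "card (T \<union> S i) = card (T \<union> (S i - T))" by simp
      also have "\<dots> = card T + card (S i - T)"
        using finite_subset[OF S(1)[OF i] assms(1)] finite_subset[OF Suc.prems(1) assms(1)]
        by (intro card_Un_disjoint) auto
      finally show "p ^ card (T \<union> S i) * y ^ k = p ^ card T * y ^ k * p ^ card (S i - T)"
        by (simp add: power_add)
    qed
    also have "\<dots> \<le> p ^ card T * y ^ k * y"
      using True assms by (intro mult_left_mono) auto
    finally show ?thesis by (simp only: mult.assoc power_Suc2)
  qed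
qed

text \<open>On the event without a seed, \<open>seedless_moment\<close> started at the empty set
  bounds the \<open>l\<close>-th moment by y^l, and Markov's inequality gives (y/z)^l. At most
  \<open>l\<close> sets of at most \<open>r\<close> elements get revealed, whence the size bound for
  seeds.\<close>

lemma subset_mean_seed_tail:
  fixes S :: "'i \<Rightarrow> 'a set"
  assumes "finite N" "finite J" "0 \<le> p" "p \<le> 1" "0 \<le> y" "0 < z"
    and S: "\<And>i. i \<in> J \<Longrightarrow> S i \<subseteq> N" "\<And>i. i \<in> J \<Longrightarrow> card (S i) \<le> r"
  shows "subset_mean p N (\<lambda>E. of_bool (z \<le> (\<Sum>i\<in>J. of_bool (S i \<subseteq> E)))) \<le>
    subset_mean p N (\<lambda>E. of_bool (\<exists>T\<subseteq>E. card T \<le> r * l \<and> y < (\<Sum>i\<in>J. p ^ card (S i - T)))) + (y / z) ^ l"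
proof -
  define X where "X = (\<lambda>E. \<Sum>i\<in>J. (of_bool (S i \<subseteq> E) :: real))"
  define Z where "Z = (\<lambda>E. \<not> (\<exists>T\<subseteq>E. card T \<le> r * l \<and> y < (\<Sum>i\<in>J. p ^ card (S i - T))))"
  have X0: "X E \<ge> 0" for E by (simp add: X_def sum_nonneg)
  have "subset_mean p N (\<lambda>E. of_bool (z \<le> X E)) \<le>
    subset_mean p N (\<lambda>E. of_bool (\<not> Z E) + of_bool (z ^ l \<le> of_bool (Z E) * X E ^ l))"
    using assms X0 by (intro subset_mean_mono) (auto simp: of_bool_def intro: power_mono)
  also have "\<dots> = subset_mean p N (\<lambda>E. of_bool (\<not> Z E)) + subset_mean p N (\<lambda>E. of_bool (z ^ l \<le> of_bool (Z E) * X E ^ l))"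
    by (rule subset_mean_add)
  also have "subset_mean p N (\<lambda>E. of_bool (z ^ l \<le> of_bool (Z E) * X E ^ l)) \<le>
      subset_mean p N (\<lambda>E. of_bool (Z E) * X E ^ l) / z ^ l"
    using assms X0 by (intro subset_mean_markov) auto
  also have "subset_mean p N (\<lambda>E. of_bool (Z E) * X E ^ l) \<le> y ^ l"
    using seedless_moment[of N J p y S r Z l "{}" l] assms
    by (force simp: Z_def X_def not_less)
  finally show ?thesis
    using assms by (simp only: X_def Z_def power_divide not_not) (simp add: divide_right_mono)
qed

subsection \<open>Traces of matrix words\<close>

type_synonym 'a mx = "'a \<Rightarrow> 'a \<Rightarrow> real"

text \<open>Matrices are total functions and only the summation index is restricted to
  \<open>I\<close>. The empty word is therefore a unit only at indices in \<open>I\<close>, which is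
  why identities for words carry the assumption \<open>i \<in> I\<close>.\<close>

definition mmul :: "'a set \<Rightarrow> 'a mx \<Rightarrow> 'a mx \<Rightarrow> 'a mx" where
  "mmul I A B = (\<lambda>i j. \<Sum>k\<in>I. A i k * B k j)"

definition wprod :: "'a set \<Rightarrow> 'a mx list \<Rightarrow> 'a mx" where
  "wprod I Ms = foldr (mmul I) Ms (\<lambda>i j. of_bool (i = j))"

definition mtrace :: "'a set \<Rightarrow> 'a mx \<Rightarrow> real" where
  "mtrace I A = (\<Sum>i\<in>I. A i i)"

definition mtotal :: "'a set \<Rightarrow> 'a mx \<Rightarrow> real" where
  "mtotal I A = (\<Sum>i\<in>I. \<Sum>j\<in>I. A i j)"

abbreviation mpow :: "'a set \<Rightarrow> 'a mx \<Rightarrow> nat \<Rightarrow> 'a mx" where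
  "mpow I A k \<equiv> wprod I (replicate k A)"

definition symm :: "'a mx \<Rightarrow> bool" where "symm A \<longleftrightarrow> (\<forall>i j. A i j = A j i)"

definition nonneg_mx :: "'a mx \<Rightarrow> bool" where "nonneg_mx A \<longleftrightarrow> (\<forall>i j. 0 \<le> A i j)"

lemma mmul_assoc: "mmul I (mmul I A B) C = mmul I A (mmul I B C)"
  unfolding mmul_def sum_distrib_left sum_distrib_right
  by (intro ext, subst sum.swap) (simp add: mult.assoc)

lemma wprod_Nil: "wprod I [] i j = of_bool (i = j)"
  by (simp add: wprod_def)

lemma wprod_Cons: "wprod I (M # Ms) = mmul I M (wprod I Ms)"
  by (simp add: wprod_def)

lemma wprod_Cons_entry: "wprod I (M # Ms) i j = (\<Sum>k\<in>I. M i k * wprod I Ms k j)"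
  by (simp add: wprod_Cons mmul_def)

lemma mmul_id_left: "finite I \<Longrightarrow> i \<in> I \<Longrightarrow> mmul I (wprod I []) B i j = B i j"
  by (simp add: mmul_def wprod_Nil of_bool_def if_distrib[of "\<lambda>x. x * _"] sum.delta' cong: if_cong)

lemma mmul_cong:
  assumes "\<And>k. k \<in> I \<Longrightarrow> A i k = A' i k" "\<And>k. k \<in> I \<Longrightarrow> B k j = B' k j"
  shows "mmul I A B i j = mmul I A' B' i j"
  using assms by (simp add: mmul_def)

lemma wprod_append:
  assumes "finite I" "i \<in> I"
  shows "wprod I (xs @ ys) i j = mmul I (wprod I xs) (wprod I ys) i j"
  using assms(2)
proof (induction xs arbitrary: i)
  case Nil
  then show ?case using mmul_id_left[OF assms(1)] by fastforce
next
  case (Cons M xs)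
  have "wprod I ((M # xs) @ ys) i j = mmul I M (mmul I (wprod I xs) (wprod I ys)) i j"
    using Cons.IH by (auto simp: wprod_Cons intro: mmul_cong)
  then show ?case by (simp only: mmul_assoc[symmetric] wprod_Cons)
qed

lemma wprod_single: "finite I \<Longrightarrow> j \<in> I \<Longrightarrow> wprod I [M] i j = M i j"
  by (simp add: wprod_Cons_entry wprod_Nil of_bool_def if_distrib[of "\<lambda>x. _ * x"] sum.delta' cong: if_cong)

lemma wprod_snoc:
  assumes "finite I" "i \<in> I" "j \<in> I"
  shows "wprod I (xs @ [M]) i j = (\<Sum>k\<in>I. wprod I xs i k * M k j)"
  using assms by (simp add: wprod_append mmul_def wprod_single)

lemma mtrace_cong: "(\<And>i. i \<in> I \<Longrightarrow> A i i = B i i) \<Longrightarrow> mtrace I A = mtrace I B"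
  by (simp add: mtrace_def)

lemma mtotal_cong: "(\<And>i j. i \<in> I \<Longrightarrow> j \<in> I \<Longrightarrow> A i j = B i j) \<Longrightarrow> mtotal I A = mtotal I B"
  by (simp add: mtotal_def)

lemma mtrace_mmul_comm: "mtrace I (mmul I A B) = mtrace I (mmul I B A)"
  unfolding mtrace_def mmul_def by (subst sum.swap) (simp add: mult.commute)

lemma mtrace_wprod_append: "finite I \<Longrightarrow> mtrace I (wprod I (xs @ ys)) = mtrace I (mmul I (wprod I xs) (wprod I ys))"
  by (rule mtrace_cong) (rule wprod_append)

lemma mtrace_wprod_append_sum:
  "finite I \<Longrightarrow> mtrace I (wprod I (xs @ ys)) = (\<Sum>i\<in>I. \<Sum>j\<in>I. wprod I xs i j * wprod I ys j i)"
  by (subst mtrace_wprod_append) (simp_all add: mtrace_def mmul_def)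

lemma mtrace_wprod_rot: "finite I \<Longrightarrow> mtrace I (wprod I (xs @ ys)) = mtrace I (wprod I (ys @ xs))"
  by (simp add: mtrace_wprod_append mtrace_mmul_comm)

lemma wprod_rev:
  assumes "finite I" "\<And>M. M \<in> set xs \<Longrightarrow> symm M" "i \<in> I" "j \<in> I"
  shows "wprod I (rev xs) i j = wprod I xs j i"
  using assms(2-)
proof (induction xs arbitrary: i j)
  case Nil
  then show ?case by (auto simp: wprod_Nil of_bool_def)
next
  case (Cons M xs)
  have "wprod I (rev (M # xs)) i j = (\<Sum>k\<in>I. wprod I (rev xs) i k * M k j)"
    using Cons.prems assms(1) by (simp add: wprod_snoc)
  also have "\<dots> = (\<Sum>k\<in>I. M j k * wprod I xs k i)"
  proof (rule sum.cong[OF refl])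
    fix k assume "k \<in> I"
    then have "wprod I (rev xs) i k = wprod I xs k i" using Cons by auto
    moreover have "M k j = M j k" using Cons.prems(1)[of M] by (simp add: symm_def)
    ultimately show "wprod I (rev xs) i k * M k j = M j k * wprod I xs k i" by simp
  qed
  finally show ?case by (simp add: wprod_Cons_entry)
qed

text \<open>For symmetric letters the reversed word is the transpose, so this trace is a squared
  Hilbert-Schmidt norm. It is the source of positivity when entries may be negative.\<close>

lemma mtrace_reflect:
  assumes "finite I" "\<And>M. M \<in> set xs \<Longrightarrow> symm M"
  shows "mtrace I (wprod I (xs @ rev xs)) = (\<Sum>i\<in>I. \<Sum>j\<in>I. (wprod I xs i j)\<^sup>2)"
  using assms by (simp add: mtrace_wprod_append_sum wprod_rev power2_eq_square)

lemma mtrace_reflect_nonneg: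
  assumes "finite I" "\<And>M. M \<in> set xs \<Longrightarrow> symm M"
  shows "0 \<le> mtrace I (wprod I (xs @ rev xs))"
  using mtrace_reflect[OF assms] by (auto intro!: sum_nonneg)

text \<open>The Hilbert-Schmidt inner product of two partial words. Both bounds are again traces of
  words over the same letters, so an extremal argument can iterate the inequality.\<close>

lemma mtrace_Cauchy_Schwarz:
  assumes "finite I" "\<And>M. M \<in> set xs \<union> set ys \<Longrightarrow> symm M"
  shows "(mtrace I (wprod I (xs @ ys)))\<^sup>2 \<le> mtrace I (wprod I (xs @ rev xs)) * mtrace I (wprod I (ys @ rev ys))"
proof -
  let ?a = "\<lambda>(i,j). wprod I xs i j" and ?b = "\<lambda>(i,j). wprod I ys j i"
  have 1: "mtrace I (wprod I (xs @ ys)) = (\<Sum>x\<in>I \<times> I. ?a x * ?b x)"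
    using assms(1) by (simp add: mtrace_wprod_append_sum sum.cartesian_product case_prod_beta)
  have "mtrace I (wprod I (ys @ rev ys)) = (\<Sum>j\<in>I. \<Sum>i\<in>I. (wprod I ys i j)\<^sup>2)"
    using mtrace_reflect[of I ys] assms by (subst sum.swap) auto
  then have 2: "mtrace I (wprod I (ys @ rev ys)) = (\<Sum>x\<in>I \<times> I. (?b x)\<^sup>2)"
    by (simp add: sum.cartesian_product case_prod_beta)
  have 3: "mtrace I (wprod I (xs @ rev xs)) = (\<Sum>x\<in>I \<times> I. (?a x)\<^sup>2)"
    using mtrace_reflect[of I xs] assms by (simp add: sum.cartesian_product case_prod_beta)
  show ?thesis unfolding 1 2 3 by (rule Cauchy_Schwarz_ineq_sum)
qed

text \<open>Among the words of length \<open>2 * t\<close> with the largest normalised trace pick one with the longest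
  constant initial run; reflecting about the middle of that run doubles it.\<close>

lemma trace_Hoelder:
  fixes f :: "'b::finite \<Rightarrow> 'a mx"
  assumes I: "finite I" and sy: "\<And>b. symm (f b)" and c: "\<And>b. c b > 0"
    and t: "t \<ge> 1" and tr: "\<And>b. mtrace I (mpow I (f b) (2 * t)) \<le> c b ^ (2 * t)"
    and w: "length w = 2 * t"
  shows "\<bar>mtrace I (wprod I (map f w))\<bar> \<le> (\<Prod>x\<leftarrow>w. c x)"
proof -
  define g where "g w = \<bar>mtrace I (wprod I (map f w))\<bar> / (\<Prod>x\<leftarrow>w. c x)" for w
  define W where "W = {w :: 'b list. length w = 2 * t}"
  define M where "M = Max (g ` W)"
  have pc: "(\<Prod>x\<leftarrow>w. c x) > 0" for w using c by (induction w) auto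
  have g0: "g w \<ge> 0" for w unfolding g_def using pc[of w] by simp
  have grot: "g (u @ v) = g (v @ u)" for u v
    by (simp add: g_def mtrace_wprod_rot[OF I, of "map f u"] mult.commute)
  have gCS: "(g (u @ v))\<^sup>2 \<le> g (u @ rev u) * g (v @ rev v)" for u v
  proof -
    have a: "\<bar>mtrace I (wprod I (map f u @ rev (map f u)))\<bar> = mtrace I (wprod I (map f u @ rev (map f u)))" for u
      by (intro abs_of_nonneg mtrace_reflect_nonneg[OF I]) (use sy in auto)
    have "(mtrace I (wprod I (map f u @ map f v)))\<^sup>2 \<le>
      \<bar>mtrace I (wprod I (map f u @ rev (map f u)))\<bar> * \<bar>mtrace I (wprod I (map f v @ rev (map f v)))\<bar>"
      unfolding a using sy by (intro mtrace_Cauchy_Schwarz[OF I]) auto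
    moreover have r: "(\<Prod>x\<leftarrow>rev u. c x) = (\<Prod>x\<leftarrow>u. c x)" for u
      by (induction u) auto
    ultimately show ?thesis
      using pc[of u] pc[of v]
      by (simp add: g_def power_divide rev_map r power2_eq_square divide_simps mult_ac)
  qed
  have fin: "finite W" unfolding W_def
    using finite_lists_length_eq[of "UNIV :: 'b set" "2 * t"] by simp
  have ne: "w \<in> W" using w by (simp add: W_def)
  have gM: "g u \<le> M" if "u \<in> W" for u
    unfolding M_def using that fin by simp
  \<comment> \<open>For a maximal word with halves u and v, Cauchy-Schwarz gives M^2 <= g (u @ rev
    u) * M, so reflecting the first half preserves maximality. The step cancels \<open>M\<close>,
    hence the case distinction.\<close>
  have refl: "g (u @ rev u) = M" if "length u = t" "length v = t" "g (u @ v) = M" for u v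
  proof (cases "M > 0")
    case True
    have "M * M \<le> g (u @ rev u) * g (v @ rev v)" using gCS[of u v] that(3) by (simp add: power2_eq_square)
    also have "\<dots> \<le> g (u @ rev u) * M"
      using that g0 by (intro mult_left_mono gM) (auto simp: W_def)
    finally have "M \<le> g (u @ rev u)" using True by simp
    moreover have "g (u @ rev u) \<le> M" using that by (intro gM) (auto simp: W_def)
    ultimately show ?thesis by simp
  next
    case False
    moreover have "g (u @ rev u) \<le> M" using that by (intro gM) (auto simp: W_def)
    ultimately show ?thesis using g0[of "u @ rev u"] g0[of "u @ v"] that(3) by simp
  qed
  \<comment> \<open>Since traces are invariant under rotation, a constant run may be assumed to
    stand at the front.\<close>
  define Q where "Q s \<longleftrightarrow> (\<exists>a u. length u + s = 2 * t \<and> g (replicate s a @ u) = M)" for s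
  have "M \<in> g ` W" unfolding M_def using fin ne by (intro Max_in) auto
  then obtain w0 where w0: "length w0 = 2 * t" "g w0 = M" by (auto simp: W_def)
  then obtain a u where au: "w0 = a # u" using t by (cases w0) auto
  have Q1: "Q 1" unfolding Q_def
    using w0 au by (intro exI[of _ a] exI[of _ u]) auto
  have Qle: "s \<le> 2 * t" if "Q s" for s using that unfolding Q_def by auto
  define s where "s = (GREATEST s. Q s)"
  have Qs: "Q s" unfolding s_def by (rule GreatestI_nat[of Q, OF Q1]) (use Qle in auto)
  have smax: "r \<le> s" if "Q r" for r
    unfolding s_def by (rule Greatest_le_nat[of Q, OF that]) (use Qle in auto)
  have s1: "s \<ge> 1" using smax[OF Q1] .
  have "s = 2 * t"
  proof (rule ccontr)
    assume "s \<noteq> 2 * t"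
    then have s2: "s < 2 * t" using Qle[OF Qs] by simp
    obtain a u where u: "length u + s = 2 * t" "g (replicate s a @ u) = M" using Qs Q_def by auto
    show False
    proof (cases "s \<ge> t")
      \<comment> \<open>The run fills the first half, whose reflection is then the constant word of
        full length.\<close>
      case True
      define v where "v = replicate (s - t) a @ u"
      have v: "replicate s a @ u = replicate t a @ v" using True
        by (simp add: v_def flip: append_assoc replicate_add)
      have "g (replicate t a @ rev (replicate t a)) = M"
        by (rule refl[of _ v]) (use u v True in \<open>auto simp: v_def\<close>)
      then have "Q (2 * t)" unfolding Q_def
        by (intro exI[of _ a] exI[of _ "[]"]) (auto simp: mult_2 replicate_add)
      then show False using smax s2 by fastforce
    next
      \<comment> \<open>Rotate until the run ends the first half \<open>u2 @ replicate s a\<close>.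
        The reflection contains a run of length 2s, and another rotation brings it to the
        front.\<close>
      case False
      define u1 where "u1 = take t u"
      define u2 where "u2 = drop t u"
      have uu: "u = u1 @ u2" by (simp add: u1_def u2_def)
      have len: "length u1 = t" "length u2 = t - s" using u(1) False by (auto simp: u1_def u2_def)
      have "g ((replicate s a @ u1) @ u2) = M" using u(2) uu by simp
      then have "g ((u2 @ replicate s a) @ u1) = M"
        by (subst (asm) grot) simp
      then have "g ((u2 @ replicate s a) @ rev (u2 @ replicate s a)) = M"
        using len False by (intro refl) auto
      then have "g (u2 @ (replicate (2 * s) a @ rev u2)) = M"
        by (simp add: mult_2 replicate_add)
      then have "g ((replicate (2 * s) a @ rev u2) @ u2) = M"
        by (subst (asm) grot) simp
      then have "Q (2 * s)" unfolding Q_def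
        using len False by (intro exI[of _ a] exI[of _ "rev u2 @ u2"]) auto
      then show False using smax[of "2 * s"] s1 by auto
    qed
  qed
  then obtain a where "g (replicate (2 * t) a) = M" using Qs unfolding Q_def by auto
  \<comment> \<open>For a constant word this is the hypothesis \<open>tr\<close>; positivity of the
    reflected trace removes the absolute value.\<close>
  moreover have "g (replicate (2 * t) a) \<le> 1"
  proof -
    have "mtrace I (wprod I (replicate t (f a) @ rev (replicate t (f a)))) \<ge> 0"
      using sy by (intro mtrace_reflect_nonneg[OF I]) auto
    then have "\<bar>mtrace I (mpow I (f a) (2 * t))\<bar> \<le> c a ^ (2 * t)"
      using tr[of a] by (simp add: mult_2 replicate_add)
    then show ?thesis using c[of a] by (simp add: g_def)
  qed
  ultimately have "g w \<le> 1" using gM[OF ne] by simp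
  then show ?thesis using pc[of w] by (simp add: g_def)
qed

section \<open>Word expansions and the Schatten norm\<close>

definition bwords :: "nat \<Rightarrow> bool list set" where "bwords k = {w. length w = k}"

lemma bwords_0: "bwords 0 = {[]}" by (simp add: bwords_def)

lemma finite_bwords: "finite (bwords k)"
  unfolding bwords_def using finite_lists_length_eq[of "UNIV :: bool set" k] by simp

lemma card_bwords: "card (bwords k) = 2 ^ k"
  unfolding bwords_def using card_lists_length_eq[of "UNIV :: bool set" k] by simp

lemma sum_bwords_Suc:
  "(\<Sum>w\<in>bwords (Suc k). F w) = (\<Sum>w\<in>bwords k. F (True # w) + (F (False # w) :: real))"
proof -
  have "bwords (Suc k) = Cons True ` bwords k \<union> Cons False ` bwords k"
    by (auto simp: bwords_def length_Suc_conv image_iff)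
  then have "(\<Sum>w\<in>bwords (Suc k). F w) = (\<Sum>w\<in>Cons True ` bwords k. F w) + (\<Sum>w\<in>Cons False ` bwords k. F w)"
    using finite_bwords by (simp, intro sum.union_disjoint) auto
  then show ?thesis by (simp add: sum.reindex sum.distrib)
qed

lemma mpow_add_expand:
  fixes f :: "bool \<Rightarrow> 'a mx"
  shows
  "mpow I (\<lambda>i j. f True i j + f False i j) k i j = (\<Sum>w\<in>bwords k. wprod I (map f w) i j)"
proof (induction k arbitrary: i)
  case 0
  then show ?case by (simp add: bwords_0)
next
  case (Suc k)
  have "mpow I (\<lambda>i j. f True i j + f False i j) (Suc k) i j =
    (\<Sum>m\<in>I. (f True i m + f False i m) * (\<Sum>w\<in>bwords k. wprod I (map f w) m j))"
    by (simp add: wprod_Cons_entry Suc)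
  also have "\<dots> = (\<Sum>w\<in>bwords k. (\<Sum>m\<in>I. f True i m * wprod I (map f w) m j) + (\<Sum>m\<in>I. f False i m * wprod I (map f w) m j))"
    by (simp add: sum_distrib_left distrib_right sum.distrib sum.swap[of _ I])
  also have "\<dots> = (\<Sum>w\<in>bwords (Suc k). wprod I (map f w) i j)"
    by (simp add: sum_bwords_Suc wprod_Cons_entry)
  finally show ?case .
qed

lemma mtrace_add_expand:
  fixes f :: "bool \<Rightarrow> 'a mx"
  shows
  "mtrace I (mpow I (\<lambda>i j. f True i j + f False i j) k) = (\<Sum>w\<in>bwords k. mtrace I (wprod I (map f w)))"
  unfolding mtrace_def mpow_add_expand by (rule sum.swap)

lemma sum_bwords_prod: "(\<Sum>w\<in>bwords k. \<Prod>x\<leftarrow>w. c x) = (c True + c False :: real) ^ k"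
  by (induction k) (simp_all add: bwords_0 sum_bwords_Suc sum.distrib algebra_simps flip: sum_distrib_left)

text \<open>\<open>trace_Hoelder\<close> bounds every word of the expansion by the product of the
  norms of its letters, and these products add up to the binomial. The norms enter as arbitrary
  positive upper bounds, so neither roots nor vanishing norms occur.\<close>

lemma Schatten_triangle:
  assumes "finite I" "symm A" "symm B" "t \<ge> 1" "a > 0" "b > 0"
    and "mtrace I (mpow I A (2 * t)) \<le> a ^ (2 * t)" "mtrace I (mpow I B (2 * t)) \<le> b ^ (2 * t)"
  shows "mtrace I (mpow I (\<lambda>i j. A i j + B i j) (2 * t)) \<le> (a + b) ^ (2 * t)"
proof -
  define f where "f x = (if x then A else B)" for x
  define c where "c x = (if x then a else b)" for x
  have "mtrace I (mpow I (\<lambda>i j. A i j + B i j) (2 * t)) = (\<Sum>w\<in>bwords (2 * t). mtrace I (wprod I (map f w)))"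
    using mtrace_add_expand[where f = f and I = I and k = "2 * t"] by (simp add: f_def)
  also have "\<dots> \<le> (\<Sum>w\<in>bwords (2 * t). \<Prod>x\<leftarrow>w. c x)"
  proof (rule sum_mono)
    fix w assume "w \<in> bwords (2 * t)"
    then have "\<bar>mtrace I (wprod I (map f w))\<bar> \<le> (\<Prod>x\<leftarrow>w. c x)"
      using assms by (intro trace_Hoelder[where t = t]) (auto simp: f_def c_def bwords_def)
    then show "mtrace I (wprod I (map f w)) \<le> (\<Prod>x\<leftarrow>w. c x)" by simp
  qed
  also have "\<dots> = (a + b) ^ (2 * t)" by (simp add: sum_bwords_prod c_def)
  finally show ?thesis .
qed

lemma mtrace_even_nonneg: "finite I \<Longrightarrow> symm A \<Longrightarrow> 0 \<le> mtrace I (mpow I A (2 * t))"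
  using mtrace_reflect_nonneg[of I "replicate t A"] by (simp add: mult_2 replicate_add)

text \<open>If the norm of \<open>B\<close> is at most \<epsilon> times the bound for
  \<open>A\<close>, the first term suffices; otherwise \<open>A\<close> is small compared with
  \<open>B\<close> and the second term does. The result is linear in the trace of \<open>B\<close>
  and can thus be averaged over a random \<open>B\<close>.\<close>

lemma Schatten_perturb:
  assumes "finite I" "symm A" "symm B" "t \<ge> 1" "\<beta> > 0" "\<epsilon> > 0"
    and A: "mtrace I (mpow I A (2 * t)) \<le> \<beta>"
  shows "mtrace I (mpow I (\<lambda>i j. A i j + B i j) (2 * t)) \<le>
    (1 + \<epsilon>) ^ (2 * t) * \<beta> + (1 + 1 / \<epsilon>) ^ (2 * t) * mtrace I (mpow I B (2 * t))"
proof -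
  define b where "b = root (2 * t) \<beta>"
  define m where "m = mtrace I (mpow I B (2 * t))"
  have b: "b > 0" "b ^ (2 * t) = \<beta>" using assms by (auto simp: b_def)
  have m: "m \<ge> 0" unfolding m_def using assms by (intro mtrace_even_nonneg) auto
  define w where "w = root (2 * t) m"
  have w: "w \<ge> 0" "w ^ (2 * t) = m" using assms m by (auto simp: w_def)
  show ?thesis
  proof (cases "w \<le> \<epsilon> * b")
    case True
    then have "w ^ (2 * t) \<le> (\<epsilon> * b) ^ (2 * t)" using w by (intro power_mono) auto
    then have "mtrace I (mpow I (\<lambda>i j. A i j + B i j) (2 * t)) \<le> (b + \<epsilon> * b) ^ (2 * t)"
      using assms b w m_def by (intro Schatten_triangle) auto
    also have "b + \<epsilon> * b = (1 + \<epsilon>) * b" by (simp add: algebra_simps)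
    also have "((1 + \<epsilon>) * b) ^ (2 * t) = (1 + \<epsilon>) ^ (2 * t) * \<beta>" by (simp only: power_mult_distrib b(2))
    finally show ?thesis using m assms unfolding m_def by (simp add: add_increasing2)
  next
    case False
    then have wp: "w > 0" using mult_pos_pos[OF assms(6) b(1)] by linarith
    have "b \<le> w / \<epsilon>" using False assms by (simp add: field_simps)
    then have "b ^ (2 * t) \<le> (w / \<epsilon>) ^ (2 * t)" using b by (intro power_mono) auto
    then have "mtrace I (mpow I (\<lambda>i j. A i j + B i j) (2 * t)) \<le> (w / \<epsilon> + w) ^ (2 * t)"
      using assms b w m_def wp by (intro Schatten_triangle) auto
    also have "w / \<epsilon> + w = (1 + 1 / \<epsilon>) * w" by (simp add: algebra_simps)
    also have "((1 + 1 / \<epsilon>) * w) ^ (2 * t) = (1 + 1 / \<epsilon>) ^ (2 * t) * m" by (simp only: power_mult_distrib w(2))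
    finally show ?thesis using assms unfolding m_def by (simp add: add_increasing)
  qed
qed

lemma mpow_telescope:
  "mpow I X k i j - mpow I Y k i j =
    (\<Sum>l<k. wprod I (replicate l X @ (\<lambda>i j. X i j - Y i j) # replicate (k - 1 - l) Y) i j)"
proof (induction k arbitrary: i)
  case 0
  then show ?case by simp
next
  case (Suc k)
  have "mpow I X (Suc k) i j - mpow I Y (Suc k) i j =
    (\<Sum>m\<in>I. (X i m - Y i m) * mpow I Y k m j) + (\<Sum>m\<in>I. X i m * (mpow I X k m j - mpow I Y k m j))"
    by (simp add: wprod_Cons_entry algebra_simps sum.distrib sum_subtractf)
  also have "(\<Sum>m\<in>I. X i m * (mpow I X k m j - mpow I Y k m j)) =
    (\<Sum>l<k. wprod I (replicate (Suc l) X @ (\<lambda>i j. X i j - Y i j) # replicate (k - 1 - l) Y) i j)"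
    by (simp add: Suc sum_distrib_left wprod_Cons_entry) (rule sum.swap)
  finally show ?case
    by (subst sum.lessThan_Suc_shift) (simp add: wprod_Cons_entry)
qed

text \<open>Rotation brings the difference to the front, where its entries weight the end points of
  the remaining walk.\<close>

lemma mtrace_telescope:
  assumes "finite I"
  shows "mtrace I (mpow I X k) - mtrace I (mpow I Y k) =
    (\<Sum>l<k. mtrace I (wprod I ((\<lambda>i j. X i j - Y i j) # replicate (k - 1 - l) Y @ replicate l X)))"
proof -
  have "mtrace I (mpow I X k) - mtrace I (mpow I Y k) =
     (\<Sum>l<k. mtrace I (wprod I (replicate l X @ (\<lambda>i j. X i j - Y i j) # replicate (k - 1 - l) Y)))"
    unfolding mtrace_def by (simp add: mpow_telescope flip: sum_subtractf) (rule sum.swap)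
  then show ?thesis using mtrace_wprod_rot[OF assms, of "replicate _ X"] by simp
qed

subsection \<open>Walks in nonnegative matrices\<close>

lemma wprod_nonneg: "(\<And>M. M \<in> set Ms \<Longrightarrow> nonneg_mx M) \<Longrightarrow> 0 \<le> wprod I Ms i j"
  by (induction Ms arbitrary: i)
    (auto simp: wprod_Nil wprod_Cons_entry nonneg_mx_def intro!: sum_nonneg mult_nonneg_nonneg)

lemma mpow_nonneg: "nonneg_mx A \<Longrightarrow> 0 \<le> mpow I A k i j"
  by (rule wprod_nonneg) auto

lemma wprod_mono:
  assumes "list_all2 (\<lambda>A B. \<forall>i j. 0 \<le> A i j \<and> A i j \<le> B i j) As Bs"
  shows "wprod I As i j \<le> wprod I Bs i j"
  using assms
proof (induction arbitrary: i rule: list_all2_induct)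
  case Nil
  then show ?case by simp
next
  case (Cons A As B Bs)
  have "0 \<le> wprod I As k j" for k
    using Cons.hyps(2) by (intro wprod_nonneg) (auto simp: nonneg_mx_def list_all2_conv_all_nth in_set_conv_nth)
  then show ?case
    using Cons by (auto simp: wprod_Cons_entry intro!: sum_mono mult_mono) (meson order_trans)
qed

lemma wprod_subset:
  assumes "finite I" "I' \<subseteq> I" "\<And>M. M \<in> set Ms \<Longrightarrow> nonneg_mx M"
  shows "wprod I' Ms i j \<le> wprod I Ms i j"
  using assms(3)
proof (induction Ms arbitrary: i)
  case (Cons M Ms)
  have "(\<Sum>k\<in>I'. M i k * wprod I' Ms k j) \<le> (\<Sum>k\<in>I'. M i k * wprod I Ms k j)"
    using Cons by (intro sum_mono mult_left_mono) (auto simp: nonneg_mx_def)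
  also have "\<dots> \<le> (\<Sum>k\<in>I. M i k * wprod I Ms k j)"
    using Cons.prems assms wprod_nonneg[of Ms]
    by (intro sum_mono2 mult_nonneg_nonneg) (auto simp: nonneg_mx_def)
  finally show ?case by (simp add: wprod_Cons_entry)
qed (simp add: wprod_Nil)

lemma mtrace_mono: "(\<And>i. i \<in> I \<Longrightarrow> A i i \<le> B i i) \<Longrightarrow> mtrace I A \<le> mtrace I B"
  by (simp add: mtrace_def sum_mono)

lemma mtotal_nonneg: "(\<And>i j. 0 \<le> A i j) \<Longrightarrow> 0 \<le> mtotal I A"
  by (simp add: mtotal_def sum_nonneg)

lemma mtrace_mpow_subset:
  assumes "finite I" "I' \<subseteq> I" "nonneg_mx A"
  shows "mtrace I' (mpow I' A k) \<le> mtrace I (mpow I A k)"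
proof -
  have "mtrace I' (mpow I' A k) \<le> mtrace I' (mpow I A k)"
    using assms by (intro mtrace_mono wprod_subset) auto
  also have "\<dots> \<le> mtrace I (mpow I A k)"
    unfolding mtrace_def using assms by (intro sum_mono2 mpow_nonneg) auto
  finally show ?thesis .
qed

lemma mpow_mono:
  assumes "\<And>i j. 0 \<le> A i j" "\<And>i j. A i j \<le> B i j"
  shows "mpow I A k i j \<le> mpow I B k i j"
  using assms by (intro wprod_mono) (auto simp: list_all2_conv_all_nth)

text \<open>Of all words in the expansion only the two constant ones are kept; for
  \<open>k = 0\<close> they would coincide.\<close>

lemma mtrace_superadd:
  assumes "nonneg_mx A" "nonneg_mx B" "k \<ge> 1"
  shows "mtrace I (mpow I A k) + mtrace I (mpow I B k) \<le> mtrace I (mpow I (\<lambda>i j. A i j + B i j) k)"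
proof -
  define f where "f x = (if x then A else B)" for x
  have ne: "replicate k True \<noteq> replicate k False" using assms(3) by auto
  have "mtrace I (mpow I A k) + mtrace I (mpow I B k) =
     (\<Sum>w\<in>{replicate k True, replicate k False}. mtrace I (wprod I (map f w)))"
    using ne by (simp add: f_def)
  also have "\<dots> \<le> (\<Sum>w\<in>bwords k. mtrace I (wprod I (map f w)))"
    using assms finite_bwords[of k] unfolding mtrace_def
    by (intro sum_mono2 sum_nonneg wprod_nonneg) (auto simp: bwords_def f_def)
  also have "\<dots> = mtrace I (mpow I (\<lambda>i j. A i j + B i j) k)"
    using mtrace_add_expand[where f = f and I = I and k = k] by (simp add: f_def)
  finally show ?thesis .
qed

lemma sum_product_4:
  "(\<Sum>i\<in>S. \<Sum>j\<in>T. \<Sum>x\<in>U. \<Sum>y\<in>V. f i x * g y j) =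
   (\<Sum>i\<in>S. \<Sum>x\<in>U. f i x) * (\<Sum>j\<in>T. \<Sum>y\<in>V. g y j :: real)"
  unfolding sum_product[symmetric] by (simp only: sum_distrib_left[symmetric] sum_distrib_right[symmetric])

section \<open>Walks counted through every other edge\<close>

context
  fixes I :: "'a set" and A :: "'a mx"
  assumes I: "finite I" and A0: "\<And>i j. 0 \<le> A i j" and A1: "\<And>i j. A i j \<le> 1"
begin

lemma nA: "nonneg_mx A" using A0 by (simp add: nonneg_mx_def)

text \<open>Bounding the middle entry by 1 cuts the walk: the first edge and the remainder are then
  chosen independently. Iterated, this charges a walk \<open>mtotal I A\<close> for every second
  edge only.\<close>

lemma mtotal_Cons2_le:
  assumes "\<And>M. M \<in> set Ms \<Longrightarrow> nonneg_mx M"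
  shows "mtotal I (wprod I (A # A # Ms)) \<le> mtotal I A * mtotal I (wprod I Ms)"
proof -
  have "mtotal I (wprod I (A # A # Ms)) = (\<Sum>i\<in>I. \<Sum>j\<in>I. \<Sum>x\<in>I. \<Sum>y\<in>I. A i x * (A x y * wprod I Ms y j))"
    by (simp add: mtotal_def wprod_Cons_entry sum_distrib_left)
  also have "\<dots> \<le> (\<Sum>i\<in>I. \<Sum>j\<in>I. \<Sum>x\<in>I. \<Sum>y\<in>I. A i x * wprod I Ms y j)"
    using A0 A1 wprod_nonneg[of Ms, OF assms]
    by (intro sum_mono mult_left_mono mult_left_le_one_le) auto
  also have "\<dots> = (\<Sum>i\<in>I. \<Sum>x\<in>I. A i x) * (\<Sum>j\<in>I. \<Sum>y\<in>I. wprod I Ms y j)"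
    by (rule sum_product_4)
  also have "\<dots> = mtotal I A * mtotal I (wprod I Ms)"
    unfolding mtotal_def by (rule arg_cong[OF sum.swap])
  finally show ?thesis .
qed

lemma mtotal_single: "mtotal I (wprod I [A]) = mtotal I A"
  by (intro mtotal_cong wprod_single I)

lemma mtotal_odd: "mtotal I (mpow I A (2 * k + 1)) \<le> mtotal I A ^ (k + 1)"
proof (induction k)
  case 0
  then show ?case by (simp add: mtotal_single)
next
  case (Suc k)
  have "mtotal I (mpow I A (2 * Suc k + 1)) \<le> mtotal I A * mtotal I (mpow I A (2 * k + 1))"
  proof -
    have "replicate (2 * Suc k + 1) A = A # A # replicate (2 * k + 1) A" by simp
    then show ?thesis using nA by (simp only:) (rule mtotal_Cons2_le, auto)
  qed
  also have "\<dots> \<le> mtotal I A * mtotal I A ^ (k + 1)"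
    using Suc A0 by (intro mult_left_mono mtotal_nonneg) auto
  finally show ?case by simp
qed

lemma mpow_sandwich:
  assumes "i \<in> I" "j \<in> I"
  shows "mpow I A (k + 2) i j = (\<Sum>x\<in>I. \<Sum>y\<in>I. A i x * mpow I A k x y * A y j)"
proof -
  have "replicate (k + 2) A = A # (replicate k A @ [A])" by (simp add: replicate_append_same)
  then have "mpow I A (k + 2) i j = (\<Sum>x\<in>I. A i x * wprod I (replicate k A @ [A]) x j)"
    by (simp only: wprod_Cons_entry)
  also have "\<dots> = (\<Sum>x\<in>I. \<Sum>y\<in>I. A i x * mpow I A k x y * A y j)"
    using assms I by (intro sum.cong refl) (simp add: wprod_snoc sum_distrib_left mult.assoc)
  finally show ?thesis .
qed

text \<open>With both end points prescribed, the outer two edges are bounded by 1; of the inner walk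
  of length 2k - 1, every other edge is counted, which makes \<open>k\<close>.\<close>

lemma entry_odd:
  assumes "i \<in> I" "j \<in> I"
  shows "mpow I A (2 * k + 1) i j \<le> mtotal I A ^ k"
proof (cases k)
  case 0
  then show ?thesis using A1 assms I by (simp add: wprod_single)
next
  case (Suc l)
  have "mpow I A (2 * k + 1) i j = (\<Sum>x\<in>I. \<Sum>y\<in>I. A i x * mpow I A (2 * l + 1) x y * A y j)"
    using mpow_sandwich[OF assms, of "2 * l + 1"] Suc by simp
  also have "\<dots> \<le> (\<Sum>x\<in>I. \<Sum>y\<in>I. mpow I A (2 * l + 1) x y)"
  proof (intro sum_mono)
    fix x y
    have 0: "0 \<le> mpow I A (2 * l + 1) x y" using mpow_nonneg[OF nA] .
    have "A i x * mpow I A (2 * l + 1) x y * A y j \<le> 1 * mpow I A (2 * l + 1) x y * 1"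
      using A0 A1 0 by (intro mult_mono mult_nonneg_nonneg) auto
    then show "A i x * mpow I A (2 * l + 1) x y * A y j \<le> mpow I A (2 * l + 1) x y" by simp
  qed
  also have "\<dots> \<le> mtotal I A ^ k" using mtotal_odd[of l] Suc by (simp add: mtotal_def)
  finally show ?thesis .
qed

text \<open>Compared with \<open>entry_odd\<close>, one factor \<open>mtotal I A\<close> is traded
  for the product of the two end degrees by keeping the outer edges. This is where the degree
  condition of a core comes from.\<close>

lemma entry_odd_degree:
  assumes "i \<in> I" "j \<in> I"
  shows "mpow I A (2 * k + 3) i j \<le> (\<Sum>x\<in>I. A i x) * (\<Sum>y\<in>I. A y j) * mtotal I A ^ k"
proof -
  have "mpow I A (2 * k + 3) i j = (\<Sum>x\<in>I. \<Sum>y\<in>I. A i x * mpow I A (2 * k + 1) x y * A y j)"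
    using mpow_sandwich[OF assms, of "2 * k + 1"] by (simp add: numeral_3_eq_3)
  also have "\<dots> \<le> (\<Sum>x\<in>I. \<Sum>y\<in>I. A i x * mtotal I A ^ k * A y j)"
    using A0 by (intro sum_mono mult_right_mono mult_left_mono entry_odd) auto
  also have "\<dots> = (\<Sum>x\<in>I. A i x) * (\<Sum>y\<in>I. A y j) * mtotal I A ^ k"
  proof -
    have "(\<Sum>x\<in>I. \<Sum>y\<in>I. A i x * mtotal I A ^ k * A y j) = (\<Sum>x\<in>I. \<Sum>y\<in>I. A i x * A y j * mtotal I A ^ k)"
      by (simp only: mult_ac)
    then show ?thesis unfolding sum_product by (simp only: sum_distrib_right)
  qed
  finally show ?thesis .
qed

text \<open>For a graph with e edges the bound is (2e)^t, which a clique attains to leading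
  order.\<close>

lemma mtrace_even_le:
  assumes "t \<ge> 1"
  shows "mtrace I (mpow I A (2 * t)) \<le> mtotal I A ^ t"
proof -
  obtain s where t: "t = Suc s" using assms by (cases t) auto
  have "mtrace I (mpow I A (2 * t)) = (\<Sum>i\<in>I. \<Sum>j\<in>I. A i j * mpow I A (2 * s + 1) j i)"
    by (simp add: t mtrace_def wprod_Cons_entry)
  also have "\<dots> \<le> (\<Sum>i\<in>I. \<Sum>j\<in>I. A i j * mtotal I A ^ s)"
    using A0 entry_odd[of _ _ s] by (intro sum_mono mult_left_mono) auto
  also have "\<dots> = mtotal I A ^ t" by (simp add: t mtotal_def sum_distrib_right)
  finally show ?thesis .
qed

text \<open>In each telescoped word the deleted entry is a step from \<open>i\<close> to
  \<open>j\<close>, and the other 2t - 1 steps lead back inside \<open>A\<close>. Hence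
  \<open>C\<close> is asked for at altered entries only.\<close>

lemma mtrace_delete_le:
  assumes B: "\<And>i j. 0 \<le> B i j" "\<And>i j. B i j \<le> A i j"
    and C: "\<And>i j. i \<in> I \<Longrightarrow> j \<in> I \<Longrightarrow> A i j \<noteq> B i j \<Longrightarrow> mpow I A (2 * t - 1) j i \<le> C i j"
  shows "mtrace I (mpow I A (2 * t)) - mtrace I (mpow I B (2 * t)) \<le> real (2 * t) * (\<Sum>i\<in>I. \<Sum>j\<in>I. (A i j - B i j) * C i j)"
proof -
  let ?D = "\<lambda>i j. A i j - B i j"
  have "mtrace I (wprod I (?D # replicate (2 * t - 1 - l) B @ replicate l A)) \<le> (\<Sum>i\<in>I. \<Sum>j\<in>I. ?D i j * C i j)"
    if l: "l < 2 * t" for l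
  proof -
    have rep: "replicate (2 * t - 1) A = replicate (2 * t - 1 - l) A @ replicate l A"
      using l by (simp flip: replicate_add)
    have *: "wprod I (replicate (2 * t - 1 - l) B @ replicate l A) j i \<le> mpow I A (2 * t - 1) j i" for i j
      unfolding rep using B A0 by (intro wprod_mono list_all2_appendI) (auto simp: list_all2_conv_all_nth)
    have "?D i j * wprod I (replicate (2 * t - 1 - l) B @ replicate l A) j i \<le> ?D i j * C i j"
      if "i \<in> I" "j \<in> I" for i j
    proof (cases "A i j = B i j")
      case False
      then show ?thesis using C[OF that False] B(2)[of i j] *[of j i] by (intro mult_left_mono) auto
    qed simp
    then show ?thesis unfolding mtrace_def wprod_Cons_entry by (intro sum_mono) auto
  qed
  then have "mtrace I (mpow I A (2 * t)) - mtrace I (mpow I B (2 * t)) \<le> (\<Sum>l<2 * t. (\<Sum>i\<in>I. \<Sum>j\<in>I. ?D i j * C i j))"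
    unfolding mtrace_telescope[OF I] by (intro sum_mono) auto
  then show ?thesis by simp
qed

lemma mtrace_delete_mass:
  assumes "\<And>i j. 0 \<le> B i j" "\<And>i j. B i j \<le> A i j" "t \<ge> 1"
  shows "mtrace I (mpow I A (2 * t)) - mtrace I (mpow I B (2 * t)) \<le>
    real (2 * t) * (mtotal I A - mtotal I B) * mtotal I A ^ (t - 1)"
proof -
  have "2 * t - 1 = 2 * (t - 1) + 1" using assms(3) by simp
  then have "mpow I A (2 * t - 1) j i \<le> mtotal I A ^ (t - 1)" if "i \<in> I" "j \<in> I" for i j
    using entry_odd[OF that(2,1), of "t - 1"] by (simp only:)
  then have "mtrace I (mpow I A (2 * t)) - mtrace I (mpow I B (2 * t)) \<le>
     real (2 * t) * (\<Sum>i\<in>I. \<Sum>j\<in>I. (A i j - B i j) * mtotal I A ^ (t - 1))"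
    using assms by (intro mtrace_delete_le) auto
  also have "(\<Sum>i\<in>I. \<Sum>j\<in>I. (A i j - B i j) * mtotal I A ^ (t - 1)) = (mtotal I A - mtotal I B) * mtotal I A ^ (t - 1)"
    unfolding sum_distrib_right[symmetric] by (simp only: mtotal_def sum_subtractf)
  finally show ?thesis by (simp only: mult.assoc)
qed

text \<open>In a bipartite graph every other edge of a walk leaves the starting side, so it is
  counted in one orientation. This gives s^t per side, where \<open>mtrace_even_le\<close> would
  give (2s)^t in total; a star attains it.\<close>

lemma mtrace_bipartite_le:
  assumes Z: "\<And>i j. A i j \<noteq> 0 \<Longrightarrow> i \<in> Z \<longleftrightarrow> j \<notin> Z" and t: "t \<ge> 1"
    and s: "(\<Sum>i\<in>I \<inter> Z. \<Sum>j\<in>I. A i j) \<le> s" "(\<Sum>i\<in>I - Z. \<Sum>j\<in>I. A i j) \<le> s"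
  shows "mtrace I (mpow I A (2 * t)) \<le> 2 * s ^ t"
proof -
  have s0: "0 \<le> s" using s(1) A0 by (meson order_trans sum_nonneg)
  \<comment> \<open>\<open>Y\<close> will be either side of the bipartition; the induction needs
    only that it is closed under two steps.\<close>
  have *: "(\<Sum>i\<in>Y. \<Sum>j\<in>I. mpow I A (2 * k + 1) i j) \<le> s ^ (k + 1)"
    if Y: "Y \<subseteq> I" "\<forall>i\<in>Y. \<forall>x. \<forall>y\<in>I. A i x \<noteq> 0 \<longrightarrow> A x y \<noteq> 0 \<longrightarrow> y \<in> Y"
      "(\<Sum>i\<in>Y. \<Sum>j\<in>I. A i j) \<le> s" for Y k
  proof (induction k)
    case 0
    have "(\<Sum>i\<in>Y. \<Sum>j\<in>I. mpow I A (2 * 0 + 1) i j) = (\<Sum>i\<in>Y. \<Sum>j\<in>I. A i j)"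
      using Y(1) I by (intro sum.cong refl) (auto simp: wprod_single)
    then show ?case using Y(3) by simp
  next
    case (Suc k)
    let ?P = "mpow I A (2 * k + 1)"
    have P0: "0 \<le> ?P y j" for y j by (rule mpow_nonneg[OF nA])
    have fY: "finite Y" using Y(1) I finite_subset by blast
    have "(\<Sum>i\<in>Y. \<Sum>j\<in>I. mpow I A (2 * Suc k + 1) i j) =
        (\<Sum>i\<in>Y. \<Sum>j\<in>I. \<Sum>x\<in>I. \<Sum>y\<in>I. A i x * A x y * ?P y j)"
      by (simp add: wprod_Cons_entry sum_distrib_left mult.assoc)
    also have "\<dots> \<le> (\<Sum>i\<in>Y. \<Sum>j\<in>I. \<Sum>x\<in>I. \<Sum>y\<in>Y. A i x * ?P y j)"
    proof (intro sum_mono)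
      fix i j x assume i: "i \<in> Y"
      have "(\<Sum>y\<in>I. A i x * A x y * ?P y j) \<le> (\<Sum>y\<in>I. if y \<in> Y then A i x * ?P y j else 0)"
      proof (intro sum_mono)
        fix y assume "y \<in> I"
        then have "y \<notin> Y \<Longrightarrow> A i x * A x y = 0" using Y(2) i by fastforce
        moreover have "A i x * A x y \<le> A i x" using A0 A1 by (simp add: mult_left_le)
        ultimately show "A i x * A x y * ?P y j \<le> (if y \<in> Y then A i x * ?P y j else 0)"
          using P0 mult_right_mono by fastforce
      qed
      also have "\<dots> = (\<Sum>y\<in>Y. A i x * ?P y j)"
        using I Y(1) by (simp add: sum.If_cases Int_absorb1)
      finally show "(\<Sum>y\<in>I. A i x * A x y * ?P y j) \<le> (\<Sum>y\<in>Y. A i x * ?P y j)" .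
    qed
    also have "\<dots> = (\<Sum>i\<in>Y. \<Sum>x\<in>I. A i x) * (\<Sum>y\<in>Y. \<Sum>j\<in>I. ?P y j)"
      unfolding sum_product_4 by (rule arg_cong[OF sum.swap])
    also have "\<dots> \<le> s * s ^ (k + 1)"
      using Suc Y(3) A0 P0 s0 by (intro mult_mono sum_nonneg) auto
    finally show ?case by simp
  qed
  obtain k where k: "t = k + 1" using t by (metis le_add_diff_inverse2)
  have half: "(\<Sum>i\<in>Y. mpow I A (2 * t) i i) \<le> s ^ t"
    if Y: "Y \<subseteq> I" "\<forall>i\<in>Y. \<forall>x. \<forall>y\<in>I. A i x \<noteq> 0 \<longrightarrow> A x y \<noteq> 0 \<longrightarrow> y \<in> Y"
      "(\<Sum>i\<in>Y. \<Sum>j\<in>I. A i j) \<le> s" for Y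
  proof -
    have "(\<Sum>i\<in>Y. mpow I A (2 * t) i i) \<le> (\<Sum>i\<in>Y. \<Sum>j\<in>I. mpow I A (2 * k + 1) i j)"
    proof (intro sum_mono)
      fix i assume i: "i \<in> Y"
      have "replicate (2 * t) A = replicate (2 * k + 1) A @ [A]"
        by (simp add: k replicate_append_same)
      then have "mpow I A (2 * t) i i = (\<Sum>j\<in>I. mpow I A (2 * k + 1) i j * A j i)"
        using i Y(1) I by (simp only: wprod_snoc subset_iff)
      also have "\<dots> \<le> (\<Sum>j\<in>I. mpow I A (2 * k + 1) i j)"
        by (intro sum_mono mult_left_le A1 mpow_nonneg[OF nA])
      finally show "mpow I A (2 * t) i i \<le> (\<Sum>j\<in>I. mpow I A (2 * k + 1) i j)" .
    qed
    then show ?thesis using *[OF Y, where k = k] k by simp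
  qed
  have "mtrace I (mpow I A (2 * t)) = (\<Sum>i\<in>I \<inter> Z. mpow I A (2 * t) i i) + (\<Sum>i\<in>I - Z. mpow I A (2 * t) i i)"
    unfolding mtrace_def using I by (subst sum.Int_Diff[of I _ Z]) auto
  also have "\<dots> \<le> s ^ t + s ^ t"
    using s Z by (intro add_mono half) blast+
  finally show ?thesis by simp
qed

text \<open>A star with L leaves has nonzero eigenvalues sqrt L and - sqrt L. The proof counts
  instead: L^t closed walks from the centre and L^(t-1) from each leaf.\<close>

lemma mtrace_star_ge:
  assumes L: "L \<subseteq> I" "v \<in> I" "v \<notin> L" "\<And>l. l \<in> L \<Longrightarrow> A v l = 1 \<and> A l v = 1" and t: "t \<ge> 1"
  shows "2 * real (card L) ^ t \<le> mtrace I (mpow I A (2 * t))"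
proof -
  have fL: "finite L" using L(1) I finite_subset by blast
  have vv: "real (card L) ^ k \<le> mpow I A (2 * k) v v" for k
  proof (induction k)
    case 0
    then show ?case by (simp add: wprod_Nil)
  next
    case (Suc k)
    let ?P = "mpow I A (2 * k)"
    have P0: "0 \<le> ?P x y" for x y by (rule mpow_nonneg[OF nA])
    have "real (card L) ^ Suc k \<le> (\<Sum>l\<in>L. A v l * (A l v * ?P v v))"
      using Suc L(4) by (simp add: mult_left_mono)
    also have "\<dots> \<le> (\<Sum>x\<in>I. A v x * (A x v * ?P v v))"
      using I L(1) A0 P0 by (intro sum_mono2 mult_nonneg_nonneg) auto
    also have "\<dots> \<le> (\<Sum>x\<in>I. A v x * (\<Sum>y\<in>I. A x y * ?P y v))"
      using I L(2) A0 P0 by (intro sum_mono mult_left_mono member_le_sum[of v I]) auto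
    finally show ?case by (simp add: wprod_Cons_entry)
  qed
  obtain k where k: "t = k + 1" using t by (metis le_add_diff_inverse2)
  have ll: "real (card L) ^ k \<le> mpow I A (2 * t) l l" if l: "l \<in> L" for l
  proof -
    let ?P = "mpow I A (2 * k)"
    have P0: "0 \<le> ?P x y" for x y by (rule mpow_nonneg[OF nA])
    have lI: "l \<in> I" using l L by auto
    have "real (card L) ^ k \<le> A l v * ?P v v * A v l" using vv[of k] L(4)[OF l] by simp
    also have "\<dots> \<le> (\<Sum>y\<in>I. A l v * ?P v y * A y l)"
      using I L(2) A0 P0 by (intro member_le_sum[of v I "\<lambda>y. A l v * ?P v y * A y l"]) auto
    also have "\<dots> \<le> (\<Sum>x\<in>I. \<Sum>y\<in>I. A l x * ?P x y * A y l)"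
      using I L(2) A0 P0 by (intro member_le_sum[of v I "\<lambda>x. \<Sum>y\<in>I. A l x * ?P x y * A y l"] sum_nonneg) auto
    finally show ?thesis using mpow_sandwich[OF lI lI, of "2 * k"] k by simp
  qed
  have "2 * real (card L) ^ t = real (card L) ^ t + (\<Sum>l\<in>L. real (card L) ^ k)" by (simp add: k)
  also have "\<dots> \<le> mpow I A (2 * t) v v + (\<Sum>l\<in>L. mpow I A (2 * t) l l)"
    by (intro add_mono vv sum_mono ll)
  also have "\<dots> = (\<Sum>i\<in>insert v L. mpow I A (2 * t) i i)" using fL L(3) by simp
  also have "\<dots> \<le> mtrace I (mpow I A (2 * t))"
    unfolding mtrace_def using I L by (intro sum_mono2 mpow_nonneg[OF nA]) auto
  finally show ?thesis .
qed

end

text \<open>A nonconstant cyclic word passes somewhere from \<open>True\<close> to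
  \<open>False\<close>; rotation moves that place to the front.\<close>

lemma bword_rotate_transition:
  assumes I: "finite I" and w: "w \<in> bwords k" "w \<noteq> replicate k True" "w \<noteq> replicate k False"
  obtains z where "k = length z + 2" "mtrace I (wprod I (map f w)) = mtrace I (wprod I (map f (True # False # z)))"
proof -
  have len: "length w = k" using w by (simp add: bwords_def)
  have *: "x = replicate (length x) b" if "(\<not> b) \<notin> set x" for x b
  proof (rule replicate_eqI)
    fix c assume c: "c \<in> set x"
    show "c = b" by (cases c; cases b) (use that c in auto)
  qed simp
  have "True \<in> set w" using *[of False w] w(3) len by auto
  then obtain u v where uv: "w = u @ True # v" by (meson split_list)
  define y where "y = v @ u"
  have 1: "mtrace I (wprod I (map f w)) = mtrace I (wprod I (map f (True # y)))"
    using mtrace_wprod_rot[OF I, of "map f u" "map f (True # v)"] by (simp add: uv y_def)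
  have "False \<in> set y"
  proof (rule ccontr)
    assume "False \<notin> set y"
    then have "w = replicate k True" unfolding len[symmetric] by (intro *) (auto simp: y_def uv)
    then show False using w(2) by contradiction
  qed
  then obtain a b where ab: "y = a @ False # b" "False \<notin> set a" by (meson split_list_first)
  \<comment> \<open>All letters before the first \<open>False\<close> are \<open>True\<close>, so
    the leading \<open>True\<close> can be moved directly in front of it.\<close>
  have "a = replicate (length a) True" using *[of True a] ab(2) by simp
  then have a: "True # a = a @ [True]" by (metis replicate_append_same)
  have "True # y = (True # a) @ False # b" by (simp add: ab(1))
  also have "\<dots> = a @ True # False # b" by (simp only: a) simp
  finally have "mtrace I (wprod I (map f (True # y))) = mtrace I (wprod I (map f a @ map f (True # False # b)))"
    by (simp only: map_append)
  also have "\<dots> = mtrace I (wprod I (map f (True # False # (b @ a))))"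
    by (subst mtrace_wprod_rot[OF I]) simp
  finally have 2: "mtrace I (wprod I (map f w)) = mtrace I (wprod I (map f (True # False # (b @ a))))"
    using 1 by simp
  have "length y = length a + length b + 1" using ab(1) by simp
  then have "k = length (b @ a) + 2" using len by (simp add: uv y_def)
  then show thesis using 2 by (rule that)
qed

text \<open>A mixed word passes from \<open>A\<close> to \<open>B\<close> at some vertex
  \<open>h\<close> and then goes on to some \<open>x\<close>. Only pairs from \<open>U\<close> and
  \<open>H\<close> qualify, and given such a pair the other steps cost a power of the total one
  lower than a free closed walk.\<close>

lemma mtrace_mixed_le:
  assumes I: "finite I" and A: "nonneg_mx A" and B: "nonneg_mx B"
    and AB: "\<And>i j. A i j + B i j \<le> 1" and t: "t \<ge> 2"
    and U: "finite U" "finite H" "\<And>l h x. A l h \<noteq> 0 \<Longrightarrow> B h x \<noteq> 0 \<Longrightarrow> h \<in> U \<and> x \<in> H"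
  shows "mtrace I (mpow I (\<lambda>i j. A i j + B i j) (2 * t)) \<le>
    mtrace I (mpow I A (2 * t)) + mtrace I (mpow I B (2 * t)) +
    2 ^ (2 * t) * (real (card U) * real (card H) * mtotal I (\<lambda>i j. A i j + B i j) ^ (t - 1))"
proof -
  define X where "X = (\<lambda>i j. A i j + B i j)"
  define f where "f b = (if b then A else B)" for b
  have A0: "0 \<le> A i j" "0 \<le> B i j" for i j using A B by (auto simp: nonneg_mx_def)
  have X0: "0 \<le> X i j" "X i j \<le> 1" for i j using A0[of i j] AB[of i j] by (auto simp: X_def)
  have le1: "A i j \<le> 1" "B i j \<le> 1" for i j using A0[of i j] AB[of i j] by linarith+
  define C where "C = real (card U) * real (card H) * mtotal I X ^ (t - 1)"
  have C0: "0 \<le> C" unfolding C_def using X0 by (intro mult_nonneg_nonneg zero_le_power mtotal_nonneg) auto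
  define W where "W = bwords (2 * t) - {replicate (2 * t) True, replicate (2 * t) False}"
  have mix: "mtrace I (wprod I (map f w)) \<le> C" if w: "w \<in> W" for w
  proof -
    obtain z where z: "2 * t = length z + 2"
      "mtrace I (wprod I (map f w)) = mtrace I (wprod I (map f (True # False # z)))"
      using bword_rotate_transition[OF I, where w = w and k = "2 * t" and f = f] w by (auto simp: W_def)
    have lz: "length z = (2 * (t - 2) + 1) + 1" using z(1) t by simp
    let ?P = "mpow I X (length z)"
    have P0: "0 \<le> ?P x y" for x y using X0 by (intro mpow_nonneg) (simp add: nonneg_mx_def)
    have zP: "wprod I (map f z) x l \<le> ?P x l" for x l
      using A0 by (intro wprod_mono) (auto simp: list_all2_conv_all_nth f_def X_def)
    \<comment> \<open>From the fixed start \<open>x\<close> the first of the 2t - 2 steps is bounded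
      by 1; among the remaining 2t - 3 steps, t - 1 edges are counted.\<close>
    have row: "(\<Sum>l\<in>I. ?P x l) \<le> mtotal I X ^ (t - 1)" for x
    proof -
      let ?Q = "mpow I X (2 * (t - 2) + 1)"
      have Q0: "0 \<le> ?Q x y" for x y using X0 by (intro mpow_nonneg) (simp add: nonneg_mx_def)
      have "(\<Sum>l\<in>I. ?P x l) = (\<Sum>l\<in>I. \<Sum>y\<in>I. X x y * ?Q y l)"
        unfolding lz by (simp add: wprod_Cons_entry)
      also have "\<dots> \<le> (\<Sum>l\<in>I. \<Sum>y\<in>I. ?Q y l)"
        using X0 Q0 by (intro sum_mono mult_left_le_one_le) auto
      also have "\<dots> = mtotal I ?Q" unfolding mtotal_def by (rule sum.swap)
      also have "\<dots> \<le> mtotal I X ^ (t - 2 + 1)" using X0 by (intro mtotal_odd I) auto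
      finally show ?thesis using t by (simp add: Suc_diff_Suc numeral_2_eq_2)
    qed
    have "mtrace I (wprod I (map f (True # False # z))) =
      (\<Sum>l\<in>I. \<Sum>h\<in>I. \<Sum>x\<in>I. A l h * (B h x * wprod I (map f z) x l))"
      by (simp add: mtrace_def f_def wprod_Cons_entry sum_distrib_left)
    also have "\<dots> \<le> (\<Sum>l\<in>I. \<Sum>h\<in>I. \<Sum>x\<in>I. if h \<in> U \<and> x \<in> H then ?P x l else 0)"
    proof (intro sum_mono)
      fix l h x
      show "A l h * (B h x * wprod I (map f z) x l) \<le> (if h \<in> U \<and> x \<in> H then ?P x l else 0)"
      proof (cases "A l h \<noteq> 0 \<and> B h x \<noteq> 0")
        case True
        have "A l h * (B h x * wprod I (map f z) x l) \<le> 1 * (1 * ?P x l)"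
          using A0 le1 zP P0 by (intro mult_mono' mult_nonneg_nonneg) (auto intro!: wprod_nonneg simp: f_def A B)
        then show ?thesis using True U(3) by auto
      next
        case False
        then show ?thesis using P0 by auto
      qed
    qed
    also have "\<dots> = (\<Sum>h\<in>I \<inter> U. \<Sum>x\<in>I \<inter> H. \<Sum>l\<in>I. ?P x l)"
    proof -
      have "(\<Sum>l\<in>I. \<Sum>h\<in>I. \<Sum>x\<in>I. if h \<in> U \<and> x \<in> H then ?P x l else 0) =
        (\<Sum>h\<in>I. \<Sum>x\<in>I. \<Sum>l\<in>I. if h \<in> U then (if x \<in> H then ?P x l else 0) else 0)"
      proof -
        have "(\<Sum>l\<in>I. \<Sum>h\<in>I. \<Sum>x\<in>I. if h \<in> U \<and> x \<in> H then ?P x l else 0) =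
          (\<Sum>h\<in>I. \<Sum>l\<in>I. \<Sum>x\<in>I. if h \<in> U \<and> x \<in> H then ?P x l else 0)" by (rule sum.swap)
        also have "\<dots> = (\<Sum>h\<in>I. \<Sum>x\<in>I. \<Sum>l\<in>I. if h \<in> U \<and> x \<in> H then ?P x l else 0)"
          by (intro sum.cong refl sum.swap)
        also have "\<dots> = (\<Sum>h\<in>I. \<Sum>x\<in>I. \<Sum>l\<in>I. if h \<in> U then (if x \<in> H then ?P x l else 0) else 0)"
          by (intro sum.cong refl) auto
        finally show ?thesis .
      qed
      also have "\<dots> = (\<Sum>h\<in>I. if h \<in> U then (\<Sum>x\<in>I. if x \<in> H then (\<Sum>l\<in>I. ?P x l) else 0) else 0)"
        by (intro sum.cong refl) (auto intro!: sum.cong)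
      also have "\<dots> = (\<Sum>h\<in>I \<inter> U. \<Sum>x\<in>I \<inter> H. \<Sum>l\<in>I. ?P x l)"
        by (simp only: sum.inter_restrict[OF I])
      finally show ?thesis .
    qed
    also have "\<dots> \<le> (\<Sum>h\<in>I \<inter> U. \<Sum>x\<in>I \<inter> H. mtotal I X ^ (t - 1))"
      by (intro sum_mono row)
    also have "\<dots> = real (card (I \<inter> U)) * (real (card (I \<inter> H)) * mtotal I X ^ (t - 1))" by simp
    also have "\<dots> \<le> real (card U) * (real (card H) * mtotal I X ^ (t - 1))"
      using U X0 by (intro mult_mono) (auto intro!: card_mono mult_nonneg_nonneg zero_le_power mtotal_nonneg)
    finally show ?thesis using z by (simp add: C_def mult.assoc)
  qed
  have ne: "replicate (2 * t) True \<noteq> replicate (2 * t) False" using t by auto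
  have sub: "{replicate (2 * t) True, replicate (2 * t) False} \<subseteq> bwords (2 * t)" by (auto simp: bwords_def)
  have "mtrace I (mpow I X (2 * t)) = (\<Sum>w\<in>bwords (2 * t). mtrace I (wprod I (map f w)))"
    using mtrace_add_expand[where f = f and I = I and k = "2 * t"] by (simp add: f_def X_def)
  also have "\<dots> = (\<Sum>w\<in>W. mtrace I (wprod I (map f w))) +
      (\<Sum>w\<in>{replicate (2 * t) True, replicate (2 * t) False}. mtrace I (wprod I (map f w)))"
    unfolding W_def by (rule sum.subset_diff[OF sub finite_bwords])
  also have "(\<Sum>w\<in>{replicate (2 * t) True, replicate (2 * t) False}. mtrace I (wprod I (map f w))) =
      mtrace I (mpow I A (2 * t)) + mtrace I (mpow I B (2 * t))"
    using ne by (simp add: f_def)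
  also have "(\<Sum>w\<in>W. mtrace I (wprod I (map f w))) \<le> (\<Sum>w\<in>W. C)" by (intro sum_mono mix)
  also have "\<dots> = real (card W) * C" by simp
  also have "\<dots> \<le> 2 ^ (2 * t) * C"
  proof (intro mult_right_mono C0)
    have "card W \<le> card (bwords (2 * t))" unfolding W_def by (intro card_mono finite_bwords) auto
    then show "real (card W) \<le> 2 ^ (2 * t)" by (simp add: card_bwords)
  qed
  finally show ?thesis by (simp add: X_def C_def)
qed

section \<open>Sidorenko's inequality for even cycles\<close>

context
  fixes I :: "'a set" and A :: "'a mx"
  assumes I: "finite I" and sA: "symm A"
begin

definition rowsum :: "nat \<Rightarrow> 'a \<Rightarrow> real" where "rowsum k i = (\<Sum>j\<in>I. mpow I A k i j)"

lemma mtotal_add_rowsum: "mtotal I (mpow I A (a + b)) = (\<Sum>m\<in>I. rowsum a m * rowsum b m)"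
proof -
  have "mtotal I (mpow I A (a + b)) = (\<Sum>i\<in>I. \<Sum>j\<in>I. \<Sum>m\<in>I. mpow I A a i m * mpow I A b m j)"
    unfolding mtotal_def replicate_add
    by (intro sum.cong refl) (simp add: wprod_append[OF I] mmul_def)
  also have "\<dots> = (\<Sum>i\<in>I. \<Sum>m\<in>I. mpow I A a i m * rowsum b m)"
    unfolding rowsum_def sum_distrib_left by (intro sum.cong refl sum.swap)
  also have "\<dots> = (\<Sum>m\<in>I. \<Sum>i\<in>I. mpow I A a i m * rowsum b m)"
    by (rule sum.swap)
  also have "\<dots> = (\<Sum>m\<in>I. (\<Sum>i\<in>I. mpow I A a m i) * rowsum b m)"
  proof (intro sum.cong refl)
    fix m assume m: "m \<in> I"
    have "mpow I A a i m = mpow I A a m i" if "i \<in> I" for i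
      using wprod_rev[OF I, of "replicate a A" i m] sA that m by simp
    then show "(\<Sum>i\<in>I. mpow I A a i m * rowsum b m) = (\<Sum>i\<in>I. mpow I A a m i) * rowsum b m"
      by (simp add: sum_distrib_right)
  qed
  finally show ?thesis by (simp add: rowsum_def)
qed

lemma mtotal_even: "mtotal I (mpow I A (2 * k)) = (\<Sum>m\<in>I. (rowsum k m)\<^sup>2)"
  using mtotal_add_rowsum[of k k] by (simp add: mult_2 power2_eq_square)

text \<open>By symmetry the walks of length a + b are the inner product of \<open>rowsum a\<close>
  and \<open>rowsum b\<close>. Split 2k + 2 as k + (k + 2) and apply Cauchy-Schwarz.\<close>

lemma mtotal_log_convex:
  "(mtotal I (mpow I A (2 * Suc k)))\<^sup>2 \<le> mtotal I (mpow I A (2 * k)) * mtotal I (mpow I A (2 * Suc (Suc k)))"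
proof -
  have "2 * Suc k = k + Suc (Suc k)" by simp
  then have "mtotal I (mpow I A (2 * Suc k)) = (\<Sum>m\<in>I. rowsum k m * rowsum (Suc (Suc k)) m)"
    using mtotal_add_rowsum[of k "Suc (Suc k)"] by (simp only:)
  then show ?thesis unfolding mtotal_even[of k] mtotal_even[of "Suc (Suc k)"]
    by (simp only: Cauchy_Schwarz_ineq_sum)
qed

text \<open>Log-convexity makes the ratios of consecutive even walk counts nondecreasing, so each is
  at least the first. The form without quotients allows for counts that vanish.\<close>

lemma mtotal_ratio_mono:
  "mtotal I (mpow I A (2 * k)) * mtotal I (mpow I A 2) \<le> mtotal I (mpow I A (2 * Suc k)) * mtotal I (mpow I A 0)"
proof (induction k)
  case 0
  then show ?case by (simp add: numeral_2_eq_2)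
next
  case (Suc k)
  define u where "u k = mtotal I (mpow I A (2 * k))" for k
  have u0: "u k \<ge> 0" for k unfolding u_def mtotal_even by (intro sum_nonneg) auto
  have IH: "u k * u 1 \<le> u (Suc k) * u 0" using Suc by (simp add: u_def)
  have lc: "(u (Suc k))\<^sup>2 \<le> u k * u (Suc (Suc k))" unfolding u_def by (rule mtotal_log_convex)
  have "u (Suc k) * u 1 \<le> u (Suc (Suc k)) * u 0"
  proof (cases "u k = 0 \<or> u (Suc k) = 0")
    case True
    then have "u (Suc k) = 0" using lc u0[of "Suc k"] by auto
    then show ?thesis using u0 by simp
  next
    case False
    then have pos: "u k > 0" "u (Suc k) > 0" using u0[of k] u0[of "Suc k"] by linarith+
    have "u k * (u (Suc k) * u 1) = u (Suc k) * (u k * u 1)" by simp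
    also have "\<dots> \<le> u (Suc k) * (u (Suc k) * u 0)" using IH pos by (intro mult_left_mono) auto
    also have "\<dots> = (u (Suc k))\<^sup>2 * u 0" by (simp add: power2_eq_square)
    also have "\<dots> \<le> u k * u (Suc (Suc k)) * u 0" using lc u0 by (intro mult_right_mono) auto
    finally show ?thesis using pos by (simp add: mult.assoc)
  qed
  then show ?case by (simp add: u_def numeral_2_eq_2)
qed

text \<open>Every ratio of consecutive even walk counts is at least the first one, which by
  Cauchy-Schwarz is at least the square of the average row sum.\<close>

lemma mtotal_power_ge:
  assumes ne: "I \<noteq> {}"
  shows "real (card I) * (mtotal I A / real (card I)) ^ (2 * k) \<le> mtotal I (mpow I A (2 * k))"
proof -
  define n where "n = real (card I)"
  have n: "n > 0" using ne I by (simp add: n_def card_gt_0_iff)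
  define u where "u k = mtotal I (mpow I A (2 * k))" for k
  have u0: "u k \<ge> 0" for k unfolding u_def mtotal_even by (intro sum_nonneg) auto
  have un: "u 0 = n" unfolding u_def mtotal_def n_def using I
    by (simp add: wprod_Nil of_bool_def sum.delta)
  have one: "mtotal I A = (\<Sum>m\<in>I. rowsum 0 m * rowsum 1 m)"
  proof -
    have "mtotal I A = mtotal I (mpow I A (0 + 1))" using I
      by (simp, intro mtotal_cong) (simp add: wprod_single)
    then show ?thesis unfolding mtotal_add_rowsum .
  qed
  have "(mtotal I A)\<^sup>2 \<le> u 0 * u 1"
    unfolding one u_def mtotal_even by (rule Cauchy_Schwarz_ineq_sum)
  then have u1: "(mtotal I A / n)\<^sup>2 \<le> u 1 / n" using n un by (simp add: power_divide power2_eq_square divide_simps mult_ac)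
  have "n * (u 1 / n) ^ k \<le> u k" for k
  proof (induction k)
    case 0
    then show ?case using un by simp
  next
    case (Suc k)
    have "u k * u 1 \<le> u (Suc k) * n" using mtotal_ratio_mono[of k] un by (simp add: u_def numeral_2_eq_2)
    then have "u k * (u 1 / n) \<le> u (Suc k)" using n by (simp add: field_simps)
    moreover have "n * (u 1 / n) ^ Suc k = (n * (u 1 / n) ^ k) * (u 1 / n)" by simp
    moreover have "\<dots> \<le> u k * (u 1 / n)" using Suc u0 n by (intro mult_right_mono) auto
    ultimately show ?case by linarith
  qed
  moreover have "((mtotal I A / n)\<^sup>2) ^ k \<le> (u 1 / n) ^ k" using u1 by (intro power_mono) auto
  ultimately show ?thesis unfolding n_def[symmetric] u_def[symmetric] power_mult
    using n by (meson mult_left_mono order_trans less_imp_le)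
qed

text \<open>The trace is the squared Hilbert-Schmidt norm of the \<open>t\<close>-th power;
  Cauchy-Schwarz in each row bounds it below by the number of walks of length 2t divided by
  \<open>card I\<close>.\<close>

lemma Sidorenko_even_cycle:
  assumes ne: "I \<noteq> {}"
  shows "(mtotal I A / real (card I)) ^ (2 * t) \<le> mtrace I (mpow I A (2 * t))"
proof -
  define n where "n = real (card I)"
  have n: "n > 0" using ne I by (simp add: n_def card_gt_0_iff)
  have "mtrace I (mpow I A (2 * t)) = (\<Sum>i\<in>I. \<Sum>j\<in>I. (mpow I A t i j)\<^sup>2)"
    using mtrace_reflect[OF I, of "replicate t A"] sA by (simp add: mult_2 replicate_add)
  moreover have "(rowsum t i)\<^sup>2 \<le> n * (\<Sum>j\<in>I. (mpow I A t i j)\<^sup>2)" for i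
    using Cauchy_Schwarz_ineq_sum[of "\<lambda>_. 1" "\<lambda>j. mpow I A t i j" I] by (simp add: rowsum_def n_def)
  then have "mtotal I (mpow I A (2 * t)) \<le> n * (\<Sum>i\<in>I. \<Sum>j\<in>I. (mpow I A t i j)\<^sup>2)"
    unfolding mtotal_even sum_distrib_left by (intro sum_mono)
  ultimately have "n * (mtotal I A / n) ^ (2 * t) \<le> n * mtrace I (mpow I A (2 * t))"
    using mtotal_power_ge[OF ne, of t] by (simp add: n_def)
  then show ?thesis using n by (simp add: n_def)
qed

end

section \<open>Adding a constant to every entry\<close>

lemma walk_bound:
  fixes A :: "'a mx"
  assumes I: "finite I" and A: "\<And>i j. 0 \<le> A i j" "\<And>i j. A i j \<le> 1"
    and s: "mtotal I A \<le> s\<^sup>2" "s \<ge> 1" and j: "j \<ge> 1"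
  shows "mtotal I (mpow I A j) \<le> s ^ (j + 2)"
  using j
proof (induction j rule: less_induct)
  case (less j)
  have nA: "nonneg_mx A" using A by (simp add: nonneg_mx_def)
  have A1: "mtotal I (wprod I [A]) = mtotal I A" by (rule mtotal_single[OF I A])
  have A0: "0 \<le> mtotal I A" using A by (intro mtotal_nonneg) auto
  consider "j = 1" | "j = 2" | k where "j = k + 2" "k \<ge> 1"
  proof -
    have "j = 1 \<or> j = 2 \<or> (j = (j - 2) + 2 \<and> j - 2 \<ge> 1)" using less.prems by arith
    then show thesis using that by blast
  qed
  then show ?case
  proof cases
    case 1
    have "s\<^sup>2 \<le> s ^ 3" using s(2) by (intro power_increasing) auto
    then show ?thesis using A1 s 1 by (simp add: numeral_3_eq_3)
  next
    \<comment> \<open>Forgetting that the two edges meet decouples them and costs s^4. Even lengths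
      force the exponent j + 2; odd ones would need only j + 1.\<close>
    case 2
    have "mtotal I (mpow I A j) = (\<Sum>i\<in>I. \<Sum>k\<in>I. \<Sum>m\<in>I. A i m * A m k)"
      unfolding mtotal_def 2 using I
      by (intro sum.cong refl) (simp add: numeral_2_eq_2 wprod_Cons_entry[of I A "[A]"] wprod_single)
    also have "\<dots> \<le> (\<Sum>i\<in>I. \<Sum>k\<in>I. \<Sum>m\<in>I. \<Sum>l\<in>I. A i m * A l k)"
      using A I by (intro sum_mono member_le_sum[of _ I "\<lambda>l. A _ _ * A l _"]) auto
    also have "\<dots> = (\<Sum>i\<in>I. \<Sum>m\<in>I. A i m) * (\<Sum>k\<in>I. \<Sum>l\<in>I. A l k)" by (rule sum_product_4)
    also have "\<dots> = mtotal I A * mtotal I A" unfolding mtotal_def by (rule arg_cong[OF sum.swap])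
    also have "\<dots> \<le> s\<^sup>2 * s\<^sup>2" using s A0 by (intro mult_mono) auto
    finally show ?thesis by (simp add: 2 power_add[symmetric])
  next
    case 3
    have "mtotal I (mpow I A j) \<le> mtotal I A * mtotal I (mpow I A k)"
      using mtotal_Cons2_le[OF I A, of "replicate k A"] nA 3 by simp
    also have "\<dots> \<le> s\<^sup>2 * s ^ (k + 2)"
      using less.IH[of k] 3 s A0 mpow_nonneg[OF nA] by (intro mult_mono mtotal_nonneg) auto
    also have "s\<^sup>2 * s ^ (k + 2) = s ^ (j + 2)" using 3 by (simp add: power_add power2_eq_square)
    finally show ?thesis .
  qed
qed

text \<open>Words in \<open>A\<close> and the constant matrix \<open>p\<close> factor at each occurrence of the latter into
  numbers of walks, so only the words without a block of \<open>A\<close> survive.\<close>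

lemma walk_mixed_bound:
  fixes A :: "'a mx"
  assumes I: "finite I" and p: "0 \<le> p" and D: "0 \<le> D" and \<eta>: "0 \<le> \<eta>" "\<eta> \<le> 1"
    and n: "p * real (card I) \<le> D"
    and w: "\<And>j. 1 \<le> j \<Longrightarrow> j \<le> K \<Longrightarrow> p * mtotal I (mpow I A j) \<le> \<eta> * D ^ (j + 1)"
    and A: "\<And>i j. 0 \<le> A i j"
    and kj: "k + j \<le> K"
  shows "p * mtotal I (wprod I (replicate k (\<lambda>i j. A i j + p) @ replicate j A)) \<le>
    D ^ (k + j + 1) * (of_bool (j = 0) + 5 ^ k * \<eta>)"
  using kj
proof (induction k arbitrary: j)
  case 0
  show ?case
  proof (cases "j = 0")
    case True
    have "mtotal I (wprod I []) = real (card I)"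
      unfolding mtotal_def using I by (simp add: wprod_Nil of_bool_def sum.delta)
    then have "p * mtotal I (wprod I []) \<le> D * 1" using n by simp
    also have "\<dots> \<le> D * (1 + \<eta>)" using D \<eta> by (intro mult_left_mono) auto
    finally show ?thesis using True by simp
  next
    case False
    then show ?thesis using w[of j] 0 by (simp add: mult_ac)
  qed
next
  case (Suc k)
  let ?X = "\<lambda>i j. A i j + p"
  let ?f = "\<lambda>k j. mtotal I (wprod I (replicate k ?X @ replicate j A))"
  have nn: "0 \<le> wprod I (replicate a ?X @ replicate b A) i j" for a b i j
    using A p by (intro wprod_nonneg) (auto simp: nonneg_mx_def)
  have f0: "0 \<le> ?f a b" for a b using nn by (intro mtotal_nonneg)
  \<comment> \<open>Expand the last of the shifted letters: its part \<open>A\<close> joins the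
    block of \<open>A\<close> letters, while the constant part has rank one and splits the total
    into a product.\<close>
  have rec: "?f (Suc k) j = ?f k (Suc j) + p * ?f k 0 * ?f 0 j"
  proof -
    have "wprod I (replicate (Suc k) ?X @ replicate j A) a b =
      wprod I (replicate k ?X @ replicate (Suc j) A) a b + p * ((\<Sum>m\<in>I. mpow I ?X k a m) * (\<Sum>m\<in>I. mpow I A j m b))"
      if "a \<in> I" for a b
    proof -
      have "replicate (Suc k) ?X @ replicate j A = replicate k ?X @ (?X # replicate j A)"
        by (simp add: replicate_app_Cons_same)
      then have "wprod I (replicate (Suc k) ?X @ replicate j A) a b =
         (\<Sum>m\<in>I. mpow I ?X k a m * (\<Sum>l\<in>I. (A m l + p) * mpow I A j l b))"
        using that I by (simp only: wprod_append mmul_def wprod_Cons_entry)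
      also have "\<dots> = (\<Sum>m\<in>I. mpow I ?X k a m * mpow I A (Suc j) m b) +
         (\<Sum>m\<in>I. mpow I ?X k a m * (p * (\<Sum>l\<in>I. mpow I A j l b)))"
      proof -
        have "(\<Sum>l\<in>I. (A m l + p) * mpow I A j l b) = mpow I A (Suc j) m b + p * (\<Sum>l\<in>I. mpow I A j l b)" for m
          by (simp add: distrib_right sum.distrib sum_distrib_left wprod_Cons_entry)
        then show ?thesis by (simp only: distrib_left sum.distrib)
      qed
      also have "(\<Sum>m\<in>I. mpow I ?X k a m * mpow I A (Suc j) m b) = wprod I (replicate k ?X @ replicate (Suc j) A) a b"
        using that I by (simp only: wprod_append mmul_def)
      also have "(\<Sum>m\<in>I. mpow I ?X k a m * (p * (\<Sum>l\<in>I. mpow I A j l b))) =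
         p * ((\<Sum>m\<in>I. mpow I ?X k a m) * (\<Sum>m\<in>I. mpow I A j m b))"
        unfolding sum_distrib_right[symmetric] by (rule mult.left_commute)
      finally show ?thesis .
    qed
    then have "?f (Suc k) j = (\<Sum>a\<in>I. \<Sum>b\<in>I. wprod I (replicate k ?X @ replicate (Suc j) A) a b
        + p * ((\<Sum>m\<in>I. mpow I ?X k a m) * (\<Sum>m\<in>I. mpow I A j m b)))"
      unfolding mtotal_def by (intro sum.cong refl)
    also have "\<dots> = ?f k (Suc j) + p * (\<Sum>a\<in>I. \<Sum>b\<in>I. (\<Sum>m\<in>I. mpow I ?X k a m) * (\<Sum>m\<in>I. mpow I A j m b))"
      by (simp only: sum.distrib mtotal_def sum_distrib_left[of p])
    also have "(\<Sum>a\<in>I. \<Sum>b\<in>I. (\<Sum>m\<in>I. mpow I ?X k a m) * (\<Sum>m\<in>I. mpow I A j m b)) =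
        mtotal I (mpow I ?X k) * (\<Sum>b\<in>I. \<Sum>m\<in>I. mpow I A j m b)"
      unfolding mtotal_def sum_product[symmetric] ..
    also have "(\<Sum>b\<in>I. \<Sum>m\<in>I. mpow I A j m b) = mtotal I (mpow I A j)"
      unfolding mtotal_def by (rule sum.swap)
    finally show ?thesis by simp
  qed
  have 5: "(5::real) ^ k \<ge> 1" by simp
  define e where "e = 5 ^ k * \<eta>"
  have e: "\<eta> \<le> e" "e \<ge> 0" using \<eta> 5 mult_right_mono[OF 5, of \<eta>] by (auto simp: e_def)
  have a: "p * ?f k (Suc j) \<le> D ^ (k + j + 2) * e"
    using Suc.IH[of "Suc j"] Suc.prems by (simp add: e_def)
  have b: "p * ?f k 0 \<le> D ^ (k + 1) * (1 + e)"
    using Suc.IH[of 0] Suc.prems by (simp add: e_def)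
  have c: "p * ?f 0 j \<le> D ^ (j + 1) * (of_bool (j = 0) + \<eta>)"
  proof (cases "j = 0")
    case True
    have "mtotal I (wprod I []) = real (card I)"
      unfolding mtotal_def using I by (simp add: wprod_Nil of_bool_def sum.delta)
    then have "p * mtotal I (wprod I []) \<le> D * 1" using n by simp
    also have "\<dots> \<le> D * (1 + \<eta>)" using D \<eta> by (intro mult_left_mono) auto
    finally show ?thesis using True by simp
  next
    case False
    then show ?thesis using w[of j] Suc.prems by (simp add: mult_ac)
  qed
  have "p * ?f (Suc k) j = p * ?f k (Suc j) + (p * ?f k 0) * (p * ?f 0 j)"
    unfolding rec by (simp only: distrib_left mult_ac)
  also have "\<dots> \<le> D ^ (k + j + 2) * e + (D ^ (k + 1) * (1 + e)) * (D ^ (j + 1) * (of_bool (j = 0) + \<eta>))"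
  proof (rule add_mono[OF a mult_mono[OF b c]])
    show "0 \<le> D ^ (k + 1) * (1 + e)" using D e by simp
    show "0 \<le> p * ?f 0 j" using p f0 by (rule mult_nonneg_nonneg)
  qed
  also have "\<dots> = D ^ (k + j + 2) * (e + (1 + e) * (of_bool (j = 0) + \<eta>))"
    by (simp add: algebra_simps power_add)
  \<comment> \<open>As \<eta> <= e and e \<eta> <= e, the bracket exceeds its main part by at most
    4e. This is why a factor 5 per letter is enough.\<close>
  also have "\<dots> \<le> D ^ (k + j + 2) * (of_bool (j = 0) + 5 * e)"
  proof (intro mult_left_mono)
    have "e * \<eta> \<le> e" using e \<eta> by (simp add: mult_left_le)
    then show "e + (1 + e) * (of_bool (j = 0) + \<eta>) \<le> of_bool (j = 0) + 5 * e"
      using e by (auto simp: algebra_simps of_bool_def)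
  qed (use D in auto)
  finally show ?case by (simp add: e_def mult.assoc)
qed

text \<open>Exchange the letters one at a time. Each difference is the constant matrix, so each term
  is \<open>p\<close> times a total covered by \<open>walk_mixed_bound\<close>; only the term
  without a letter \<open>A\<close> has a main part, hence the single D^K.\<close>

lemma mtrace_shift_le:
  fixes A :: "'a mx"
  assumes I: "finite I" and p: "0 \<le> p" and D: "0 \<le> D" and \<eta>: "0 \<le> \<eta>" "\<eta> \<le> 1"
    and n: "p * real (card I) \<le> D"
    and w: "\<And>j. 1 \<le> j \<Longrightarrow> j \<le> K \<Longrightarrow> p * mtotal I (mpow I A j) \<le> \<eta> * D ^ (j + 1)"
    and A: "\<And>i j. 0 \<le> A i j" and K: "K \<ge> 1"
  shows "mtrace I (mpow I (\<lambda>i j. A i j + p) K) \<le> mtrace I (mpow I A K) + D ^ K * (1 + real K * (5 ^ K * \<eta>))"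
proof -
  let ?X = "\<lambda>i j. A i j + p"
  have "mtrace I (mpow I A K) - mtrace I (mpow I ?X K) =
     (\<Sum>l<K. mtrace I (wprod I ((\<lambda>i j. A i j - (A i j + p)) # replicate (K - 1 - l) ?X @ replicate l A)))"
    by (rule mtrace_telescope[OF I])
  also have "\<dots> = (\<Sum>l<K. - (p * mtotal I (wprod I (replicate (K - 1 - l) ?X @ replicate l A))))"
  proof (rule sum.cong[OF refl])
    fix l
    let ?Q = "wprod I (replicate (K - 1 - l) ?X @ replicate l A)"
    have "mtrace I (wprod I ((\<lambda>i j. A i j - (A i j + p)) # replicate (K - 1 - l) ?X @ replicate l A)) =
      (\<Sum>i\<in>I. \<Sum>k\<in>I. - p * ?Q k i)"
      by (simp add: mtrace_def wprod_Cons_entry)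
    also have "\<dots> = - p * (\<Sum>i\<in>I. \<Sum>k\<in>I. ?Q k i)" by (simp only: sum_distrib_left)
    also have "(\<Sum>i\<in>I. \<Sum>k\<in>I. ?Q k i) = mtotal I ?Q" unfolding mtotal_def by (rule sum.swap)
    finally show "mtrace I (wprod I ((\<lambda>i j. A i j - (A i j + p)) # replicate (K - 1 - l) ?X @ replicate l A)) = - (p * mtotal I ?Q)"
      by simp
  qed
  finally have "mtrace I (mpow I ?X K) - mtrace I (mpow I A K) =
     (\<Sum>l<K. p * mtotal I (wprod I (replicate (K - 1 - l) ?X @ replicate l A)))"
    by (simp add: sum_negf)
  also have "\<dots> \<le> (\<Sum>l<K. D ^ K * (of_bool (l = 0) + 5 ^ K * \<eta>))"
  proof (rule sum_mono)
    fix l assume l: "l \<in> {..<K}"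
    have "p * mtotal I (wprod I (replicate (K - 1 - l) ?X @ replicate l A)) \<le>
      D ^ (K - 1 - l + l + 1) * (of_bool (l = 0) + 5 ^ (K - 1 - l) * \<eta>)"
      using l by (intro walk_mixed_bound[OF I p D \<eta> n w A]) auto
    also have "K - 1 - l + l + 1 = K" using l by auto
    also have "D ^ K * (of_bool (l = 0) + 5 ^ (K - 1 - l) * \<eta>) \<le> D ^ K * (of_bool (l = 0) + 5 ^ K * \<eta>)"
      using D \<eta> by (intro mult_left_mono add_left_mono mult_right_mono power_increasing) auto
    finally show "p * mtotal I (wprod I (replicate (K - 1 - l) ?X @ replicate l A)) \<le> D ^ K * (of_bool (l = 0) + 5 ^ K * \<eta>)" .
  qed
  also have "\<dots> = D ^ K * ((\<Sum>l<K. of_bool (l = 0)) + real K * (5 ^ K * \<eta>))"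
    by (simp add: sum.distrib flip: sum_distrib_left)
  also have "(\<Sum>l<K. of_bool (l = 0)) = (1::real)" using K by (simp add: of_bool_def)
  finally show ?thesis by simp
qed

subsection \<open>Closed walks and cycle homomorphisms\<close>

text \<open>The weight \<open>h\<close> on the end points carries the induction: stripping the last
  step merely changes it. Taking the entry that leads back as weight closes the walk.\<close>

lemma sum_walks:
  assumes I: "finite I"
  shows "(\<Sum>\<phi>\<in>{..<Suc k} \<rightarrow>\<^sub>E I. (\<Prod>l<k. a (\<phi> l) (\<phi> (Suc l))) * h (\<phi> 0) (\<phi> k)) =
    (\<Sum>i\<in>I. \<Sum>j\<in>I. mpow I a k i j * (h i j :: real))"
proof (induction k arbitrary: h)
  case 0
  have "(\<Sum>\<phi>\<in>{..<Suc 0} \<rightarrow>\<^sub>E I. h (\<phi> 0) (\<phi> 0)) = (\<Sum>i\<in>I. h i i)"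
    by (rule sum.reindex_bij_witness[of _ "\<lambda>i. (\<lambda>x. undefined)(0 := i)" "\<lambda>\<phi>. \<phi> 0"]) (auto simp: PiE_iff extensional_def)
  also have "\<dots> = (\<Sum>i\<in>I. \<Sum>j\<in>I. of_bool (i = j) * h i j)"
    using I by (intro sum.cong refl) (simp add: of_bool_def if_distrib[of "\<lambda>x. x * _"] sum.delta cong: if_cong)
  finally show ?case by (simp only: wprod_Nil replicate_0 lessThan_0 prod.empty mult_1_left)
next
  case (Suc k)
  have rep: "replicate (Suc k) a = replicate k a @ [a]" by (simp add: replicate_append_same)
  have split: "{..<Suc (Suc k)} = insert (Suc k) {..<Suc k}" by auto
  have "(\<Sum>\<phi>\<in>{..<Suc (Suc k)} \<rightarrow>\<^sub>E I. (\<Prod>l<Suc k. a (\<phi> l) (\<phi> (Suc l))) * h (\<phi> 0) (\<phi> (Suc k))) =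
    (\<Sum>(y, \<phi>)\<in>I \<times> ({..<Suc k} \<rightarrow>\<^sub>E I). (\<Prod>l<k. a (\<phi> l) (\<phi> (Suc l))) * (a (\<phi> k) y * h (\<phi> 0) y))"
    unfolding split PiE_insert_eq
  proof (subst sum.reindex)
    show "inj_on (\<lambda>(y, g). g(Suc k := y)) (I \<times> ({..<Suc k} \<rightarrow>\<^sub>E I))"
      by (rule inj_combinator) auto
    have "(\<Prod>l<k. a ((\<phi>(Suc k := y)) l) ((\<phi>(Suc k := y)) (Suc l))) = (\<Prod>l<k. a (\<phi> l) (\<phi> (Suc l)))" for \<phi> y
      by (intro prod.cong) auto
    then have eq: "(\<Prod>l<Suc k. a ((\<phi>(Suc k := y)) l) ((\<phi>(Suc k := y)) (Suc l))) * h ((\<phi>(Suc k := y)) 0) ((\<phi>(Suc k := y)) (Suc k)) =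
       (\<Prod>l<k. a (\<phi> l) (\<phi> (Suc l))) * (a (\<phi> k) y * h (\<phi> 0) y)" for \<phi> y
      by (simp add: mult.assoc)
    show "(\<Sum>x\<in>I \<times> ({..<Suc k} \<rightarrow>\<^sub>E I). ((\<lambda>\<phi>. (\<Prod>l<Suc k. a (\<phi> l) (\<phi> (Suc l))) * h (\<phi> 0) (\<phi> (Suc k))) \<circ> (\<lambda>(y, g). g(Suc k := y))) x) =
      (\<Sum>(y, \<phi>)\<in>I \<times> ({..<Suc k} \<rightarrow>\<^sub>E I). (\<Prod>l<k. a (\<phi> l) (\<phi> (Suc l))) * (a (\<phi> k) y * h (\<phi> 0) y))"
      unfolding comp_def case_prod_beta by (intro sum.cong refl eq)
  qed
  also have "\<dots> = (\<Sum>y\<in>I. \<Sum>\<phi>\<in>{..<Suc k} \<rightarrow>\<^sub>E I. (\<Prod>l<k. a (\<phi> l) (\<phi> (Suc l))) * (a (\<phi> k) y * h (\<phi> 0) y))"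
    by (simp only: sum.cartesian_product)
  also have "\<dots> = (\<Sum>y\<in>I. \<Sum>i\<in>I. \<Sum>j\<in>I. mpow I a k i j * (a j y * h i y))"
    by (rule sum.cong[OF refl], rule Suc.IH[of "\<lambda>i j. a j _ * h i _"])
  also have "\<dots> = (\<Sum>i\<in>I. \<Sum>y\<in>I. (\<Sum>j\<in>I. mpow I a k i j * a j y) * h i y)"
    by (subst sum.swap) (simp add: sum_distrib_right mult.assoc)
  also have "\<dots> = (\<Sum>i\<in>I. \<Sum>y\<in>I. mpow I a (Suc k) i y * h i y)"
    unfolding rep using I by (intro sum.cong refl) (simp only: wprod_snoc)
  finally show ?case .
qed

lemma sum_closed_walks:
  assumes "finite I" "k \<ge> 1"
  shows "(\<Sum>\<phi>\<in>{..<k} \<rightarrow>\<^sub>E I. \<Prod>l<k. a (\<phi> l) (\<phi> (Suc l mod k))) = mtrace I (mpow I a k)"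
proof -
  obtain m where k: "k = Suc m" using assms(2) by (cases k) auto
  have rep: "replicate (Suc m) a = replicate m a @ [a]" by (simp add: replicate_append_same)
  have "(\<Prod>l<k. a (\<phi> l) (\<phi> (Suc l mod k))) = (\<Prod>l<m. a (\<phi> l) (\<phi> (Suc l))) * a (\<phi> m) (\<phi> 0)" for \<phi>
    by (simp add: k)
  then have "(\<Sum>\<phi>\<in>{..<k} \<rightarrow>\<^sub>E I. \<Prod>l<k. a (\<phi> l) (\<phi> (Suc l mod k))) =
     (\<Sum>i\<in>I. \<Sum>j\<in>I. mpow I a m i j * a j i)"
    using sum_walks[OF assms(1), where a = a and h = "\<lambda>i j. a j i" and k = m] by (simp add: k)
  also have "\<dots> = mtrace I (mpow I a k)"
    unfolding mtrace_def using assms(1)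
    unfolding k rep by (intro sum.cong refl) (simp only: wprod_snoc)
  finally show ?thesis .
qed

definition adj_mx :: "'a set set \<Rightarrow> 'a mx" where "adj_mx E = (\<lambda>i j. of_bool ({i, j} \<in> E))"

lemma adj_mx_symm: "symm (adj_mx E)" by (simp add: symm_def adj_mx_def insert_commute)

lemma adj_mx_bounds: "0 \<le> adj_mx E i j" "adj_mx E i j \<le> 1" by (auto simp: adj_mx_def)

text \<open>As a set it counts a repeated edge once, which is what probabilities see. A step that
  stays in place contributes a singleton, which lies in no set of two-element edges.\<close>

definition wedges :: "nat \<Rightarrow> (nat \<Rightarrow> 'a) \<Rightarrow> 'a set set" where
  "wedges k \<phi> = (\<lambda>l. {\<phi> l, \<phi> (Suc l mod k)}) ` {..<k}"

lemma prod_adj_mx: "(\<Prod>l<k. adj_mx E (\<phi> l) (\<phi> (Suc l mod k))) = of_bool (wedges k \<phi> \<subseteq> E)"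
proof (cases "wedges k \<phi> \<subseteq> E")
  case True
  then show ?thesis by (subst prod.neutral) (auto simp: adj_mx_def wedges_def)
next
  case False
  then show ?thesis by (subst prod_zero) (auto simp: adj_mx_def wedges_def)
qed

lemma mtrace_adj_mx:
  assumes "finite I" "k \<ge> 1"
  shows "mtrace I (mpow I (adj_mx E) k) = (\<Sum>\<phi>\<in>{..<k} \<rightarrow>\<^sub>E I. of_bool (wedges k \<phi> \<subseteq> E))"
  using sum_closed_walks[OF assms, of "adj_mx E"] by (simp only: prod_adj_mx)

lemma card_wedges_le: "card (wedges k \<phi>) \<le> k"
  unfolding wedges_def using card_image_le[of "{..<k}"] by simp

text \<open>The factors of \<open>Hom\<close> are ordered pairs, the factors here are steps round
  the cycle. They correspond one to one, the closing step being listed as (0, s - 1); for s = 2 the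
  two steps would share a pair.\<close>

lemma Hom_cycle_graph:
  assumes "s \<ge> 3"
  shows "Hom (cycle_graph s) (V, E) = (\<Sum>\<phi>\<in>{..<s} \<rightarrow>\<^sub>E V. of_bool (wedges s \<phi> \<subseteq> E))"
proof -
  define P where "P = {(x, y). x < y \<and> {x, y} \<in> edges (cycle_graph s)}"
  let ?b = "\<lambda>l. if Suc l < s then (l, Suc l) else (0, l)"
  have bij: "bij_betw ?b {..<s} P"
      unfolding bij_betw_def
    proof
      show "inj_on (\<lambda>l. if Suc l < s then (l, Suc l) else (0, l)) {..<s}"
        using assms by (auto simp: inj_on_def split: if_splits)
      show "(\<lambda>l. if Suc l < s then (l, Suc l) else (0, l)) ` {..<s} = P"
      proof (intro equalityI subsetI)
        fix e assume "e \<in> (\<lambda>l. if Suc l < s then (l, Suc l) else (0, l)) ` {..<s}"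
        then obtain l where l: "l < s" "e = (if Suc l < s then (l, Suc l) else (0, l))" by blast
        show "e \<in> P"
        proof (cases "Suc l < s")
          case True
          then show ?thesis using l by (auto simp: P_def edges_def cycle_graph_def intro!: exI[of _ l])
        next
          case False
          then have "Suc l = s" using l by simp
          then show ?thesis using l assms by (auto simp: P_def edges_def cycle_graph_def insert_commute intro!: exI[of _ l])
        qed
      next
        fix e assume "e \<in> P"
        then obtain x y l where xy: "e = (x, y)" "x < y" "{x, y} = {l, Suc l mod s}" "l < s"
          by (auto simp: P_def edges_def cycle_graph_def)
        show "e \<in> (\<lambda>l. if Suc l < s then (l, Suc l) else (0, l)) ` {..<s}"
        proof (cases "Suc l < s")
          case True
          then have "x = l \<and> y = Suc l" using xy by (auto simp: doubleton_eq_iff)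
          then show ?thesis using True xy by (auto intro!: image_eqI[of _ _ l])
        next
          case False
          then have "Suc l = s" using xy by simp
          then have "x = 0 \<and> y = l" using xy by (auto simp: doubleton_eq_iff)
          then show ?thesis using False xy by (auto intro!: image_eqI[of _ _ l])
        qed
      qed
    qed
  have val: "(case ?b l of (x, y) \<Rightarrow> adj (V, E) (\<phi> x) (\<phi> y)) = adj_mx E (\<phi> l) (\<phi> (Suc l mod s))"
    if l: "l \<in> {..<s}" for l and \<phi> :: "nat \<Rightarrow> 'a"
  proof (cases "Suc l < s")
    case False
    then have "Suc l = s" using l by simp
    then show ?thesis by (auto simp: adj_def adj_mx_def edges_def insert_commute)
  qed (auto simp: adj_def adj_mx_def edges_def)
  have "(\<Prod>(x, y)\<in>P. adj (V, E) (\<phi> x) (\<phi> y)) = (\<Prod>l<s. adj_mx E (\<phi> l) (\<phi> (Suc l mod s)))" for \<phi> :: "nat \<Rightarrow> 'a"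
  proof -
    have "(\<Prod>(x, y)\<in>P. adj (V, E) (\<phi> x) (\<phi> y)) = (\<Prod>l<s. case ?b l of (x, y) \<Rightarrow> adj (V, E) (\<phi> x) (\<phi> y))"
      by (rule prod.reindex_bij_betw[OF bij, symmetric])
    also have "\<dots> = (\<Prod>l<s. adj_mx E (\<phi> l) (\<phi> (Suc l mod s)))"
      by (rule prod.cong[OF refl val])
    finally show ?thesis .
  qed
  then show ?thesis unfolding Hom_def P_def[symmetric] prod_adj_mx
    by (simp add: cycle_graph_def verts_def)
qed

lemma card_range_le:
  "card (\<phi> ` {..m}) \<le> card ((\<lambda>l. {\<phi> l, \<phi> (Suc l)}) ` {..<m}) + 1"
proof (induction m)
  case 0
  then show ?case by simp
next
  case (Suc m)
  let ?e = "\<lambda>l. {\<phi> l, \<phi> (Suc l)}"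
  show ?case
  proof (cases "\<phi> (Suc m) \<in> \<phi> ` {..m}")
    case True
    then have "\<phi> ` {..Suc m} = \<phi> ` {..m}" by (auto simp: atMost_Suc)
    moreover have "card (?e ` {..<m}) \<le> card (?e ` {..<Suc m})"
      by (intro card_mono image_mono) auto
    ultimately show ?thesis using Suc by simp
  next
    case False
    have "?e m \<notin> ?e ` {..<m}"
    proof
      assume "?e m \<in> ?e ` {..<m}"
      then obtain l where "l < m" "{\<phi> m, \<phi> (Suc m)} = {\<phi> l, \<phi> (Suc l)}" by auto
      then have "\<phi> (Suc m) = \<phi> l \<or> \<phi> (Suc m) = \<phi> (Suc l)" by (auto simp: doubleton_eq_iff)
      then show False using False \<open>l < m\<close> by auto
    qed
    then have "card (?e ` {..<Suc m}) = card (?e ` {..<m}) + 1" by (simp add: lessThan_Suc)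
    moreover have "card (\<phi> ` {..Suc m}) = card (\<phi> ` {..m}) + 1" using False by (simp add: atMost_Suc)
    ultimately show ?thesis using Suc by simp
  qed
qed

lemma card_range_wedges:
  assumes "k \<ge> 1"
  shows "card (\<phi> ` {..<k}) \<le> card (wedges k \<phi>) + 1"
proof -
  obtain m where k: "k = Suc m" using assms by (cases k) auto
  have "(\<lambda>l. {\<phi> l, \<phi> (Suc l)}) ` {..<m} \<subseteq> wedges k \<phi>"
    by (force simp: wedges_def k)
  then have "card ((\<lambda>l. {\<phi> l, \<phi> (Suc l)}) ` {..<m}) \<le> card (wedges k \<phi>)"
    by (intro card_mono) (auto simp: wedges_def)
  then show ?thesis using card_range_le[of \<phi> m] by (simp add: k lessThan_Suc_atMost)
qed

text \<open>Such a map factors through \<open>s\<close> labels: label the \<open>k\<close> positions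
  and assign elements of \<open>I\<close> to the labels.\<close>

lemma card_maps_small_range:
  assumes "finite I" "k \<ge> 1"
  shows "card {\<phi> \<in> {..<k} \<rightarrow>\<^sub>E I. card (\<phi> ` {..<k}) \<le> s} \<le> card I ^ s * s ^ k"
proof -
  let ?F = "\<lambda>(\<psi>, \<kappa>). restrict (\<lambda>l. \<psi> (\<kappa> l)) {..<k}"
  let ?D = "({..<s} \<rightarrow>\<^sub>E I) \<times> ({..<k} \<rightarrow>\<^sub>E {..<s})"
  have "{\<phi> \<in> {..<k} \<rightarrow>\<^sub>E I. card (\<phi> ` {..<k}) \<le> s} \<subseteq> ?F ` ?D"
    proof
      fix \<phi> assume "\<phi> \<in> {\<phi> \<in> {..<k} \<rightarrow>\<^sub>E I. card (\<phi> ` {..<k}) \<le> s}"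
      then have \<phi>: "\<phi> \<in> {..<k} \<rightarrow>\<^sub>E I" and c: "card (\<phi> ` {..<k}) \<le> s" by auto
      obtain g where g: "bij_betw g {..<card (\<phi> ` {..<k})} (\<phi> ` {..<k})"
        using ex_bij_betw_nat_finite[of "\<phi> ` {..<k}"] by (auto simp: atLeast0LessThan)
      define r where "r = card (\<phi> ` {..<k})"
      have im: "\<phi> ` {..<k} \<subseteq> I" using \<phi> by auto
      obtain a where a: "a \<in> I" using im assms(2) by (cases k) auto
      define \<psi> where "\<psi> = (\<lambda>i\<in>{..<s}. if i < r then g i else a)"
      define \<kappa> where "\<kappa> = (\<lambda>l\<in>{..<k}. inv_into {..<r} g (\<phi> l))"
      have gr: "g ` {..<r} = \<phi> ` {..<k}" using g by (simp add: bij_betw_def r_def)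
      have \<kappa>r: "\<kappa> l < r \<and> g (\<kappa> l) = \<phi> l" if "l < k" for l
      proof -
        have "\<phi> l \<in> g ` {..<r}" using gr that by auto
        then have "inv_into {..<r} g (\<phi> l) \<in> {..<r}" "g (inv_into {..<r} g (\<phi> l)) = \<phi> l"
          by (rule inv_into_into, rule f_inv_into_f)
        then show ?thesis using that by (simp add: \<kappa>_def)
      qed
      have gI: "g i \<in> I" if "i < r" for i using gr im that by blast
      have "\<psi> \<in> {..<s} \<rightarrow>\<^sub>E I" using gI a by (auto simp: \<psi>_def)
      moreover have "\<kappa> \<in> {..<k} \<rightarrow>\<^sub>E {..<s}"
      proof (rule PiE_I)
        fix l assume "l \<in> {..<k}"
        then show "\<kappa> l \<in> {..<s}" using \<kappa>r[of l] c unfolding r_def lessThan_iff by linarith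
      qed (simp add: \<kappa>_def)
      moreover have "\<phi> = ?F (\<psi>, \<kappa>)"
      proof
        fix l
        show "\<phi> l = ?F (\<psi>, \<kappa>) l"
        proof (cases "l < k")
          case True
          then show ?thesis using \<kappa>r[OF True] c by (simp add: \<psi>_def r_def)
        next
          case False
          then show ?thesis using \<phi> by (auto simp: PiE_iff extensional_def)
        qed
      qed
      ultimately show "\<phi> \<in> ?F ` ?D" by blast
    qed
  then have "card {\<phi> \<in> {..<k} \<rightarrow>\<^sub>E I. card (\<phi> ` {..<k}) \<le> s} \<le> card (?F ` ?D)"
    using assms(1) by (intro card_mono finite_imageI finite_cartesian_product finite_PiE) auto
  also have "\<dots> \<le> card ?D"
    using assms(1) by (intro card_image_le finite_cartesian_product finite_PiE) auto
  also have "\<dots> = card I ^ s * s ^ k" by (simp add: card_cartesian_product card_PiE)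
  finally show ?thesis .
qed


text \<open>The centred moments of a Bernoulli variable: the first vanishes, and the higher ones are
  at most the variance in absolute value.\<close>

lemma centred_factor:
  fixes p :: real
  assumes "0 \<le> p" "p \<le> 1" "m \<ge> 1"
  shows "\<bar>p * (1 - p) ^ m + (1 - p) * (- p) ^ m\<bar> \<le> (if m = 1 then 0 else p)"
proof (cases "m = 1")
  case False
  then obtain k where m: "m = k + 2" using assms(3) by (metis Suc_1 Suc_leI add.commute le_Suc_ex le_neq_implies_less One_nat_def)
  have "\<bar>p * (1 - p) ^ m + (1 - p) * (- p) ^ m\<bar> \<le> p * (1 - p) ^ m + (1 - p) * p ^ m"
    using assms by (intro order_trans[OF abs_triangle_ineq]) (simp add: abs_mult power_abs)
  also have "\<dots> \<le> p * (1 - p) ^ 2 + (1 - p) * p ^ 2"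
    using assms m by (intro add_mono mult_left_mono power_decreasing) auto
  also have "\<dots> = p * (1 - p)" by (simp add: power2_eq_square algebra_simps)
  also have "\<dots> \<le> p" using assms by (simp add: mult_left_le)
  finally show ?thesis using False by simp
qed simp

text \<open>The mean factors over the distinct edges, and an edge used exactly once makes it vanish.
  Otherwise every edge is used at least twice, so there are at most k/2 of them, each contributing
  at most \<open>p\<close>.\<close>

lemma subset_mean_centred_walk:
  assumes N: "finite N" and p: "0 \<le> p" "p \<le> 1" and F: "F \<subseteq> N" and e: "\<And>l. l < k \<Longrightarrow> e l \<in> F"
  shows "\<bar>subset_mean p N (\<lambda>E. \<Prod>l<k. of_bool (e l \<in> E) - p)\<bar> \<le>
    (if 2 * card (e ` {..<k}) \<le> k then p ^ card (e ` {..<k}) else 0)"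
proof -
  define c where "c x = card {l \<in> {..<k}. e l = x}" for x
  have eF: "e ` {..<k} \<subseteq> N" using e F by auto
  have "subset_mean p N (\<lambda>E. \<Prod>l<k. of_bool (e l \<in> E) - p) =
     subset_mean p N (\<lambda>E. \<Prod>x\<in>N. (\<lambda>x b. (of_bool b - p) ^ c x) x (x \<in> E))"
  proof (rule subset_mean_cong)
    fix E assume "E \<subseteq> N"
    have "(\<Prod>l<k. of_bool (e l \<in> E) - p) = (\<Prod>x\<in>N. \<Prod>l | l \<in> {..<k} \<and> e l = x. of_bool (e l \<in> E) - p)"
      using prod.group[of "{..<k}" N e "\<lambda>l. of_bool (e l \<in> E) - p"] N eF by simp
    also have "\<dots> = (\<Prod>x\<in>N. (\<lambda>x b. (of_bool b - p) ^ c x) x (x \<in> E))"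
      by (intro prod.cong refl) (simp add: c_def)
    finally show "(\<Prod>l<k. of_bool (e l \<in> E) - p) = (\<Prod>x\<in>N. (\<lambda>x b. (of_bool b - p) ^ c x) x (x \<in> E))" .
  qed
  also have "\<dots> = (\<Prod>x\<in>N. p * (1 - p) ^ c x + (1 - p) * (- p) ^ c x)"
    by (subst subset_mean_prod[OF N]) simp
  also have "\<dots> = (\<Prod>x\<in>e ` {..<k}. p * (1 - p) ^ c x + (1 - p) * (- p) ^ c x)"
  proof (rule prod.mono_neutral_right[OF N eF])
    show "\<forall>x\<in>N - e ` {..<k}. p * (1 - p) ^ c x + (1 - p) * (- p) ^ c x = 1"
    proof
      fix x assume "x \<in> N - e ` {..<k}"
      then have "{l \<in> {..<k}. e l = x} = {}" by auto
      then have "c x = 0" by (simp only: c_def card.empty)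
      then show "p * (1 - p) ^ c x + (1 - p) * (- p) ^ c x = 1" by simp
    qed
  qed
  finally have eq: "\<bar>subset_mean p N (\<lambda>E. \<Prod>l<k. of_bool (e l \<in> E) - p)\<bar> =
     (\<Prod>x\<in>e ` {..<k}. \<bar>p * (1 - p) ^ c x + (1 - p) * (- p) ^ c x\<bar>)"
    by (simp only: abs_prod)
  have c1: "c x \<ge> 1" if "x \<in> e ` {..<k}" for x
  proof -
    have "{l \<in> {..<k}. e l = x} \<noteq> {}" using that by auto
    then show ?thesis unfolding c_def by (simp add: Suc_leI card_gt_0_iff)
  qed
  have le: "(\<Prod>x\<in>e ` {..<k}. \<bar>p * (1 - p) ^ c x + (1 - p) * (- p) ^ c x\<bar>) \<le>
     (\<Prod>x\<in>e ` {..<k}. if c x = 1 then 0 else p)"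
    using centred_factor[OF p] c1 by (intro prod_mono) auto
  show ?thesis
  proof (cases "\<exists>x\<in>e ` {..<k}. c x = 1")
    case True
    then have "(\<Prod>x\<in>e ` {..<k}. if c x = 1 then 0 else p) = 0" by (intro prod_zero) auto
    then have "\<bar>subset_mean p N (\<lambda>E. \<Prod>l<k. of_bool (e l \<in> E) - p)\<bar> \<le> 0"
      using eq le by (simp only:)
    also have "0 \<le> (if 2 * card (e ` {..<k}) \<le> k then p ^ card (e ` {..<k}) else 0)" using p by simp
    finally show ?thesis .
  next
    case False
    have "(\<Sum>x\<in>e ` {..<k}. c x) = k"
      unfolding c_def using sum.group[of "{..<k}" "e ` {..<k}" e "\<lambda>_. 1::nat"] by simp
    moreover have "(\<Sum>x\<in>e ` {..<k}. 2) \<le> (\<Sum>x\<in>e ` {..<k}. c x)"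
      using False c1 by (intro sum_mono) (metis Suc_1 Suc_leI le_neq_implies_less One_nat_def)
    ultimately have "2 * card (e ` {..<k}) \<le> k" by (simp add: mult.commute)
    moreover have "(\<Prod>x\<in>e ` {..<k}. if c x = 1 then 0 else p) = (\<Prod>x\<in>e ` {..<k}. p)"
      using False by (intro prod.cong refl) auto
    then have "(\<Prod>x\<in>e ` {..<k}. if c x = 1 then 0 else p) = p ^ card (e ` {..<k})"
      by (simp only: prod_constant)
    ultimately show ?thesis using eq le by (simp only: if_True)
  qed
qed

definition noise :: "real \<Rightarrow> 'a set set \<Rightarrow> 'a set set \<Rightarrow> 'a mx" where
  "noise p F E = (\<lambda>i j. if {i, j} \<in> F then of_bool ({i, j} \<in> E) - p else 0)"

text \<open>With n = \<open>card I\<close> and d = n p: a surviving walk has s <= t distinct edges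
  and at most s + 1 vertices, so these walks contribute at most a constant times n^(s+1) p^s = n
  d^s. The constant has (t+1)^(2t) for the labellings and t + 1 for the values of s.\<close>

lemma subset_mean_noise_le:
  assumes I: "finite I" and N: "finite N" and p: "0 \<le> p" "p \<le> 1" and F: "F \<subseteq> N" and t: "t \<ge> 1"
    and d: "real (card I) * p \<ge> 1"
  shows "subset_mean p N (\<lambda>E. mtrace I (mpow I (noise p F E) (2 * t))) \<le>
    real ((t + 1) ^ (2 * t + 1)) * (real (card I) * (real (card I) * p) ^ t)"
proof -
  define n where "n = real (card I)"
  let ?P = "{..<2 * t} \<rightarrow>\<^sub>E I"
  let ?Q = "\<lambda>s. {\<phi> \<in> ?P. card (wedges (2 * t) \<phi>) = s}"
  have fin: "finite ?P" using I by (intro finite_PiE) auto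
  have "subset_mean p N (\<lambda>E. mtrace I (mpow I (noise p F E) (2 * t))) =
     (\<Sum>\<phi>\<in>?P. subset_mean p N (\<lambda>E. \<Prod>l<2 * t. noise p F E (\<phi> l) (\<phi> (Suc l mod (2 * t)))))"
    using sum_closed_walks[OF I, of "2 * t"] t by (simp flip: subset_mean_sum)
  also have "\<dots> \<le> (\<Sum>\<phi>\<in>?P. if card (wedges (2 * t) \<phi>) \<le> t then p ^ card (wedges (2 * t) \<phi>) else 0)"
  proof (rule sum_mono)
    fix \<phi> assume "\<phi> \<in> ?P"
    let ?e = "\<lambda>l. {\<phi> l, \<phi> (Suc l mod (2 * t))}"
    show "subset_mean p N (\<lambda>E. \<Prod>l<2 * t. noise p F E (\<phi> l) (\<phi> (Suc l mod (2 * t)))) \<le>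
      (if card (wedges (2 * t) \<phi>) \<le> t then p ^ card (wedges (2 * t) \<phi>) else 0)"
    proof (cases "\<forall>l<2 * t. ?e l \<in> F")
      case True
      then have "subset_mean p N (\<lambda>E. \<Prod>l<2 * t. noise p F E (\<phi> l) (\<phi> (Suc l mod (2 * t)))) =
         subset_mean p N (\<lambda>E. \<Prod>l<2 * t. of_bool (?e l \<in> E) - p)"
        by (intro subset_mean_cong prod.cong) (auto simp: noise_def)
      moreover have "\<bar>subset_mean p N (\<lambda>E. \<Prod>l<2 * t. of_bool (?e l \<in> E) - p)\<bar> \<le>
         (if 2 * card (?e ` {..<2 * t}) \<le> 2 * t then p ^ card (?e ` {..<2 * t}) else 0)"
        using True by (intro subset_mean_centred_walk[OF N p F]) auto
      ultimately show ?thesis by (simp add: wedges_def split: if_splits)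
    next
      case False
      then obtain l where l: "l < 2 * t" "?e l \<notin> F" by auto
      have "(\<Prod>l<2 * t. noise p F E (\<phi> l) (\<phi> (Suc l mod (2 * t)))) = 0" for E
        using l by (intro prod_zero) (auto simp: noise_def intro!: bexI[of _ l])
      then have "subset_mean p N (\<lambda>E. \<Prod>l<2 * t. noise p F E (\<phi> l) (\<phi> (Suc l mod (2 * t)))) = 0"
        by (simp only: subset_mean_def mult_zero_right sum.neutral_const)
      then show ?thesis using p by simp
    qed
  qed
  also have "\<dots> = (\<Sum>s\<in>{..t}. \<Sum>\<phi> | \<phi> \<in> ?P \<and> card (wedges (2 * t) \<phi>) = s. p ^ s)"
  proof -
    have "(\<Sum>\<phi>\<in>?P. if card (wedges (2 * t) \<phi>) \<le> t then p ^ card (wedges (2 * t) \<phi>) else 0) =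
      (\<Sum>\<phi> | \<phi> \<in> ?P \<and> card (wedges (2 * t) \<phi>) \<le> t. p ^ card (wedges (2 * t) \<phi>))"
      by (rule sum.inter_filter[OF fin, symmetric])
    also have "\<dots> = (\<Sum>s\<in>{..t}. \<Sum>\<phi> | \<phi> \<in> {\<phi> \<in> ?P. card (wedges (2 * t) \<phi>) \<le> t} \<and> card (wedges (2 * t) \<phi>) = s. p ^ card (wedges (2 * t) \<phi>))"
      by (rule sum.group[symmetric]) (use fin in auto)
    also have "\<dots> = (\<Sum>s\<in>{..t}. \<Sum>\<phi> | \<phi> \<in> ?P \<and> card (wedges (2 * t) \<phi>) = s. p ^ s)"
      by (intro sum.cong refl) auto
    finally show ?thesis .
  qed
  also have "\<dots> = (\<Sum>s\<in>{..t}. real (card (?Q s)) * p ^ s)" by simp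
  also have "\<dots> \<le> (\<Sum>s\<in>{..t}. real ((t + 1) ^ (2 * t)) * (n * (n * p) ^ t))"
  proof (rule sum_mono)
    fix s assume s: "s \<in> {..t}"
    have "card (?Q s) \<le> card {\<phi> \<in> ?P. card (\<phi> ` {..<2 * t}) \<le> s + 1}"
    proof (rule card_mono)
      show "?Q s \<subseteq> {\<phi> \<in> ?P. card (\<phi> ` {..<2 * t}) \<le> s + 1}"
        using card_range_wedges[of "2 * t"] t by fastforce
    qed (use fin in auto)
    also have "\<dots> \<le> card I ^ (s + 1) * (s + 1) ^ (2 * t)"
      using t by (intro card_maps_small_range[OF I]) auto
    also have "\<dots> \<le> card I ^ (s + 1) * (t + 1) ^ (2 * t)"
      using s by (intro mult_left_mono power_mono) auto
    finally have "real (card (?Q s)) \<le> real (card I ^ (s + 1) * (t + 1) ^ (2 * t))"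
      by (rule of_nat_mono)
    then have "real (card (?Q s)) * p ^ s \<le> real (card I ^ (s + 1) * (t + 1) ^ (2 * t)) * p ^ s"
      using p by (intro mult_right_mono) auto
    also have "\<dots> = real ((t + 1) ^ (2 * t)) * (n * (n * p) ^ s)"
      by (simp add: n_def power_mult_distrib)
    also have "\<dots> \<le> real ((t + 1) ^ (2 * t)) * (n * (n * p) ^ t)"
      using d s by (intro mult_left_mono power_increasing) (auto simp: n_def)
    finally show "real (card (?Q s)) * p ^ s \<le> real ((t + 1) ^ (2 * t)) * (n * (n * p) ^ t)" .
  qed
  also have "\<dots> = real ((t + 1) ^ (2 * t + 1)) * (n * (n * p) ^ t)" by (simp add: algebra_simps)
  finally show ?thesis by (simp add: n_def)
qed

text \<open>Once \<open>T\<close> is planted, a walk needs only its edges outside \<open>T\<close>.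
  So the sum that defines a seed is a mean count, and matrix inequalities apply to it.\<close>

lemma planted_mean:
  assumes I: "finite I" and N: "finite N" and T: "T \<subseteq> N" and t: "k \<ge> 1"
  shows "subset_mean p N (\<lambda>E. mtrace I (mpow I (adj_mx (E \<union> T)) k)) =
    (\<Sum>\<phi> | \<phi> \<in> {..<k} \<rightarrow>\<^sub>E I \<and> wedges k \<phi> \<subseteq> N. p ^ card (wedges k \<phi> - T))"
proof -
  have fin: "finite ({..<k} \<rightarrow>\<^sub>E I)" using I by (intro finite_PiE) auto
  have "subset_mean p N (\<lambda>E. mtrace I (mpow I (adj_mx (E \<union> T)) k)) =
     (\<Sum>\<phi>\<in>{..<k} \<rightarrow>\<^sub>E I. subset_mean p N (\<lambda>E. of_bool (wedges k \<phi> \<subseteq> E \<union> T)))"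
    by (simp only: mtrace_adj_mx[OF I t] subset_mean_sum)
  also have "\<dots> = (\<Sum>\<phi>\<in>{..<k} \<rightarrow>\<^sub>E I. if wedges k \<phi> \<subseteq> N then p ^ card (wedges k \<phi> - T) else 0)"
  proof (rule sum.cong[OF refl])
    fix \<phi>
    show "subset_mean p N (\<lambda>E. of_bool (wedges k \<phi> \<subseteq> E \<union> T)) =
      (if wedges k \<phi> \<subseteq> N then p ^ card (wedges k \<phi> - T) else 0)"
    proof (cases "wedges k \<phi> \<subseteq> N")
      case True
      have "subset_mean p N (\<lambda>E. of_bool (wedges k \<phi> \<subseteq> E \<union> T)) = subset_mean p N (\<lambda>E. of_bool (wedges k \<phi> - T \<subseteq> E))"
        by (intro subset_mean_cong arg_cong[of _ _ of_bool]) blast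
      then show ?thesis using True subset_mean_superset[OF N, of "wedges k \<phi> - T" p] by auto
    next
      case False
      have "subset_mean p N (\<lambda>E. of_bool (wedges k \<phi> \<subseteq> E \<union> T)) = subset_mean p N (\<lambda>E. 0)"
        using False T by (intro subset_mean_cong) auto
      then show ?thesis using False by (simp add: subset_mean_def)
    qed
  qed
  also have "\<dots> = (\<Sum>\<phi> | \<phi> \<in> {..<k} \<rightarrow>\<^sub>E I \<and> wedges k \<phi> \<subseteq> N. p ^ card (wedges k \<phi> - T))"
    by (rule sum.inter_filter[OF fin, symmetric])
  finally show ?thesis .
qed

text \<open>Splitting the adjacency matrix into its conditional mean and centred noise, the
  Schatten norm of the noise is negligible since a walk must use each noise edge twice.\<close>

lemma planted_mean_le:
  assumes I: "finite I" and N: "finite N" and T: "T \<subseteq> N" and p: "0 \<le> p" "p \<le> 1" and t: "t \<ge> 1"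
    and d: "real (card I) * p \<ge> 1" and \<epsilon>: "\<epsilon> > 0" and \<beta>: "\<beta> > 0"
    and B: "mtrace I (mpow I (\<lambda>i j. adj_mx T i j + p) (2 * t)) \<le> \<beta>"
  shows "subset_mean p N (\<lambda>E. mtrace I (mpow I (adj_mx (E \<union> T)) (2 * t))) \<le>
    (1 + \<epsilon>) ^ (2 * t) * \<beta> + (1 + 1 / \<epsilon>) ^ (2 * t) *
      (real ((t + 1) ^ (2 * t + 1)) * (real (card I) * (real (card I) * p) ^ t))"
proof -
  \<comment> \<open>The mean of the adjacency matrix of \<open>E \<union> T\<close>. Raising it to
    \<open>adj_mx T i j + p\<close> everywhere only increases the trace, as all entries are
    nonnegative.\<close>
  define M where "M = (\<lambda>i j. if {i, j} \<in> T then 1 else if {i, j} \<in> N then p else 0)"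
  have M: "0 \<le> M i j" "M i j \<le> adj_mx T i j + p" for i j
    using p by (auto simp: M_def adj_mx_def)
  have sM: "symm M" by (simp add: symm_def M_def insert_commute)
  have sW: "symm (noise p (N - T) E)" for E by (simp add: symm_def noise_def insert_commute)
  have "mtrace I (mpow I M (2 * t)) \<le> mtrace I (mpow I (\<lambda>i j. adj_mx T i j + p) (2 * t))"
    by (intro mtrace_mono mpow_mono M)
  then have M\<beta>: "mtrace I (mpow I M (2 * t)) \<le> \<beta>" using B by simp
  have "subset_mean p N (\<lambda>E. mtrace I (mpow I (adj_mx (E \<union> T)) (2 * t))) \<le>
    subset_mean p N (\<lambda>E. (1 + \<epsilon>) ^ (2 * t) * \<beta> + (1 + 1 / \<epsilon>) ^ (2 * t) * mtrace I (mpow I (noise p (N - T) E) (2 * t)))"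
  proof (rule subset_mean_mono[OF p])
    fix E assume E: "E \<subseteq> N"
    have "adj_mx (E \<union> T) = (\<lambda>i j. M i j + noise p (N - T) E i j)"
      using E T by (auto simp: fun_eq_iff adj_mx_def M_def noise_def)
    then show "mtrace I (mpow I (adj_mx (E \<union> T)) (2 * t)) \<le>
      (1 + \<epsilon>) ^ (2 * t) * \<beta> + (1 + 1 / \<epsilon>) ^ (2 * t) * mtrace I (mpow I (noise p (N - T) E) (2 * t))"
      using Schatten_perturb[OF I sM sW t \<beta> \<epsilon> M\<beta>] by simp
  qed
  also have "\<dots> = (1 + \<epsilon>) ^ (2 * t) * \<beta> + (1 + 1 / \<epsilon>) ^ (2 * t) * subset_mean p N (\<lambda>E. mtrace I (mpow I (noise p (N - T) E) (2 * t)))"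
    by (simp only: subset_mean_add subset_mean_cmult subset_mean_const[OF N])
  also have "\<dots> \<le> (1 + \<epsilon>) ^ (2 * t) * \<beta> + (1 + 1 / \<epsilon>) ^ (2 * t) *
      (real ((t + 1) ^ (2 * t + 1)) * (real (card I) * (real (card I) * p) ^ t))"
    using \<epsilon> by (intro add_left_mono mult_left_mono subset_mean_noise_le[OF I N p _ t d]) auto
  finally show ?thesis .
qed

subsection \<open>Cores\<close>

definition pairs :: "'a set \<Rightarrow> 'a set set" where "pairs I = {e. e \<subseteq> I \<and> card e = 2}"

definition deg :: "'a set set \<Rightarrow> 'a \<Rightarrow> nat" where "deg E v = card {w. {v, w} \<in> E}"

lemma finite_pairs: "finite I \<Longrightarrow> finite (pairs I)"
  by (rule finite_subset[of _ "Pow I"]) (auto simp: pairs_def)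

lemma pairs_pairD: "E \<subseteq> pairs I \<Longrightarrow> {v, w} \<in> E \<Longrightarrow> v \<in> I \<and> w \<in> I \<and> v \<noteq> w"
proof -
  assume "E \<subseteq> pairs I" "{v, w} \<in> E"
  then have "{v, w} \<in> pairs I" by (rule subsetD)
  then show ?thesis by (auto simp: pairs_def card_insert_if split: if_splits)
qed

lemma pairsE:
  assumes "E \<subseteq> pairs I" "e \<in> E"
  obtains u v where "e = {u, v}" "u \<noteq> v" "u \<in> I" "v \<in> I"
proof -
  have "card e = 2" "e \<subseteq> I" using assms by (auto simp: pairs_def)
  then obtain u v where "e = {u, v}" "u \<noteq> v" by (auto simp: card_2_iff)
  then show thesis using that \<open>e \<subseteq> I\<close> by auto
qed

lemma row_adj_mx:
  assumes "finite I" "E \<subseteq> pairs I"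
  shows "(\<Sum>j\<in>I. adj_mx E v j) = real (deg E v)"
proof -
  have "{w. {v, w} \<in> E} = I \<inter> {w. {v, w} \<in> E}" using pairs_pairD[OF assms(2)] by auto
  then show ?thesis using assms(1) by (simp add: adj_mx_def of_bool_def sum.If_cases deg_def)
qed

lemma mtotal_adj_mx:
  assumes I: "finite I" and E: "E \<subseteq> pairs I"
  shows "mtotal I (adj_mx E) = 2 * real (card E)"
proof -
  have fE: "finite E" using E finite_pairs[OF I] finite_subset by blast
  have "mtotal I (adj_mx E) = (\<Sum>i\<in>I. \<Sum>j\<in>I. \<Sum>e\<in>E. of_bool ({i, j} = e))"
    unfolding mtotal_def adj_mx_def using fE by (intro sum.cong refl) (simp add: of_bool_def)
  also have "\<dots> = (\<Sum>i\<in>I. \<Sum>e\<in>E. \<Sum>j\<in>I. of_bool ({i, j} = e))"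
    by (intro sum.cong refl sum.swap)
  also have "\<dots> = (\<Sum>e\<in>E. \<Sum>i\<in>I. \<Sum>j\<in>I. of_bool ({i, j} = e))"
    by (rule sum.swap)
  also have "\<dots> = (\<Sum>e\<in>E. 2)"
  proof (rule sum.cong[OF refl])
    fix e assume "e \<in> E"
    then obtain u v where e: "e = {u, v}" "u \<noteq> v" "u \<in> I" "v \<in> I" using pairsE[OF E] by metis
    have "(\<Sum>i\<in>I. \<Sum>j\<in>I. of_bool ({i, j} = e)) = (\<Sum>i\<in>I. \<Sum>j\<in>I. (of_bool (i = u) * of_bool (j = v) + of_bool (i = v) * of_bool (j = u) :: real))"
      using e by (intro sum.cong refl) (auto simp: doubleton_eq_iff)
    also have "\<dots> = 2"
      using e I by (simp add: sum.distrib of_bool_def flip: sum_product)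
    finally show "(\<Sum>i\<in>I. \<Sum>j\<in>I. of_bool ({i, j} = e)) = (2::real)" .
  qed
  finally show ?thesis by simp
qed

lemma sum_deg:
  assumes "finite I" "E \<subseteq> pairs I"
  shows "(\<Sum>v\<in>I. deg E v) = 2 * card E"
proof -
  have "real (\<Sum>v\<in>I. deg E v) = mtotal I (adj_mx E)"
    by (simp add: mtotal_def row_adj_mx[OF assms])
  then have "real (\<Sum>v\<in>I. deg E v) = real (2 * card E)" by (simp add: mtotal_adj_mx[OF assms])
  then show ?thesis by (simp only: of_nat_eq_iff)
qed

lemma card_large_le:
  fixes f :: "'a \<Rightarrow> nat"
  assumes "finite I" "c > 0"
  shows "real (card {v \<in> I. c \<le> real (f v)}) \<le> real (\<Sum>v\<in>I. f v) / c"
proof -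
  have "real (card {v \<in> I. c \<le> real (f v)}) * c = (\<Sum>v \<in> {v \<in> I. c \<le> real (f v)}. c)" by simp
  also have "\<dots> \<le> (\<Sum>v \<in> {v \<in> I. c \<le> real (f v)}. real (f v))" by (intro sum_mono) auto
  also have "\<dots> \<le> (\<Sum>v\<in>I. real (f v))" using assms by (intro sum_mono2) auto
  finally show ?thesis using assms by (simp add: field_simps)
qed

definition cycle_homs :: "'a set \<Rightarrow> nat \<Rightarrow> 'a set set \<Rightarrow> real" where
  "cycle_homs I t E = mtrace I (mpow I (adj_mx E) (2 * t))"

text \<open>Instead of deleting edges one after the other, maximise the count minus \<open>x\<close>
  per edge. Comparison with \<open>T\<close> bounds the loss, and comparison with
  \<open>G - {e}\<close> shows that each remaining edge is worth \<open>x\<close>.\<close>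

lemma extract_core:
  fixes I :: "'a set"
  assumes "finite T" "x \<ge> 0"
  obtains G where "G \<subseteq> T" "cycle_homs I t T - x * real (card T) \<le> cycle_homs I t G"
    "\<And>e. e \<in> G \<Longrightarrow> x \<le> cycle_homs I t G - cycle_homs I t (G - {e})"
proof -
  define \<Phi> where "\<Phi> G = cycle_homs I t G - x * real (card G)" for G :: "'a set set"
  have "Max (\<Phi> ` Pow T) \<in> \<Phi> ` Pow T" using assms by (intro Max_in) auto
  then obtain G where G: "G \<subseteq> T" "\<Phi> G = Max (\<Phi> ` Pow T)" by auto
  have max: "\<Phi> G' \<le> \<Phi> G" if "G' \<subseteq> T" for G' unfolding G(2) using that assms by (intro Max_ge) auto
  have "cycle_homs I t T - x * real (card T) \<le> cycle_homs I t G"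
  proof -
    have "0 \<le> x * real (card G)" using assms by simp
    then show ?thesis using max[of T] by (simp add: \<Phi>_def)
  qed
  moreover have "x \<le> cycle_homs I t G - cycle_homs I t (G - {e})" if e: "e \<in> G" for e
  proof -
    have "card G = Suc (card (G - {e}))"
      using e G(1) assms(1) by (metis card_Suc_Diff1 finite_subset)
    moreover have "\<Phi> (G - {e}) \<le> \<Phi> G" using G(1) by (intro max) auto
    ultimately show ?thesis by (simp add: \<Phi>_def algebra_simps)
  qed
  ultimately show thesis using that G(1) by blast
qed

text \<open>The factor 4t stands for 2t positions and two orientations of the edge; the way back of
  2t - 1 steps is bounded by \<open>entry_odd_degree\<close>.\<close>

lemma edge_removal_le:
  assumes I: "finite I" and G: "G \<subseteq> pairs I" and e: "{u, v} \<in> G" and t: "t \<ge> 2"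
  shows "cycle_homs I t G - cycle_homs I t (G - {{u, v}}) \<le>
    4 * real t * (real (deg G u) * real (deg G v) * (2 * real (card G)) ^ (t - 2))"
proof -
  let ?B = "adj_mx (G - {{u, v}})"
  have uv: "u \<in> I" "v \<in> I" "u \<noteq> v" using pairs_pairD[OF G e] by auto
  define c where "c = (2 * real (card G)) ^ (t - 2)"
  have t': "2 * t - 1 = 2 * (t - 2) + 3" using t by simp
  have col: "(\<Sum>y\<in>I. adj_mx G y i) = real (deg G i)" for i
    using row_adj_mx[OF I G, of i] adj_mx_symm[of G] by (simp add: symm_def)
  have C: "mpow I (adj_mx G) (2 * t - 1) j i \<le> real (deg G j) * real (deg G i) * c" if "i \<in> I" "j \<in> I" for i j
    using entry_odd_degree[where A = "adj_mx G" and k = "t - 2", OF I adj_mx_bounds that(2,1)]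
    unfolding t' c_def mtotal_adj_mx[OF I G] row_adj_mx[OF I G] col .
  have "cycle_homs I t G - cycle_homs I t (G - {{u, v}}) \<le>
      real (2 * t) * (\<Sum>i\<in>I. \<Sum>j\<in>I. (adj_mx G i j - ?B i j) * (real (deg G j) * real (deg G i) * c))"
    unfolding cycle_homs_def
  proof (rule mtrace_delete_le[OF I adj_mx_bounds])
    show "0 \<le> ?B i j" for i j by (rule adj_mx_bounds)
    show "?B i j \<le> adj_mx G i j" for i j by (auto simp: adj_mx_def)
  qed (rule C)
  also have "(\<Sum>i\<in>I. \<Sum>j\<in>I. (adj_mx G i j - ?B i j) * (real (deg G j) * real (deg G i) * c)) =
    (\<Sum>i\<in>I. \<Sum>j\<in>I. (of_bool (i = u) * real (deg G u)) * (of_bool (j = v) * real (deg G v) * c) +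
        (of_bool (i = v) * real (deg G v)) * (of_bool (j = u) * real (deg G u) * c))"
  proof -
    have "{v, u} \<in> G" using e by (simp add: insert_commute)
    then show ?thesis using uv e by (intro sum.cong refl) (auto simp: adj_mx_def doubleton_eq_iff)
  qed
  also have "\<dots> = 2 * (real (deg G u) * real (deg G v) * c)"
    using uv I by (simp add: sum.distrib flip: sum_product)
      (simp add: of_bool_def if_distrib[of "\<lambda>x. x * _"] cong: if_cong)
  finally show ?thesis by (simp add: c_def)
qed

definition low_edges :: "'a set set \<Rightarrow> real \<Rightarrow> 'a set set" where
  "low_edges G \<tau> = {e \<in> G. \<exists>v\<in>e. real (deg G v) < \<tau>}"

lemma low_edges_subset: "low_edges G \<tau> \<subseteq> G" by (auto simp: low_edges_def)

lemma low_edges_mono: "\<sigma> \<le> \<tau> \<Longrightarrow> low_edges G \<sigma> \<subseteq> low_edges G \<tau>" unfolding low_edges_def by (blast intro: less_le_trans)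

text \<open>Edges with an end of degree below \<sigma> form a bipartite graph, edges with both ends
  of degree at least \<tau> get the general bound, and the edges in between are deleted. A walk
  changes from the first kind to the second at a vertex of degree at least q/\<sigma> and continues
  to one of degree at least \<tau>; counting such vertices produces the third term with its gain
  \<sigma>/\<tau>.\<close>

lemma cycle_homs_low_high:
  assumes I: "finite I" and G: "G \<subseteq> pairs I" and t: "t \<ge> 2"
    and q: "\<And>u v. {u, v} \<in> G \<Longrightarrow> q \<le> real (deg G u) * real (deg G v)"
    and st: "0 < \<sigma>" "\<sigma> \<le> \<tau>" "\<sigma>\<^sup>2 \<le> q"
  shows "cycle_homs I t G \<le> 2 * real (card (low_edges G \<sigma>)) ^ t + (2 * real (card (G - low_edges G \<tau>))) ^ t +
    2 ^ (2 * t) * ((2 * real (card G) * \<sigma> / q) * (2 * real (card G) / \<tau>) * (2 * real (card G)) ^ (t - 1)) +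
    4 * real t * real (card (low_edges G \<tau> - low_edges G \<sigma>)) * (2 * real (card G)) ^ (t - 1)"
proof -
  define L where "L = low_edges G \<sigma>"
  define H where "H = G - low_edges G \<tau>"
  define m where "m = real (card G)"
  have fG: "finite G" using G finite_pairs[OF I] finite_subset by blast
  have LH: "L \<inter> H = {}" "L \<subseteq> G" "H \<subseteq> G" using low_edges_mono[OF st(2), of G] low_edges_subset[of G \<sigma>] by (auto simp: L_def H_def)
  have sub: "L \<subseteq> pairs I" "H \<subseteq> pairs I" "L \<union> H \<subseteq> pairs I" using LH G by auto
  have q0: "q > 0" using st by (meson less_le_trans zero_less_power)
  have nn: "nonneg_mx (adj_mx E)" for E :: "'a set set" by (simp add: nonneg_mx_def adj_mx_bounds)
  have sum: "adj_mx (L \<union> H) = (\<lambda>i j. adj_mx L i j + adj_mx H i j)"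
    using LH by (auto simp: adj_mx_def fun_eq_iff)
  \<comment> \<open>The degrees of the ends multiply to at least q >= \<sigma>^2, so exactly one of
    them is below \<sigma>.\<close>
  have lowdeg: "real (deg G i) < \<sigma> \<longleftrightarrow> \<not> real (deg G j) < \<sigma>" if "{i, j} \<in> L" for i j
  proof -
    have "real (deg G i) < \<sigma> \<or> real (deg G j) < \<sigma>" using that by (auto simp: L_def low_edges_def)
    moreover have "\<not> (real (deg G i) < \<sigma> \<and> real (deg G j) < \<sigma>)"
    proof
      assume "real (deg G i) < \<sigma> \<and> real (deg G j) < \<sigma>"
      then have "real (deg G i) * real (deg G j) < \<sigma> * \<sigma>" by (intro mult_strict_mono') auto
      then show False using q[of i j] st(3) that LH(2) by (auto simp: power2_eq_square)
    qed
    ultimately show ?thesis by blast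
  qed
  have Lbound: "mtrace I (mpow I (adj_mx L) (2 * t)) \<le> 2 * real (card L) ^ t"
  proof (rule mtrace_bipartite_le[OF I adj_mx_bounds, where Z = "{v. real (deg G v) < \<sigma>}"])
    have inj: "(\<Sum>i\<in>Y. \<Sum>j\<in>I. adj_mx L i j) \<le> real (card L)"
      if Y: "Y \<subseteq> I" "\<And>i j. {i, j} \<in> L \<Longrightarrow> i \<in> Y \<Longrightarrow> j \<notin> Y" for Y
    proof -
      have fY: "finite Y" using Y I finite_subset by blast
      have "(\<Sum>i\<in>Y. \<Sum>j\<in>I. adj_mx L i j) = real (card {x \<in> Y \<times> I. {fst x, snd x} \<in> L})"
      proof -
        have "{x \<in> Y \<times> I. {fst x, snd x} \<in> L} = (SIGMA i:Y. {j \<in> I. {i, j} \<in> L})" by auto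
        then show ?thesis using fY I by (simp add: adj_mx_def of_bool_def sum.If_cases Int_def)
      qed
      also have "\<dots> \<le> real (card L)"
      proof (intro of_nat_mono card_inj_on_le[of "\<lambda>x. {fst x, snd x}"])
        show "inj_on (\<lambda>x. {fst x, snd x}) {x \<in> Y \<times> I. {fst x, snd x} \<in> L}"
          using Y(2) by (fastforce simp: inj_on_def doubleton_eq_iff)
        show "finite L" using LH fG finite_subset by blast
      qed auto
      finally show ?thesis .
    qed
    show "(\<Sum>i\<in>I \<inter> {v. real (deg G v) < \<sigma>}. \<Sum>j\<in>I. adj_mx L i j) \<le> real (card L)"
      using lowdeg by (intro inj) auto
    show "(\<Sum>i\<in>I - {v. real (deg G v) < \<sigma>}. \<Sum>j\<in>I. adj_mx L i j) \<le> real (card L)"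
      using lowdeg by (intro inj) auto
    show "i \<in> {v. real (deg G v) < \<sigma>} \<longleftrightarrow> j \<notin> {v. real (deg G v) < \<sigma>}" if "adj_mx L i j \<noteq> 0" for i j
      using that lowdeg[of i j] by (auto simp: adj_mx_def split: if_splits)
  qed (use t in auto)
  have Hbound: "mtrace I (mpow I (adj_mx H) (2 * t)) \<le> (2 * real (card H)) ^ t"
    using mtrace_even_le[where A = "adj_mx H" and t = t, OF I adj_mx_bounds] t by (simp add: mtotal_adj_mx[OF I sub(2)])
  define U where "U = {v \<in> I. q / \<sigma> \<le> real (deg G v)}"
  define V where "V = {v \<in> I. \<tau> \<le> real (deg G v)}"
  have cardU: "real (card U) \<le> 2 * m * \<sigma> / q"
    using card_large_le[OF I, of "q / \<sigma>" "deg G"] q0 st sum_deg[OF I G]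
    by (simp add: U_def m_def)
  have cardV: "real (card V) \<le> 2 * m / \<tau>"
    using card_large_le[OF I, of \<tau> "deg G"] st sum_deg[OF I G] by (simp add: V_def m_def)
  have fin: "finite U" "finite V" using I by (auto simp: U_def V_def)
  have mixed: "h \<in> U \<and> x \<in> V" if lhx: "adj_mx L l h \<noteq> 0" "adj_mx H h x \<noteq> 0" for l h x
  proof -
    have e: "{l, h} \<in> L" "{h, x} \<in> H" using lhx by (auto simp: adj_mx_def split: if_splits)
    have ge: "\<tau> \<le> real (deg G h)" "\<tau> \<le> real (deg G x)" using e(2) by (fastforce simp: H_def low_edges_def)+
    then have "real (deg G l) < \<sigma>" using lowdeg[OF e(1)] st by auto
    then have "real (deg G l) * real (deg G h) \<le> \<sigma> * real (deg G h)" by (intro mult_right_mono) auto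
    then have "q \<le> \<sigma> * real (deg G h)" using q[of l h] e LH by auto
    then have "q / \<sigma> \<le> real (deg G h)" using st by (simp add: field_simps)
    then show ?thesis using ge pairs_pairD[OF sub(2) e(2)] by (simp add: U_def V_def)
  qed
  have mt: "mtotal I (adj_mx (L \<union> H)) \<le> 2 * m"
  proof -
    have "card (L \<union> H) \<le> card G" using LH fG by (intro card_mono) auto
    then show ?thesis by (simp add: mtotal_adj_mx[OF I sub(3)] m_def)
  qed
  have m0: "0 \<le> m" by (simp add: m_def)
  have "cycle_homs I t (L \<union> H) \<le> mtrace I (mpow I (adj_mx L) (2 * t)) + mtrace I (mpow I (adj_mx H) (2 * t)) +
     2 ^ (2 * t) * (real (card U) * real (card V) * mtotal I (adj_mx (L \<union> H)) ^ (t - 1))"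
    unfolding cycle_homs_def sum
  proof (rule mtrace_mixed_le[OF I nn nn _ t fin mixed])
    show "adj_mx L i j + adj_mx H i j \<le> 1" for i j using LH by (auto simp: adj_mx_def)
  qed
  also have "\<dots> \<le> 2 * real (card L) ^ t + (2 * real (card H)) ^ t +
     2 ^ (2 * t) * ((2 * m * \<sigma> / q) * (2 * m / \<tau>) * (2 * m) ^ (t - 1))"
    using Lbound Hbound cardU cardV mt q0 st m0
    by (intro add_mono mult_left_mono mult_mono power_mono mult_nonneg_nonneg divide_nonneg_nonneg mtotal_nonneg adj_mx_bounds zero_le_power) auto
  finally have 1: "cycle_homs I t (L \<union> H) \<le> 2 * real (card L) ^ t + (2 * real (card H)) ^ t +
     2 ^ (2 * t) * ((2 * m * \<sigma> / q) * (2 * m / \<tau>) * (2 * m) ^ (t - 1))" .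
  have "cycle_homs I t G - cycle_homs I t (L \<union> H) \<le> real (2 * t) * (mtotal I (adj_mx G) - mtotal I (adj_mx (L \<union> H))) * mtotal I (adj_mx G) ^ (t - 1)"
    unfolding cycle_homs_def
  proof (rule mtrace_delete_mass[OF I adj_mx_bounds])
    show "0 \<le> adj_mx (L \<union> H) i j" for i j by (rule adj_mx_bounds)
    show "adj_mx (L \<union> H) i j \<le> adj_mx G i j" for i j using LH by (auto simp: adj_mx_def)
  qed (use t in auto)
  also have "\<dots> = 4 * real t * (m - real (card (L \<union> H))) * (2 * m) ^ (t - 1)"
    unfolding mtotal_adj_mx[OF I G] mtotal_adj_mx[OF I sub(3)] m_def by simp
  also have "m - real (card (L \<union> H)) = real (card (low_edges G \<tau> - low_edges G \<sigma>))"
  proof -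
    have "low_edges G \<tau> - low_edges G \<sigma> = G - (L \<union> H)" using low_edges_subset[of G \<tau>] by (auto simp: L_def H_def)
    moreover have "card (G - (L \<union> H)) = card G - card (L \<union> H)"
      using LH fG by (intro card_Diff_subset) (auto intro: finite_subset)
    moreover have "card (L \<union> H) \<le> card G" using LH fG by (intro card_mono) auto
    ultimately show ?thesis by (simp add: m_def of_nat_diff)
  qed
  finally show ?thesis using 1 by (simp add: L_def H_def m_def)
qed

lemma low_edges_pigeonhole:
  assumes G: "finite G" and \<tau>: "\<And>i j. i \<le> j \<Longrightarrow> \<tau> i \<le> \<tau> j" and N: "N \<ge> 1"
  obtains j where "j < N" "real N * real (card (low_edges G (\<tau> (Suc j)) - low_edges G (\<tau> j))) \<le> real (card G)"
proof -
  let ?M = "\<lambda>j. low_edges G (\<tau> (Suc j)) - low_edges G (\<tau> j)"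
  have fin: "finite (?M j)" for j using G low_edges_subset finite_subset by (metis finite_Diff)
  have disj: "disjoint_family_on ?M {..<N}"
    unfolding disjoint_family_on_def
  proof (intro ballI impI)
    have *: "?M i \<inter> ?M j = {}" if "i < j" for i j
      using low_edges_mono[OF \<tau>[of "Suc i" j], of G] that by auto
    fix i j :: nat assume "i \<noteq> j"
    then show "?M i \<inter> ?M j = {}" using *[of i j] *[of j i] by (cases "i < j") auto
  qed
  have "(\<Sum>j<N. card (?M j)) = card (\<Union>j<N. ?M j)"
    using fin disj by (intro card_UN_disjoint[symmetric]) (auto simp: disjoint_family_on_def)
  also have "\<dots> \<le> card G" using low_edges_subset[of G] by (intro card_mono G) blast
  finally have le: "(\<Sum>j<N. card (?M j)) \<le> card G" .
  have "\<exists>j<N. N * card (?M j) \<le> card G"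
  proof (rule ccontr)
    assume "\<not> ?thesis"
    then have "(\<Sum>j<N. card G) < (\<Sum>j<N. N * card (?M j))"
      using N by (intro sum_strict_mono) (auto simp: not_le lessThan_empty_iff)
    then have "N * card G < N * (\<Sum>j<N. card (?M j))" by (simp add: sum_distrib_left)
    then show False using mult_le_mono2[OF le, of N] by simp
  qed
  then obtain j where "j < N" "N * card (?M j) \<le> card G" by blast
  then show thesis by (intro that[of j]) (auto simp flip: of_nat_mult)
qed

section \<open>Counting cores\<close>

lemma sum_pow_subsets:
  assumes "finite P"
  shows "(\<Sum>X\<in>Pow P. x ^ card X) = (1 + x :: real) ^ card P"
  using prod_add[OF assms, of "\<lambda>_. x" "\<lambda>_. 1"] by (simp add: add.commute)

lemma one_plus_power_le_exp: "0 \<le> (x::real) \<Longrightarrow> (1 + x) ^ k \<le> exp (real k * x)"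
  using power_mono[OF exp_ge_add_one_self[of x], of k] by (simp add: exp_of_nat_mult[symmetric])

text \<open>Weight a function by z to the size of its support, with z = 1/(nR) and n =
  \<open>card I\<close>. The total weight is (1 + Rz)^n <= e, and each function counted weighs at
  least z^m.\<close>

lemma card_sparse_functions:
  assumes I: "finite I" "I \<noteq> {}" and R: "R \<ge> 1"
  shows "real (card {D \<in> I \<rightarrow>\<^sub>E {0..R}. card {v \<in> I. D v \<noteq> 0} \<le> m}) \<le> exp 1 * (real (card I) * real R) ^ m"
proof -
  define z where "z = 1 / (real (card I) * real R)"
  have n: "real (card I) \<ge> 1" using I by (simp add: Suc_leI card_gt_0_iff)
  have nR: "real (card I) * real R \<ge> 1" using n R by (metis mult_mono' mult_1 of_nat_1 of_nat_mono zero_le_one)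
  have z: "0 < z" "z \<le> 1" using nR by (auto simp: z_def)
  let ?S = "{D \<in> I \<rightarrow>\<^sub>E {0..R}. card {v \<in> I. D v \<noteq> 0} \<le> m}"
  have fin: "finite (I \<rightarrow>\<^sub>E {0..R})" using I by (intro finite_PiE) auto
  have pr: "(\<Prod>v\<in>I. if D v = 0 then 1 else z) = z ^ card {v \<in> I. D v \<noteq> 0}" for D :: "'a \<Rightarrow> nat"
  proof -
    have "I \<inter> - {v. D v = 0} = {v \<in> I. D v \<noteq> 0}" by auto
    then show ?thesis using I by (simp add: prod.If_cases)
  qed
  have "real (card ?S) * z ^ m = (\<Sum>D\<in>?S. z ^ m)" by simp
  also have "\<dots> \<le> (\<Sum>D\<in>?S. \<Prod>v\<in>I. if D v = 0 then 1 else z)"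
    unfolding pr using z by (intro sum_mono power_decreasing) auto
  also have "\<dots> \<le> (\<Sum>D\<in>I \<rightarrow>\<^sub>E {0..R}. \<Prod>v\<in>I. if D v = 0 then 1 else z)"
    using fin z by (intro sum_mono2 prod_nonneg) auto
  also have "\<dots> = (\<Prod>v\<in>I. \<Sum>k\<in>{0..R}. if k = 0 then 1 else z)"
    using I by (intro prod_sum_PiE[symmetric]) auto
  also have "(\<Sum>k\<in>{0..R}. if k = 0 then 1 else z) = 1 + real R * z"
    by (subst sum.atLeast_Suc_atMost) (auto simp: sum.If_cases)
  also have "(\<Prod>v\<in>I. 1 + real R * z) = (1 + real R * z) ^ card I" by simp
  also have "\<dots> \<le> exp (real (card I) * (real R * z))"
    using z by (intro one_plus_power_le_exp) auto
  also have "real (card I) * (real R * z) = 1" using n R by (simp add: z_def)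
  finally have "real (card ?S) * z ^ m \<le> exp 1" .
  then show ?thesis using R I z nR by (simp add: z_def power_one_over field_simps card_gt_0_iff)
qed

definition cores :: "'a set \<Rightarrow> nat \<Rightarrow> real \<Rightarrow> 'a set set set" where
  "cores I R q = {G. G \<subseteq> pairs I \<and> card G \<le> R \<and>
     (\<forall>u v. {u, v} \<in> G \<longrightarrow> q \<le> real (deg G u) * real (deg G v))}"

lemma finite_cores: "finite I \<Longrightarrow> finite (cores I R q)"
  by (rule finite_subset[of _ "Pow (pairs I)"]) (auto simp: cores_def finite_pairs)

text \<open>A core is determined by the degrees of its few high-degree vertices, its edges between
  pairs of large recorded degree product, and its remaining edges, which meet a hub.\<close>

lemma sum_cores_le:
  fixes I :: "'a set"
  assumes I: "finite I" "I \<noteq> {}" and R: "R \<ge> 1" and \<tau>: "0 < \<tau>" "\<tau>\<^sup>2 \<le> q"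
    and xy: "0 \<le> x" "0 \<le> y" and m: "2 * real R / \<tau> \<le> real m"
  shows "(\<Sum>G\<in>cores I R q. x ^ card (G - low_edges G \<tau>) * y ^ card (low_edges G \<tau>)) \<le>
    exp 1 * (real (card I) * real (2 * R)) ^ m *
      exp (x * ((2 * real R)\<^sup>2 / q) + y * (real (card I) * (2 * real R * \<tau> / q)))"
proof -
  have q0: "q > 0" using \<tau> by (meson less_le_trans zero_less_power)
  define P where "P D = {e \<in> pairs I. \<exists>u v. e = {u, v} \<and> q \<le> real (D u) * real (D v)}" for D :: "'a \<Rightarrow> nat"
  define Q where "Q D = {e \<in> pairs I. \<exists>v\<in>e. q / \<tau> \<le> real (D v)}" for D :: "'a \<Rightarrow> nat"
  define \<D> where "\<D> = {D \<in> I \<rightarrow>\<^sub>E {0..2 * R}. card {v \<in> I. D v \<noteq> 0} \<le> m \<and> (\<Sum>v\<in>I. D v) \<le> 2 * R}"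
  \<comment> \<open>Degrees below \<tau> are recorded as 0. The recorded function then has support
    of size at most 2R/\<tau>, so there are few such functions.\<close>
  define \<Delta> where "\<Delta> G = (\<lambda>v\<in>I. if \<tau> \<le> real (deg G v) then deg G v else 0)" for G :: "'a set set"
  define F where "F G = (\<Delta> G, G - low_edges G \<tau>, low_edges G \<tau>)" for G
  have finP: "finite (P D)" "finite (Q D)" for D using finite_pairs[OF I(1)] by (auto simp: P_def Q_def)
  have finD: "finite \<D>"
    unfolding \<D>_def using I by (intro finite_subset[OF _ finite_PiE[of I "\<lambda>_. {0..2 * R}"]]) auto
  have FG: "F G \<in> (SIGMA D:\<D>. Pow (P D) \<times> Pow (Q D))" if "G \<in> cores I R q" for G
  proof -
    have G: "G \<subseteq> pairs I" "card G \<le> R" and Gq: "\<And>u v. {u, v} \<in> G \<Longrightarrow> q \<le> real (deg G u) * real (deg G v)"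
      using that by (auto simp: cores_def)
    have sd: "(\<Sum>v\<in>I. deg G v) \<le> 2 * R" using sum_deg[OF I(1) G(1)] G(2) by simp
    have \<Delta>le: "\<Delta> G v \<le> deg G v" if "v \<in> I" for v using that by (simp add: \<Delta>_def)
    have s\<Delta>: "(\<Sum>v\<in>I. \<Delta> G v) \<le> 2 * R"
      using sum_mono[of I "\<Delta> G" "deg G"] \<Delta>le sd by (meson order_trans)
    have "\<Delta> G v \<le> 2 * R" if "v \<in> I" for v
      using member_le_sum[of v I "\<Delta> G"] that I(1) s\<Delta> by simp
    moreover have "card {v \<in> I. \<Delta> G v \<noteq> 0} \<le> m"
    proof -
      have "real (card {v \<in> I. \<Delta> G v \<noteq> 0}) \<le> real (card {v \<in> I. \<tau> \<le> real (deg G v)})"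
        using I(1) by (intro of_nat_mono card_mono) (auto simp: \<Delta>_def)
      also have "\<dots> \<le> real (\<Sum>v\<in>I. deg G v) / \<tau>" by (rule card_large_le[OF I(1) \<tau>(1)])
      also have "\<dots> \<le> 2 * real R / \<tau>"
        using \<tau> of_nat_mono[OF sd, where 'a = real] by (intro divide_right_mono) auto
      finally show ?thesis using m by (simp only: of_nat_le_iff)
    qed
    ultimately have 1: "\<Delta> G \<in> \<D>" using s\<Delta> by (auto simp: \<D>_def \<Delta>_def)
    have 2: "G - low_edges G \<tau> \<subseteq> P (\<Delta> G)"
    proof
      fix e assume e: "e \<in> G - low_edges G \<tau>"
      then obtain u v where uv: "e = {u, v}" "u \<in> I" "v \<in> I" using pairsE[OF G(1)] by (metis Diff_iff)
      have "\<tau> \<le> real (deg G u)" "\<tau> \<le> real (deg G v)" using e uv(1) by (auto simp: low_edges_def)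
      then have "\<Delta> G u = deg G u" "\<Delta> G v = deg G v" using uv by (auto simp: \<Delta>_def)
      then have "q \<le> real (\<Delta> G u) * real (\<Delta> G v)" using Gq[of u v] e uv(1) by simp
      then show "e \<in> P (\<Delta> G)" using e G(1) uv(1) by (auto simp: P_def)
    qed
    have 3: "low_edges G \<tau> \<subseteq> Q (\<Delta> G)"
    proof
      fix e assume e: "e \<in> low_edges G \<tau>"
      then have eG: "e \<in> G" using low_edges_subset by blast
      have "\<exists>u v. e = {u, v} \<and> u \<in> I \<and> v \<in> I \<and> real (deg G v) < \<tau>"
      proof -
        obtain a b where ab: "e = {a, b}" "a \<in> I" "b \<in> I" using pairsE[OF G(1) eG] by metis
        have "real (deg G a) < \<tau> \<or> real (deg G b) < \<tau>" using e ab(1) by (auto simp: low_edges_def)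
        then show ?thesis using ab by (metis insert_commute)
      qed
      then obtain u v where uv: "e = {u, v}" "u \<in> I" "v \<in> I" "real (deg G v) < \<tau>" by blast
      have "q \<le> real (deg G u) * real (deg G v)" using Gq[of u v] eG uv(1) by simp
      also have "\<dots> \<le> real (deg G u) * \<tau>" using uv(4) by (intro mult_left_mono) auto
      finally have qd: "q / \<tau> \<le> real (deg G u)" using \<tau> by (simp add: field_simps)
      \<comment> \<open>The partner of a vertex of degree below \<tau> has degree at least q/\<tau>;
        as \<tau>^2 <= q, the degree of this hub has been recorded.\<close>
      have "\<tau> \<le> q / \<tau>" using \<tau> by (simp add: field_simps power2_eq_square)
      then have "\<Delta> G u = deg G u" using qd uv by (simp add: \<Delta>_def)
      then show "e \<in> Q (\<Delta> G)" using qd uv(1) eG G(1) by (auto simp: Q_def)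
    qed
    show ?thesis using 1 2 3 by (simp add: F_def)
  qed
  have inj: "inj_on F (cores I R q)"
  proof (rule inj_onI)
    fix G G' assume "F G = F G'"
    then have "G - low_edges G \<tau> = G' - low_edges G' \<tau>" "low_edges G \<tau> = low_edges G' \<tau>"
      unfolding F_def prod.inject by blast+
    then show "G = G'" using low_edges_subset[of G \<tau>] low_edges_subset[of G' \<tau>] by blast
  qed
  let ?w = "\<lambda>(D, A, B). x ^ card A * y ^ card B"
  have "(\<Sum>G\<in>cores I R q. x ^ card (G - low_edges G \<tau>) * y ^ card (low_edges G \<tau>)) = (\<Sum>G\<in>cores I R q. ?w (F G))"
    by (simp add: F_def)
  also have "\<dots> = (\<Sum>z\<in>F ` cores I R q. ?w z)" by (simp add: sum.reindex[OF inj])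
  also have "\<dots> \<le> (\<Sum>z\<in>(SIGMA D:\<D>. Pow (P D) \<times> Pow (Q D)). ?w z)"
  proof (rule sum_mono2)
    show "F ` cores I R q \<subseteq> (SIGMA D:\<D>. Pow (P D) \<times> Pow (Q D))" using FG by (rule image_subsetI)
  qed (use finD finP xy in \<open>auto intro!: finite_SigmaI\<close>)
  also have "\<dots> = (\<Sum>D\<in>\<D>. \<Sum>A\<in>Pow (P D). \<Sum>B\<in>Pow (Q D). x ^ card A * y ^ card B)"
  proof -
    have "(\<Sum>z\<in>(SIGMA D:\<D>. Pow (P D) \<times> Pow (Q D)). ?w z) = (\<Sum>D\<in>\<D>. \<Sum>z\<in>Pow (P D) \<times> Pow (Q D). ?w (D, z))"
      using finD finP by (subst sum.Sigma) (auto simp: case_prod_beta)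
    then show ?thesis by (simp add: sum.cartesian_product case_prod_beta)
  qed
  also have "\<dots> = (\<Sum>D\<in>\<D>. (1 + x) ^ card (P D) * (1 + y) ^ card (Q D))"
    using finP by (simp add: sum_product[symmetric] sum_pow_subsets)
  also have "\<dots> \<le> (\<Sum>D\<in>\<D>. exp (x * ((2 * real R)\<^sup>2 / q) + y * (real (card I) * (2 * real R * \<tau> / q))))"
  proof (rule sum_mono)
    fix D assume D: "D \<in> \<D>"
    have sD: "real (\<Sum>v\<in>I. D v) \<le> 2 * real R"
    proof -
      have "(\<Sum>v\<in>I. D v) \<le> 2 * R" using D by (simp add: \<D>_def)
      from of_nat_mono[OF this, where 'a = real] show ?thesis by simp
    qed
    \<comment> \<open>The product of recorded degrees, summed over all ordered pairs, is the square
      of the degree sum, hence at most (2R)^2.\<close>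
    have "real (card (P D)) * q \<le> (2 * real R)\<^sup>2"
    proof -
      let ?X = "{z \<in> I \<times> I. q \<le> real (D (fst z)) * real (D (snd z))}"
      have fX: "finite ?X" using I by auto
      have "P D \<subseteq> (\<lambda>z. {fst z, snd z}) ` ?X"
      proof
        fix e assume e: "e \<in> P D"
        then obtain u v where uv: "e = {u, v}" "q \<le> real (D u) * real (D v)" by (auto simp: P_def)
        then have "u \<in> I" "v \<in> I" using e by (auto simp: P_def pairs_def)
        then show "e \<in> (\<lambda>z. {fst z, snd z}) ` ?X" using uv by (intro image_eqI[of _ _ "(u, v)"]) auto
      qed
      then have "card (P D) \<le> card ?X" using fX by (intro order_trans[OF card_mono card_image_le]) auto
      then have "real (card (P D)) * q \<le> real (card ?X) * q" using q0 by (intro mult_right_mono) auto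
      also have "\<dots> = (\<Sum>z\<in>?X. q)" by simp
      also have "\<dots> \<le> (\<Sum>z\<in>?X. real (D (fst z)) * real (D (snd z)))" by (intro sum_mono) auto
      also have "\<dots> \<le> (\<Sum>z\<in>I \<times> I. real (D (fst z)) * real (D (snd z)))"
        using I by (intro sum_mono2) auto
      also have "\<dots> = (real (\<Sum>v\<in>I. D v))\<^sup>2"
        by (simp add: power2_eq_square sum_product sum.cartesian_product case_prod_beta)
      also have "\<dots> \<le> (2 * real R)\<^sup>2" by (rule power_mono[OF sD of_nat_0_le_iff])
      finally show ?thesis .
    qed
    then have cP: "real (card (P D)) \<le> (2 * real R)\<^sup>2 / q" using q0 by (simp add: field_simps)
    \<comment> \<open>At most 2R\<tau>/q vertices qualify as hubs, and each has at most
      \<open>card I\<close> partners.\<close>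
    have cQ: "real (card (Q D)) \<le> real (card I) * (2 * real R * \<tau> / q)"
    proof -
      let ?V = "{v \<in> I. q / \<tau> \<le> real (D v)}"
      have "Q D \<subseteq> (\<lambda>z. {fst z, snd z}) ` (?V \<times> I)"
      proof
        fix e assume e: "e \<in> Q D"
        then obtain v where v: "v \<in> e" "q / \<tau> \<le> real (D v)" by (auto simp: Q_def)
        obtain a b where ab: "e = {a, b}" "a \<in> I" "b \<in> I"
        proof -
          have "e \<in> pairs I" using e by (simp add: Q_def)
          then show thesis by (rule pairsE[OF subset_refl]) (rule that)
        qed
        show "e \<in> (\<lambda>z. {fst z, snd z}) ` (?V \<times> I)"
        proof (cases "v = a")
          case True
          then show ?thesis using ab v by (intro image_eqI[of _ _ "(a, b)"]) auto
        next
          case False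
          then show ?thesis using ab v by (intro image_eqI[of _ _ "(b, a)"]) auto
        qed
      qed
      then have "card (Q D) \<le> card (?V \<times> I)" using I
        by (intro order_trans[OF card_mono card_image_le]) auto
      then have "real (card (Q D)) \<le> real (card ?V) * real (card I)"
        by (simp only: card_cartesian_product flip: of_nat_mult)
      also have "\<dots> \<le> (real (\<Sum>v\<in>I. D v) / (q / \<tau>)) * real (card I)"
        using q0 \<tau> by (intro mult_right_mono card_large_le[OF I(1)]) auto
      also have "\<dots> \<le> (2 * real R / (q / \<tau>)) * real (card I)"
        using sD q0 \<tau> by (intro mult_right_mono divide_right_mono) auto
      finally show ?thesis by (simp add: mult_ac)
    qed
    have "(1 + x) ^ card (P D) * (1 + y) ^ card (Q D) \<le> exp (real (card (P D)) * x) * exp (real (card (Q D)) * y)"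
      using xy by (intro mult_mono one_plus_power_le_exp) auto
    also have "\<dots> \<le> exp (x * ((2 * real R)\<^sup>2 / q) + y * (real (card I) * (2 * real R * \<tau> / q)))"
      using mult_left_mono[OF cP xy(1)] mult_left_mono[OF cQ xy(2)]
      by (simp add: exp_add[symmetric] mult.commute)
    finally show "(1 + x) ^ card (P D) * (1 + y) ^ card (Q D) \<le>
      exp (x * ((2 * real R)\<^sup>2 / q) + y * (real (card I) * (2 * real R * \<tau> / q)))" .
  qed
  also have "\<dots> = real (card \<D>) * exp (x * ((2 * real R)\<^sup>2 / q) + y * (real (card I) * (2 * real R * \<tau> / q)))"
    by simp
  also have "real (card \<D>) \<le> exp 1 * (real (card I) * real (2 * R)) ^ m"
  proof -
    have "card \<D> \<le> card {D \<in> I \<rightarrow>\<^sub>E {0..2 * R}. card {v \<in> I. D v \<noteq> 0} \<le> m}"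
      using I by (intro card_mono finite_subset[OF _ finite_PiE[of I "\<lambda>_. {0..2 * R}"]]) (auto simp: \<D>_def)
    then have "real (card \<D>) \<le> real (card {D \<in> I \<rightarrow>\<^sub>E {0..2 * R}. card {v \<in> I. D v \<noteq> 0} \<le> m})" by simp
    also have "\<dots> \<le> exp 1 * (real (card I) * real (2 * R)) ^ m"
      using R by (intro card_sparse_functions I) auto
    finally show ?thesis .
  qed
  finally show ?thesis by (simp add: mult_right_mono)
qed

text \<open>Write p^(a+b) as (p/x)^a (p/y)^b times x^a y^b. The first part is at most \<Xi> for the
  cores in question; the second is summed over all cores by \<open>sum_cores_le\<close>. The weights
  decide how much of \<open>p\<close> pays for the number of possible edges of each kind.\<close>

lemma core_union_bound:
  fixes I :: "'a set"
  assumes I: "finite I" "I \<noteq> {}" and R: "R \<ge> 1" and \<tau>: "0 < \<tau>" "\<tau>\<^sup>2 \<le> q"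
    and xy: "0 < x" "0 < y" and m: "2 * real R / \<tau> \<le> real m" and p: "0 \<le> p" "p \<le> 1"
    and \<Xi>: "\<And>G. G \<in> cores I R q \<Longrightarrow> Q G \<Longrightarrow> (p / x) ^ card (G - low_edges G \<tau>) * (p / y) ^ card (low_edges G \<tau>) \<le> \<Xi>"
    and \<Xi>0: "0 \<le> \<Xi>"
  shows "subset_mean p (pairs I) (\<lambda>E. of_bool (\<exists>G\<subseteq>E. G \<in> cores I R q \<and> Q G)) \<le>
    \<Xi> * (exp 1 * (real (card I) * real (2 * R)) ^ m *
      exp (x * ((2 * real R)\<^sup>2 / q) + y * (real (card I) * (2 * real R * \<tau> / q))))"
proof -
  let ?C = "{G \<in> cores I R q. Q G}"
  have fC: "finite ?C" "finite (cores I R q)" using finite_cores[OF I(1)] by auto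
  have "subset_mean p (pairs I) (\<lambda>E. of_bool (\<exists>G\<subseteq>E. G \<in> cores I R q \<and> Q G)) \<le>
     subset_mean p (pairs I) (\<lambda>E. \<Sum>G\<in>?C. of_bool (G \<subseteq> E))"
  proof (rule subset_mean_mono[OF p])
    fix E
    show "of_bool (\<exists>G\<subseteq>E. G \<in> cores I R q \<and> Q G) \<le> (\<Sum>G\<in>?C. of_bool (G \<subseteq> E) :: real)"
    proof (cases "\<exists>G\<subseteq>E. G \<in> cores I R q \<and> Q G")
      case True
      then obtain G where G: "G \<subseteq> E" "G \<in> ?C" by auto
      have "(of_bool (G \<subseteq> E) :: real) \<le> (\<Sum>G\<in>?C. of_bool (G \<subseteq> E))"
        using fC G by (intro member_le_sum) auto
      then show ?thesis using G True by simp
    qed (auto intro!: sum_nonneg)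
  qed
  also have "\<dots> = (\<Sum>G\<in>?C. p ^ card G)"
    unfolding subset_mean_sum using finite_pairs[OF I(1)]
    by (intro sum.cong refl subset_mean_superset) (auto simp: cores_def)
  also have "\<dots> \<le> (\<Sum>G\<in>?C. \<Xi> * (x ^ card (G - low_edges G \<tau>) * y ^ card (low_edges G \<tau>)))"
  proof (rule sum_mono)
    fix G assume G: "G \<in> ?C"
    have "finite G" using G finite_pairs[OF I(1)] finite_subset by (auto simp: cores_def)
    then have "card G = card (G - low_edges G \<tau>) + card (low_edges G \<tau>)"
      using low_edges_subset[of G \<tau>] by (metis Diff_partition card_Diff_subset card_mono finite_subset le_add_diff_inverse2)
    then have "p ^ card G = ((p / x) ^ card (G - low_edges G \<tau>) * (p / y) ^ card (low_edges G \<tau>)) * (x ^ card (G - low_edges G \<tau>) * y ^ card (low_edges G \<tau>))"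
      using xy by (simp add: power_add power_divide)
    also have "\<dots> \<le> \<Xi> * (x ^ card (G - low_edges G \<tau>) * y ^ card (low_edges G \<tau>))"
      using \<Xi>[of G] G xy by (intro mult_right_mono) auto
    finally show "p ^ card G \<le> \<Xi> * (x ^ card (G - low_edges G \<tau>) * y ^ card (low_edges G \<tau>))" .
  qed
  also have "\<dots> \<le> \<Xi> * (\<Sum>G\<in>cores I R q. x ^ card (G - low_edges G \<tau>) * y ^ card (low_edges G \<tau>))"
    unfolding sum_distrib_left using fC xy \<Xi>0 by (intro sum_mono2) auto
  also have "\<dots> \<le> \<Xi> * (exp 1 * (real (card I) * real (2 * R)) ^ m *
      exp (x * ((2 * real R)\<^sup>2 / q) + y * (real (card I) * (2 * real R * \<tau> / q))))"
    using xy by (intro mult_left_mono sum_cores_le I R \<tau> m \<Xi>0) auto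
  finally show ?thesis .
qed

subsection \<open>Bounds for a fixed number of vertices\<close>

lemma all_pairs_eq: "all_pairs n = pairs {1..n}"
  by (simp add: all_pairs_def pairs_def)

lemma card_pairs: "finite I \<Longrightarrow> card (pairs I) = card I choose 2"
  by (simp add: pairs_def n_subsets)

lemma two_card_pairs: "finite I \<Longrightarrow> 2 * real (card (pairs I)) = real (card I) * (real (card I) - 1)"
proof -
  assume "finite I"
  moreover have "even (card I * (card I - 1))" by (cases "card I") auto
  ultimately have "2 * card (pairs I) = card I * (card I - 1)"
    by (simp only: card_pairs choose_two dvd_mult_div_cancel)
  then have "real (2 * card (pairs I)) = real (card I * (card I - 1))" by (simp only:)
  then show ?thesis by (cases "card I") (simp_all add: algebra_simps)
qed

text \<open>The product law is supported on the finitely many predicates that are false outside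
  \<open>all_pairs n\<close>, that is, on subsets of it; the integral is therefore a finite
  sum.\<close>

lemma erdos_renyi_expectation:
  assumes "0 \<le> p" "p \<le> 1"
  shows "measure_pmf.expectation (erdos_renyi n p) f = subset_mean p (pairs {1..n}) (\<lambda>E. f ({1..n}, E))"
proof -
  let ?N = "all_pairs n"
  have fin: "finite ?N" unfolding all_pairs_eq by (intro finite_pairs) simp
  let ?P = "Pi_pmf ?N False (\<lambda>_. bernoulli_pmf p)"
  define S where "S = (\<lambda>X x. x \<in> X) ` Pow ?N"
  have finS: "finite S" using fin by (simp add: S_def)
  have inj: "inj_on (\<lambda>X x. x \<in> X) (Pow ?N)" by (auto simp: inj_on_def fun_eq_iff)
  have sub: "set_pmf ?P \<subseteq> S"
  proof
    fix X assume "X \<in> set_pmf ?P"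
    then have "X \<in> {f. \<forall>x. x \<notin> ?N \<longrightarrow> f x = False}" by (rule subsetD[OF set_Pi_pmf_subset[OF fin]])
    then show "X \<in> S" unfolding S_def by (intro image_eqI[of _ _ "{x. X x}"]) auto
  qed
  have "measure_pmf.expectation (erdos_renyi n p) f = measure_pmf.expectation ?P (\<lambda>X. f ({1..n}, {e \<in> ?N. X e}))"
    by (simp add: erdos_renyi_def)
  also have "\<dots> = (\<Sum>X\<in>S. pmf ?P X *\<^sub>R f ({1..n}, {e \<in> ?N. X e}))"
    by (rule integral_measure_pmf[OF finS]) (use sub in auto)
  also have "\<dots> = (\<Sum>E\<in>Pow ?N. pmf ?P (\<lambda>x. x \<in> E) * f ({1..n}, {e \<in> ?N. e \<in> E}))"
    unfolding S_def by (simp add: sum.reindex[OF inj])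
  also have "\<dots> = subset_mean p ?N (\<lambda>E. f ({1..n}, E))"
    unfolding subset_mean_def
  proof (rule sum.cong[OF refl])
    fix E assume E: "E \<in> Pow ?N"
    have "pmf ?P (\<lambda>x. x \<in> E) = (\<Prod>x\<in>?N. if x \<in> E then p else 1 - p)"
      using fin assms E by (subst pmf_Pi') (auto intro!: prod.cong)
    also have "\<dots> = p ^ card E * (1 - p) ^ card (?N - E)"
      using fin E by (simp add: prod.If_cases Int_absorb1 Diff_eq[symmetric])
    moreover have "{e \<in> ?N. e \<in> E} = E" using E by auto
    ultimately show "pmf ?P (\<lambda>x. x \<in> E) * f ({1..n}, {e \<in> ?N. e \<in> E}) =
        p ^ card E * (1 - p) ^ card (?N - E) * f ({1..n}, E)"
      by (simp only:)
  qed
  finally show ?thesis by (simp add: all_pairs_eq)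
qed

lemma Hom_eq_cycle_homs:
  assumes "t \<ge> 2" "finite I"
  shows "Hom (cycle_graph (2 * t)) (I, E) = cycle_homs I t E"
  using assms by (simp add: Hom_cycle_graph cycle_homs_def mtrace_adj_mx)

text \<open>Walks that cannot occur, such as those with a step in place, must be removed from the
  index set, because the seed sum would give them a positive weight.\<close>

lemma cycle_homs_walks:
  assumes "finite I" "t \<ge> 1" "E \<subseteq> N"
  shows "cycle_homs I t E = (\<Sum>\<phi> | \<phi> \<in> {..<2 * t} \<rightarrow>\<^sub>E I \<and> wedges (2 * t) \<phi> \<subseteq> N. of_bool (wedges (2 * t) \<phi> \<subseteq> E))"
proof -
  have fin: "finite ({..<2 * t} \<rightarrow>\<^sub>E I)" using assms by (intro finite_PiE) auto
  have "2 * t \<ge> 1" using assms by simp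
  then show ?thesis unfolding cycle_homs_def mtrace_adj_mx[OF assms(1) \<open>2 * t \<ge> 1\<close>]
    using assms(3) fin by (intro sum.mono_neutral_right) auto
qed

lemma cycle_homs_Sidorenko:
  assumes "finite I" "I \<noteq> {}" "E \<subseteq> pairs I"
  shows "(2 * real (card E) / real (card I)) ^ (2 * t) \<le> cycle_homs I t E"
  using Sidorenko_even_cycle[OF assms(1) adj_mx_symm assms(2), where t = t and E1 = E]
  by (simp add: cycle_homs_def mtotal_adj_mx[OF assms(1,3)])

text \<open>The case of an empty planted set: without walks in it, \<eta> can be taken to be 0 in
  \<open>mtrace_shift_le\<close>.\<close>

lemma subset_mean_cycle_homs_le:
  assumes I: "finite I" and p: "0 \<le> p" "p \<le> 1" and t: "t \<ge> 1"
    and d: "real (card I) * p \<ge> 1" and \<epsilon>: "\<epsilon> > 0"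
  shows "subset_mean p (pairs I) (cycle_homs I t) \<le> (1 + \<epsilon>) ^ (2 * t) * (real (card I) * p) ^ (2 * t) + (1 + 1 / \<epsilon>) ^ (2 * t) *
      (real ((t + 1) ^ (2 * t + 1)) * (real (card I) * (real (card I) * p) ^ t))"
proof -
  let ?D = "real (card I) * p"
  have z: "mpow I (adj_mx {}) j a b = 0" if "j \<ge> 1" for j a b
  proof -
    have eq: "replicate j (adj_mx {} :: 'a mx) = adj_mx {} # replicate (j - 1) (adj_mx {})" using that by (cases j) auto
    show ?thesis by (subst eq) (simp add: wprod_Cons_entry adj_mx_def)
  qed
  have "mtrace I (mpow I (\<lambda>i j. adj_mx {} i j + p) (2 * t)) \<le> mtrace I (mpow I (adj_mx {}) (2 * t)) + ?D ^ (2 * t) * (1 + real (2 * t) * (5 ^ (2 * t) * 0))"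
  proof (rule mtrace_shift_le[OF I p(1), where D = ?D])
    show "p * mtotal I (mpow I (adj_mx {}) j) \<le> 0 * ?D ^ (j + 1)" if "1 \<le> j" for j
      using z[OF that] by (simp add: mtotal_def)
  qed (use d p t adj_mx_bounds in \<open>auto simp: mult.commute\<close>)
  also have "\<dots> = ?D ^ (2 * t)" using z[of "2 * t"] t by (simp add: mtrace_def)
  finally have "mtrace I (mpow I (\<lambda>i j. adj_mx {} i j + p) (2 * t)) \<le> ?D ^ (2 * t)" .
  then have "subset_mean p (pairs I) (\<lambda>E. mtrace I (mpow I (adj_mx (E \<union> {})) (2 * t))) \<le> (1 + \<epsilon>) ^ (2 * t) * ?D ^ (2 * t) + (1 + 1 / \<epsilon>) ^ (2 * t) *
      (real ((t + 1) ^ (2 * t + 1)) * (real (card I) * ?D ^ t))"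
    using d by (intro planted_mean_le[OF I finite_pairs[OF I] _ p t d \<epsilon>]) auto
  then show ?thesis by (simp add: cycle_homs_def[abs_def])
qed

text \<open>Repeated edges only make a walk more likely, so the mean is at least p^(2t) times the
  count in the complete graph, for which Sidorenko's inequality is enough.\<close>

lemma subset_mean_cycle_homs_ge:
  assumes I: "finite I" "I \<noteq> {}" and p: "0 \<le> p" "p \<le> 1" and t: "t \<ge> 1"
  shows "((real (card I) - 1) * p) ^ (2 * t) \<le> subset_mean p (pairs I) (cycle_homs I t)"
proof -
  let ?J = "{\<phi> \<in> {..<2 * t} \<rightarrow>\<^sub>E I. wedges (2 * t) \<phi> \<subseteq> pairs I}"
  have t': "2 * t \<ge> 1" using t by simp
  have "2 * real (card (pairs I)) / real (card I) = real (card I) - 1"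
    using I by (simp add: two_card_pairs)
  then have "(real (card I) - 1) ^ (2 * t) \<le> cycle_homs I t (pairs I)"
    using cycle_homs_Sidorenko[OF I subset_refl, of t] by simp
  then have "((real (card I) - 1) * p) ^ (2 * t) \<le> cycle_homs I t (pairs I) * p ^ (2 * t)"
    using p by (simp add: power_mult_distrib mult_right_mono)
  also have "cycle_homs I t (pairs I) = (\<Sum>\<phi>\<in>?J. 1)"
    unfolding cycle_homs_walks[OF I(1) t subset_refl] by (intro sum.cong) auto
  also have "(\<Sum>\<phi>\<in>?J. 1) * p ^ (2 * t) = (\<Sum>\<phi>\<in>?J. p ^ (2 * t))" by simp
  also have "\<dots> \<le> (\<Sum>\<phi>\<in>?J. p ^ card (wedges (2 * t) \<phi> - {}))"
    using p card_wedges_le by (intro sum_mono power_decreasing) auto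
  also have "\<dots> = subset_mean p (pairs I) (\<lambda>E. mtrace I (mpow I (adj_mx (E \<union> {})) (2 * t)))"
    by (rule planted_mean[OF I(1) finite_pairs[OF I(1)] _ t', symmetric]) simp
  finally show ?thesis by (simp add: cycle_homs_def[abs_def])
qed

section \<open>Planting a clique or a star\<close>

lemma cycle_homs_superadd:
  assumes "A \<inter> B = {}" "t \<ge> 1"
  shows "cycle_homs I t (E \<inter> A) + cycle_homs I t (E \<inter> B) \<le> cycle_homs I t E"
proof -
  have nn: "nonneg_mx (adj_mx E)" for E :: "'a set set" by (simp add: nonneg_mx_def adj_mx_bounds)
  have "cycle_homs I t (E \<inter> A) + cycle_homs I t (E \<inter> B) \<le> mtrace I (mpow I (\<lambda>i j. adj_mx (E \<inter> A) i j + adj_mx (E \<inter> B) i j) (2 * t))"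
    unfolding cycle_homs_def using assms by (intro mtrace_superadd nn) auto
  also have "\<dots> \<le> cycle_homs I t E"
    unfolding cycle_homs_def using assms by (intro mtrace_mono mpow_mono) (auto simp: adj_mx_def)
  finally show ?thesis .
qed

text \<open>The pairs outside \<open>A\<close> form an independent background, which with
  probability at least 1/2 has more than a fraction 1 - x of its expected edges; \<open>big\<close>
  makes the Chebyshev bound at most 1/2. The square in \<open>z\<close> collects the pairs given up
  to \<open>A\<close> and the deviation of the edge count.\<close>

lemma planting_lower_bound:
  assumes I: "finite I" "I \<noteq> {}" and p: "0 < p" "p \<le> 1" and t: "t \<ge> 1" and A: "A \<subseteq> pairs I"
    and x: "0 < x" "x < 1" and B: "(1 - x) * (real (card I))\<^sup>2 / 2 \<le> real (card (pairs I - A))"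
    and big: "4 \<le> x\<^sup>2 * (1 - x) * (real (card I))\<^sup>2 * p"
    and z: "z2 \<le> ((1 - x)\<^sup>2 * (real (card I) * p)) ^ (2 * t)"
  shows "subset_mean p A (\<lambda>E. of_bool (z1 \<le> cycle_homs I t E)) / 2 \<le> subset_mean p (pairs I) (\<lambda>E. of_bool (z1 + z2 \<le> cycle_homs I t E))"
proof -
  define n where "n = real (card I)"
  have n: "n > 0" using I by (simp add: n_def card_gt_0_iff)
  define B' where "B' = pairs I - A"
  have fin: "finite A" "finite B'" using A finite_pairs[OF I(1)] finite_subset by (auto simp: B'_def)
  have U: "pairs I = A \<union> B'" "A \<inter> B' = {}" using A by (auto simp: B'_def)
  have Bn: "(1 - x) * n\<^sup>2 / 2 \<le> real (card B')" using B by (simp add: B'_def n_def)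
  have "0 < (1 - x) * n\<^sup>2 / 2" using x n by simp
  then have B0: "real (card B') > 0" using Bn by linarith
  have bigB: "2 \<le> x\<^sup>2 * (real (card B') * p)"
  proof -
    have "4 \<le> x\<^sup>2 * ((1 - x) * n\<^sup>2) * p" using big by (simp add: n_def mult.assoc)
    also have "\<dots> \<le> x\<^sup>2 * (2 * real (card B')) * p"
      using Bn p by (intro mult_right_mono mult_left_mono) auto
    finally show ?thesis by (simp add: mult_ac)
  qed
  have half: "1 / 2 \<le> subset_mean p B' (\<lambda>E. of_bool (z2 \<le> cycle_homs I t E))"
  proof -
    have "subset_mean p B' (\<lambda>E. of_bool (real (card E) \<le> (1 - x) * (real (card B') * p))) \<le> 1 / (x\<^sup>2 * (real (card B') * p))"
      using B0 by (intro subset_mean_card_tail fin p x) auto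
    also have "\<dots> \<le> 1 / 2" using bigB by (intro divide_left_mono) auto
    finally have tail: "subset_mean p B' (\<lambda>E. of_bool (real (card E) \<le> (1 - x) * (real (card B') * p))) \<le> 1 / 2" .
    have "1 = subset_mean p B' (\<lambda>E. 1)" by (simp add: subset_mean_const[OF fin(2)])
    also have "\<dots> \<le> subset_mean p B' (\<lambda>E. of_bool (real (card E) \<le> (1 - x) * (real (card B') * p)) + of_bool (z2 \<le> cycle_homs I t E))"
    proof (rule subset_mean_mono)
      fix E assume E: "E \<subseteq> B'"
      show "1 \<le> of_bool (real (card E) \<le> (1 - x) * (real (card B') * p)) + (of_bool (z2 \<le> cycle_homs I t E) :: real)"
      proof (cases "real (card E) \<le> (1 - x) * (real (card B') * p)")
        case False
        have "(1 - x)\<^sup>2 * (n * p) = 2 * ((1 - x) * ((1 - x) * n\<^sup>2 / 2 * p)) / n"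
          using n by (simp add: power2_eq_square)
        also have "\<dots> \<le> 2 * ((1 - x) * (real (card B') * p)) / n"
          using n x p Bn by (intro divide_right_mono mult_left_mono mult_right_mono) auto
        also have "\<dots> \<le> 2 * real (card E) / n" using False n by (intro divide_right_mono) auto
        finally have "((1 - x)\<^sup>2 * (n * p)) ^ (2 * t) \<le> (2 * real (card E) / n) ^ (2 * t)"
          using n p by (intro power_mono) auto
        also have "\<dots> \<le> cycle_homs I t E"
          unfolding n_def using E by (intro cycle_homs_Sidorenko I) (auto simp: B'_def)
        finally show ?thesis using z by (simp add: n_def)
      qed simp
    qed (use p in auto)
    also have "\<dots> \<le> 1 / 2 + subset_mean p B' (\<lambda>E. of_bool (z2 \<le> cycle_homs I t E))"
      using tail by (simp add: subset_mean_add)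
    finally show ?thesis by simp
  qed
  have A0: "0 \<le> subset_mean p A (\<lambda>E. of_bool (z1 \<le> cycle_homs I t E))" using p by (intro subset_mean_nonneg) auto
  have "subset_mean p A (\<lambda>E. of_bool (z1 \<le> cycle_homs I t E)) * (1 / 2) \<le>
    subset_mean p A (\<lambda>E. of_bool (z1 \<le> cycle_homs I t E)) * subset_mean p B' (\<lambda>E. of_bool (z2 \<le> cycle_homs I t E))"
    using half A0 by (intro mult_left_mono)
  also have "\<dots> = subset_mean p (A \<union> B') (\<lambda>E. of_bool (z1 \<le> cycle_homs I t (E \<inter> A)) * of_bool (z2 \<le> cycle_homs I t (E \<inter> B')))"
    by (rule subset_mean_indep[OF fin U(2), symmetric])
  also have "\<dots> \<le> subset_mean p (A \<union> B') (\<lambda>E. of_bool (z1 + z2 \<le> cycle_homs I t E))"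
  proof (rule subset_mean_mono)
    fix E
    show "of_bool (z1 \<le> cycle_homs I t (E \<inter> A)) * of_bool (z2 \<le> cycle_homs I t (E \<inter> B')) \<le> (of_bool (z1 + z2 \<le> cycle_homs I t E) :: real)"
      using cycle_homs_superadd[OF U(2) t, of I E] by (auto simp: of_bool_def)
  qed (use p in auto)
  finally show ?thesis using U(1) by simp
qed

text \<open>All pairs of \<open>K\<close> are demanded. The complete graph on \<open>K\<close> has
  average degree \<open>card K - 1\<close>, the quantity in Sidorenko's inequality.\<close>

lemma clique_probability:
  assumes I: "finite I" and K: "K \<subseteq> I" "K \<noteq> {}" and p: "0 \<le> p" "p \<le> 1"
    and z: "z \<le> (real (card K) - 1) ^ (2 * t)"
  shows "p ^ card (pairs K) \<le> subset_mean p (pairs K) (\<lambda>E. of_bool (z \<le> cycle_homs I t E))"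
proof -
  have fK: "finite K" using K I finite_subset by blast
  have "(real (card K) - 1) ^ (2 * t) \<le> cycle_homs K t (pairs K)"
    using cycle_homs_Sidorenko[OF fK K(2) subset_refl, of t] K fK by (simp add: two_card_pairs)
  also have "\<dots> \<le> cycle_homs I t (pairs K)"
    unfolding cycle_homs_def using I K by (intro mtrace_mpow_subset) (auto simp: nonneg_mx_def adj_mx_bounds)
  finally have h: "z \<le> cycle_homs I t (pairs K)" using z by simp
  have "p ^ card (pairs K) = subset_mean p (pairs K) (\<lambda>E. of_bool (pairs K \<subseteq> E))"
    by (rule subset_mean_superset[symmetric]) (auto simp: finite_pairs fK)
  also have "\<dots> \<le> subset_mean p (pairs K) (\<lambda>E. of_bool (z \<le> cycle_homs I t E))"
    using h p by (intro subset_mean_mono) (auto simp: of_bool_def dest: subset_antisym)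
  finally show ?thesis .
qed

text \<open>The leaves are not prescribed: the sum over all sets of \<open>m\<close> edges at
  \<open>v\<close> yields the binomial coefficient, which makes a star edge cheaper than an edge of
  a clique.\<close>

lemma star_probability:
  assumes I: "finite I" and v: "v \<in> I" and p: "0 \<le> p" "p \<le> 1" and t: "t \<ge> 1"
    and m: "m \<le> card I - 1" and z: "z \<le> 2 * real m ^ t"
  defines "A \<equiv> (\<lambda>w. {v, w}) ` (I - {v})"
  shows "A \<subseteq> pairs I" "card A = card I - 1"
    "real (card I - 1 choose m) * (p ^ m * (1 - p) ^ (card I - 1 - m)) \<le> subset_mean p A (\<lambda>E. of_bool (z \<le> cycle_homs I t E))"
proof -
  show Ap: "A \<subseteq> pairs I" using v by (auto simp: A_def pairs_def card_insert_if)
  have inj: "inj_on (\<lambda>w. {v, w}) (I - {v})" by (auto simp: inj_on_def doubleton_eq_iff)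
  show cA: "card A = card I - 1" unfolding A_def using I v by (simp add: card_image[OF inj])
  have fA: "finite A" using I by (simp add: A_def)
  have h: "z \<le> cycle_homs I t E" if E: "E \<subseteq> A" "card E = m" for E
  proof -
    define L where "L = {w \<in> I - {v}. {v, w} \<in> E}"
    have "E = (\<lambda>w. {v, w}) ` L" using E(1) by (auto simp: A_def L_def)
    moreover have "inj_on (\<lambda>w. {v, w}) L" using inj by (rule inj_on_subset) (auto simp: L_def)
    ultimately have "card L = m" using E(2) by (metis card_image)
    moreover have "2 * real (card L) ^ t \<le> mtrace I (mpow I (adj_mx E) (2 * t))"
      by (rule mtrace_star_ge[OF I adj_mx_bounds _ v _ _ t]) (auto simp: L_def adj_mx_def insert_commute)
    ultimately show ?thesis using z by (simp add: cycle_homs_def)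
  qed
  let ?S = "{E. E \<subseteq> A \<and> card E = m}"
  have "real (card I - 1 choose m) * (p ^ m * (1 - p) ^ (card I - 1 - m)) = (\<Sum>E\<in>?S. p ^ m * (1 - p) ^ (card I - 1 - m))"
    using n_subsets[OF fA, of m] by (simp add: cA)
  also have "\<dots> = (\<Sum>E\<in>?S. p ^ card E * (1 - p) ^ card (A - E) * of_bool (z \<le> cycle_homs I t E))"
  proof (rule sum.cong[OF refl])
    fix E assume E: "E \<in> ?S"
    then have "card (A - E) = card I - 1 - m" using fA finite_subset by (subst card_Diff_subset) (auto simp: cA)
    then show "p ^ m * (1 - p) ^ (card I - 1 - m) = p ^ card E * (1 - p) ^ card (A - E) * of_bool (z \<le> cycle_homs I t E)"
      using E h by simp
  qed
  also have "\<dots> \<le> subset_mean p A (\<lambda>E. of_bool (z \<le> cycle_homs I t E))"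
    unfolding subset_mean_def using fA p by (intro sum_mono2) auto
  finally show "real (card I - 1 choose m) * (p ^ m * (1 - p) ^ (card I - 1 - m)) \<le> subset_mean p A (\<lambda>E. of_bool (z \<le> cycle_homs I t E))" .
qed

text \<open>The seed sum is the mean count with \<open>T\<close> planted.
  \<open>planted_mean_le\<close> and \<open>mtrace_shift_le\<close> bound it in terms of the closed
  walks inside \<open>T\<close>, which must therefore number at least \<delta> d^(2t).
  \<open>extract_core\<close> at the price \<epsilon> d^(2t)/R per edge loses at most \<epsilon>
  d^(2t), and \<open>edge_removal_le\<close> turns that price into the lower bound for degree
  products.\<close>

lemma seed_gives_core:
  fixes I :: "'a set"
  assumes I: "finite I" "I \<noteq> {}" and p: "0 \<le> p" "p \<le> 1" and t: "t \<ge> 2"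
    and d: "d = real (card I) * p" "d \<ge> 1"
    and T: "T \<subseteq> pairs I" "card T \<le> R" and R: "R \<ge> 1"
    and \<rho>: "\<rho> = 2 * real R / d\<^sup>2" "\<rho> \<ge> 1"
    and \<eta>: "\<eta> = \<rho> ^ (t + 1) * d\<^sup>2 / real (card I)" "\<eta> \<le> 1"
    and \<epsilon>: "\<epsilon>3 > 0" "\<epsilon> > 0" and \<delta>: "\<delta> > 0"
    and seed: "(1 + \<epsilon>3) ^ (2 * t) * (\<delta> + 1 + real (2 * t) * (5 ^ (2 * t) * \<eta>)) * d ^ (2 * t) +
      (1 + 1 / \<epsilon>3) ^ (2 * t) * (real ((t + 1) ^ (2 * t + 1)) * (real (card I) * d ^ t)) <
      (\<Sum>\<phi> | \<phi> \<in> {..<2 * t} \<rightarrow>\<^sub>E I \<and> wedges (2 * t) \<phi> \<subseteq> pairs I. p ^ card (wedges (2 * t) \<phi> - T))"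
  shows "\<exists>G\<subseteq>T. G \<in> cores I R (\<epsilon> * d ^ (2 * t) / (2 * real t * (2 * real R) ^ (t - 1))) \<and>
    (\<delta> - \<epsilon>) * d ^ (2 * t) \<le> cycle_homs I t G"
proof -
  define n where "n = real (card I)"
  have n: "n > 0" using I by (simp add: n_def card_gt_0_iff)
  define D where "D = d ^ (2 * t)"
  have D: "D > 0" using d by (simp add: D_def)
  have t1: "t \<ge> 1" "2 * t \<ge> 1" using t by auto
  have \<eta>0: "\<eta> \<ge> 0" using \<rho> by (simp add: \<eta>)
  have fT: "finite T" using T finite_pairs[OF I(1)] finite_subset by blast
  define s where "s = sqrt (2 * real R)"
  have "d \<noteq> 0" using d(2) by auto
  then have s2: "s\<^sup>2 = \<rho> * d\<^sup>2" by (simp add: s_def \<rho>(1))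
  have s2': "s\<^sup>2 = 2 * real R" by (simp add: s_def)
  have s1: "s \<ge> 1" using R by (simp add: s_def)
  have mT: "mtotal I (adj_mx T) \<le> s\<^sup>2" using T by (simp add: mtotal_adj_mx[OF I(1)] s_def)
  define r where "r = s / d"
  have r2: "r\<^sup>2 = \<rho>" using s2 \<open>d \<noteq> 0\<close> by (simp add: r_def power_divide)
  have "r \<ge> 0" using s1 d(2) by (simp add: r_def)
  then have r1: "r \<ge> 1" using r2 \<rho>(2) by (intro power2_le_imp_le[of 1 r]) auto
  have walks: "p * mtotal I (mpow I (adj_mx T) j) \<le> \<eta> * d ^ (j + 1)" if j: "1 \<le> j" "j \<le> 2 * t" for j
  proof -
    have "p * mtotal I (mpow I (adj_mx T) j) \<le> p * s ^ (j + 2)"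
      using p walk_bound[OF I(1) adj_mx_bounds mT s1 j(1)] by (intro mult_left_mono) auto
    \<comment> \<open>Substitute s = r d and p = d/n. The excess of s over d costs powers of \<rho>
      = r^2, and the gain is d^2/n.\<close>
    also have "\<dots> = r ^ (j + 2) * (d\<^sup>2 / n) * d ^ (j + 1)"
    proof -
      have "p = d / n" using d n by (simp add: n_def)
      moreover have "s = r * d" using \<open>d \<noteq> 0\<close> by (simp add: r_def)
      ultimately show ?thesis by (simp add: power_mult_distrib power2_eq_square)
    qed
    also have "\<dots> \<le> r ^ (2 * (t + 1)) * (d\<^sup>2 / n) * d ^ (j + 1)"
      using r1 j n d by (intro mult_right_mono power_increasing) auto
    also have "r ^ (2 * (t + 1)) = \<rho> ^ (t + 1)" by (simp only: power_mult r2)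
    finally show ?thesis by (simp add: \<eta> n_def)
  qed
  have nn: "nonneg_mx (adj_mx T)" by (simp add: nonneg_mx_def adj_mx_bounds)
  have h0: "cycle_homs I t T \<ge> 0" unfolding cycle_homs_def mtrace_def by (intro sum_nonneg mpow_nonneg nn)
  define \<beta> where "\<beta> = cycle_homs I t T + D * (1 + real (2 * t) * (5 ^ (2 * t) * \<eta>))"
  have "mtrace I (mpow I (\<lambda>i j. adj_mx T i j + p) (2 * t)) \<le> \<beta>"
    unfolding \<beta>_def cycle_homs_def D_def
    by (rule mtrace_shift_le[OF I(1) p(1) _ \<eta>0 \<eta>(2)]) (use d walks t adj_mx_bounds in \<open>auto simp: mult.commute\<close>)
  moreover have "\<beta> > 0" unfolding \<beta>_def using h0 D \<eta>0 by (intro add_nonneg_pos mult_pos_pos add_pos_nonneg) auto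
  ultimately have "(\<Sum>\<phi> | \<phi> \<in> {..<2 * t} \<rightarrow>\<^sub>E I \<and> wedges (2 * t) \<phi> \<subseteq> pairs I. p ^ card (wedges (2 * t) \<phi> - T)) \<le>
    (1 + \<epsilon>3) ^ (2 * t) * \<beta> + (1 + 1 / \<epsilon>3) ^ (2 * t) * (real ((t + 1) ^ (2 * t + 1)) * (n * d ^ t))"
    using planted_mean_le[OF I(1) finite_pairs[OF I(1)] T(1) p t1(1) _ \<epsilon>(1), of \<beta>] d
    unfolding planted_mean[OF I(1) finite_pairs[OF I(1)] T(1) t1(2)] by (simp add: n_def)
  then have "(1 + \<epsilon>3) ^ (2 * t) * ((\<delta> + 1 + real (2 * t) * (5 ^ (2 * t) * \<eta>)) * D) < (1 + \<epsilon>3) ^ (2 * t) * \<beta>"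
    using seed by (simp add: n_def D_def mult.assoc)
  then have "(\<delta> + 1 + real (2 * t) * (5 ^ (2 * t) * \<eta>)) * D < \<beta>"
    using \<epsilon> by (simp add: mult_less_cancel_left_pos)
  then have hT: "\<delta> * D \<le> cycle_homs I t T" by (simp add: \<beta>_def algebra_simps)
  define x where "x = \<epsilon> * D / real R"
  have x0: "x \<ge> 0" using \<epsilon> D by (simp add: x_def)
  obtain G where G: "G \<subseteq> T" "cycle_homs I t T - x * real (card T) \<le> cycle_homs I t G"
    "\<And>e. e \<in> G \<Longrightarrow> x \<le> cycle_homs I t G - cycle_homs I t (G - {e})"
    using extract_core[OF fT x0, where I = I and t = t] by blast
  have "x * real (card T) \<le> x * real R" using T x0 by (intro mult_left_mono) auto
  also have "\<dots> = \<epsilon> * D" using R by (simp add: x_def)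
  finally have hG: "(\<delta> - \<epsilon>) * D \<le> cycle_homs I t G" using G(2) hT by (simp add: algebra_simps)
  have Gp: "G \<subseteq> pairs I" using G T by blast
  have cG: "card G \<le> R" using card_mono[OF fT G(1)] T by simp
  have "\<epsilon> * D / (2 * real t * (2 * real R) ^ (t - 1)) \<le> real (deg G u) * real (deg G v)" if e: "{u, v} \<in> G" for u v
  proof -
    have "x \<le> 4 * real t * (real (deg G u) * real (deg G v) * (2 * real (card G)) ^ (t - 2))"
      using G(3)[OF e] edge_removal_le[OF I(1) Gp e t] by simp
    also have "\<dots> \<le> 4 * real t * (real (deg G u) * real (deg G v) * (2 * real R) ^ (t - 2))"
      using cG by (intro mult_left_mono power_mono) auto
    finally have "\<epsilon> * D \<le> 4 * real t * (real (deg G u) * real (deg G v) * (2 * real R) ^ (t - 2)) * real R"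
      using R by (simp add: x_def field_simps)
    also have "\<dots> = real (deg G u) * real (deg G v) * (2 * real t * ((2 * real R) ^ (t - 2) * (2 * real R)))" by simp
    also have "(2 * real R) ^ (t - 2) * (2 * real R) = (2 * real R) ^ (t - 1)"
      using t by (metis Suc_1 Suc_diff_le diff_Suc_Suc diff_zero power_Suc2 Suc_diff_Suc Suc_le_lessD numeral_2_eq_2)
    finally show ?thesis using t R by (simp add: field_simps)
  qed
  then have "G \<in> cores I R (\<epsilon> * D / (2 * real t * (2 * real R) ^ (t - 1)))"
    using Gp cG by (simp add: cores_def)
  then show ?thesis using G(1) hG by (auto simp: D_def)
qed

text \<open>Two losses of \<epsilon> occur. Consecutive thresholds differ by the factor d^\<theta>,
  which makes mixed walks negligible; and some shell between thresholds has at most a fraction 1/N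
  of the edges. The second loss is compared with d^(2t), which is why at most K d^2 edges are
  allowed.\<close>

lemma core_dichotomy:
  fixes I :: "'a set"
  assumes I: "finite I" and t: "t \<ge> 2" and G: "G \<in> cores I R q" and q: "q > 0"
    and d: "d \<ge> 1" and N: "N \<ge> 1" and \<theta>: "\<theta> > 0" and thr: "(d powr (real N * \<theta>))\<^sup>2 \<le> q"
    and mix: "2 ^ (2 * t) * ((2 * real R) ^ (t + 1) / q * d powr (- \<theta>)) \<le> \<epsilon> * d ^ (2 * t)"
    and K: "K \<ge> 0" "4 * real t * (2 * K) ^ t \<le> \<epsilon> * real N" and small: "real (card G) \<le> K * d\<^sup>2"
    and h: "\<delta> * d ^ (2 * t) \<le> cycle_homs I t G"
  shows "\<exists>j<N. (\<delta> - 2 * \<epsilon>) * d ^ (2 * t) \<le>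
    2 * real (card (low_edges G (d powr (real (Suc j) * \<theta>)))) ^ t + (2 * real (card (G - low_edges G (d powr (real (Suc j) * \<theta>))))) ^ t"
proof -
  define \<tau> where "\<tau> j = d powr (real j * \<theta>)" for j
  have Gp: "G \<subseteq> pairs I" and cG: "card G \<le> R" and Gq: "\<And>u v. {u, v} \<in> G \<Longrightarrow> q \<le> real (deg G u) * real (deg G v)"
    using G by (auto simp: cores_def)
  have fG: "finite G" using Gp finite_pairs[OF I] finite_subset by blast
  have \<tau>mono: "\<tau> i \<le> \<tau> j" if "i \<le> j" for i j
    unfolding \<tau>_def using that d \<theta> by (intro powr_mono mult_right_mono) auto
  obtain j where j: "j < N" "real N * real (card (low_edges G (\<tau> (Suc j)) - low_edges G (\<tau> j))) \<le> real (card G)"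
    by (rule low_edges_pigeonhole[OF fG _ N, of \<tau>]) (rule \<tau>mono)
  have \<tau>0: "\<tau> i > 0" for i using d by (simp add: \<tau>_def)
  have \<tau>q: "(\<tau> j)\<^sup>2 \<le> q"
  proof -
    have "(\<tau> j)\<^sup>2 \<le> (\<tau> N)\<^sup>2" using \<tau>0[of j] \<tau>mono[of j N] j by (intro power_mono) auto
    also have "\<dots> \<le> q" using thr by (simp only: \<tau>_def)
    finally show ?thesis .
  qed
  define g where "g = 2 * real (card G)"
  have g: "0 \<le> g" "g \<le> 2 * real R" using cG by (auto simp: g_def)
  define M where "M = real (card (low_edges G (\<tau> (Suc j)) - low_edges G (\<tau> j)))"
  have main: "cycle_homs I t G \<le> 2 * real (card (low_edges G (\<tau> j))) ^ t + (2 * real (card (G - low_edges G (\<tau> (Suc j))))) ^ t +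
    2 ^ (2 * t) * ((g * \<tau> j / q) * (g / \<tau> (Suc j)) * g ^ (t - 1)) + 4 * real t * M * g ^ (t - 1)"
    unfolding g_def M_def
    using cycle_homs_low_high[OF I Gp t Gq \<tau>0[of j] \<tau>mono[of j "Suc j"] \<tau>q] by simp
  have ratio: "\<tau> j / \<tau> (Suc j) = d powr (- \<theta>)"
  proof -
    have "real j * \<theta> - real (Suc j) * \<theta> = - \<theta>" by (simp add: algebra_simps)
    then show ?thesis unfolding \<tau>_def powr_diff[symmetric] by (simp only:)
  qed
  have "(g * \<tau> j / q) * (g / \<tau> (Suc j)) * g ^ (t - 1) = g ^ (t + 1) / q * (\<tau> j / \<tau> (Suc j))"
    using t by (cases t) auto
  also have "\<dots> \<le> (2 * real R) ^ (t + 1) / q * d powr (- \<theta>)"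
    unfolding ratio using g q by (intro mult_right_mono divide_right_mono power_mono) auto
  finally have e1: "2 ^ (2 * t) * ((g * \<tau> j / q) * (g / \<tau> (Suc j)) * g ^ (t - 1)) \<le> \<epsilon> * d ^ (2 * t)"
    by (intro order_trans[OF mult_left_mono mix]) auto
  have e2: "4 * real t * M * g ^ (t - 1) \<le> \<epsilon> * d ^ (2 * t)"
  proof -
    have gK: "g \<le> 2 * K * d\<^sup>2" using small by (simp add: g_def)
    have "real N * (4 * real t * M * g ^ (t - 1)) = 4 * real t * ((real N * M) * g ^ (t - 1))" by simp
    also have "\<dots> \<le> 4 * real t * ((2 * K * d\<^sup>2) * (2 * K * d\<^sup>2) ^ (t - 1))"
    proof -
      have "real N * M \<le> K * d\<^sup>2" using j(2) small by (simp add: M_def)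
      also have "\<dots> \<le> 2 * K * d\<^sup>2" using K by simp
      finally have NM: "real N * M \<le> 2 * K * d\<^sup>2" .
      show ?thesis
        by (rule mult_left_mono[OF mult_mono[OF NM power_mono[OF gK]]]) (use g K in auto)
    qed
    also have "(2 * K * d\<^sup>2) * (2 * K * d\<^sup>2) ^ (t - 1) = (2 * K * d\<^sup>2) ^ t"
      using t by (cases t) auto
    also have "4 * real t * (2 * K * d\<^sup>2) ^ t = (4 * real t * (2 * K) ^ t) * d ^ (2 * t)"
      by (simp add: power_mult_distrib power_mult)
    also have "\<dots> \<le> (\<epsilon> * real N) * d ^ (2 * t)" using K d by (intro mult_right_mono) auto
    finally have "real N * (4 * real t * M * g ^ (t - 1)) \<le> real N * (\<epsilon> * d ^ (2 * t))" by (simp add: mult_ac)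
    then show ?thesis using N by simp
  qed
  \<comment> \<open>Pass from the lower to the upper threshold, so that the two classes being
    counted partition \<open>G\<close>.\<close>
  have le: "real (card (low_edges G (\<tau> j))) ^ t \<le> real (card (low_edges G (\<tau> (Suc j)))) ^ t"
  proof (intro power_mono of_nat_mono card_mono)
    show "finite (low_edges G (\<tau> (Suc j)))" by (rule finite_subset[OF low_edges_subset fG])
    show "low_edges G (\<tau> j) \<subseteq> low_edges G (\<tau> (Suc j))" by (intro low_edges_mono \<tau>mono) simp
  qed simp
  have "(\<delta> - 2 * \<epsilon>) * d ^ (2 * t) \<le> 2 * real (card (low_edges G (\<tau> (Suc j)))) ^ t + (2 * real (card (G - low_edges G (\<tau> (Suc j))))) ^ t"
  proof -
    have "(\<delta> - 2 * \<epsilon>) * d ^ (2 * t) = \<delta> * d ^ (2 * t) - 2 * (\<epsilon> * d ^ (2 * t))" by (simp add: algebra_simps)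
    then show ?thesis using main e1 e2 h le by linarith
  qed
  then show ?thesis using j(1) unfolding \<tau>_def by blast
qed

text \<open>The cost is linear in the two edge counts while the gain is convex, so the optimum is
  attained by a pure clique or a pure star.\<close>

lemma cost_lower_bound:
  fixes a b :: real
  assumes t: "t \<ge> 1" and a: "a \<ge> 0" and b: "b \<ge> 0" and \<delta>: "\<delta> > 0" and d: "d > 0" and \<alpha>: "0 \<le> \<alpha>" "\<alpha> \<le> 1"
    and h: "\<delta> * d ^ (2 * t) \<le> 2 * b ^ t + (2 * a) ^ t"
  shows "min ((\<delta> / 2) powr (1 / real t) * \<alpha>) (1 / 2 * \<delta> powr (1 / real t) * (1 - \<alpha>)) * d\<^sup>2 \<le> (1 - \<alpha>) * a + \<alpha> * b"
proof -
  define c where "c = \<delta> powr (1 / real t)"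
  define c' where "c' = (\<delta> / 2) powr (1 / real t)"
  have ct: "c ^ t = \<delta>" "c' ^ t = \<delta> / 2"
  proof -
    have "(x powr (1 / real t)) ^ t = x" if "x > 0" for x :: real
      using that t powr_realpow[of "x powr (1 / real t)" t] by (simp add: powr_powr)
    then show "c ^ t = \<delta>" "c' ^ t = \<delta> / 2" using \<delta> by (auto simp: c_def c'_def)
  qed
  have c0: "c > 0" "c' > 0" using \<delta> by (auto simp: c_def c'_def)
  \<comment> \<open>Edge counts in units of the pure optima: a clique alone needs c d^2 / 2 edges, a
    star alone c' d^2.\<close>
  define u where "u = 2 * a / (c * d\<^sup>2)"
  define v where "v = b / (c' * d\<^sup>2)"
  have uv0: "u \<ge> 0" "v \<ge> 0" using a b c0 by (auto simp: u_def v_def)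
  have ua: "2 * a = u * c * d\<^sup>2" and vb: "b = v * c' * d\<^sup>2" using c0 d by (auto simp: u_def v_def)
  have "\<delta> * d ^ (2 * t) \<le> \<delta> * d ^ (2 * t) * (u ^ t + v ^ t)"
    using h unfolding ua vb by (simp add: power_mult_distrib ct algebra_simps flip: power_mult)
  then have uv: "1 \<le> u ^ t + v ^ t" using \<delta> d by simp
  have "1 \<le> u + v"
  proof (rule ccontr)
    assume "\<not> 1 \<le> u + v"
    then have lt: "u + v < 1" by simp
    have "u ^ t \<le> u" "v ^ t \<le> v" using uv0 lt t power_decreasing[of 1 t u] power_decreasing[of 1 t v] by auto
    then show False using uv lt by simp
  qed
  define \<kappa> where "\<kappa> = min (c' * \<alpha>) (1 / 2 * c * (1 - \<alpha>))"
  have \<kappa>0: "\<kappa> \<ge> 0" using c0 \<alpha> by (simp add: \<kappa>_def)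
  have "\<kappa> * d\<^sup>2 \<le> \<kappa> * d\<^sup>2 * (u + v)" using mult_left_mono[OF \<open>1 \<le> u + v\<close>, of "\<kappa> * d\<^sup>2"] \<kappa>0 by simp
  also have "\<dots> = (u * \<kappa> + v * \<kappa>) * d\<^sup>2" by (simp add: algebra_simps)
  also have "\<dots> \<le> (u * (1 / 2 * c * (1 - \<alpha>)) + v * (c' * \<alpha>)) * d\<^sup>2"
    using uv0 by (intro mult_right_mono add_mono mult_left_mono) (auto simp: \<kappa>_def)
  also have "\<dots> = (1 - \<alpha>) * (u * c * d\<^sup>2) / 2 + \<alpha> * (v * c' * d\<^sup>2)" by (simp add: algebra_simps)
  also have "\<dots> = (1 - \<alpha>) * a + \<alpha> * b" unfolding ua[symmetric] vb[symmetric] by simp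
  finally show ?thesis by (simp add: \<kappa>_def c_def c'_def)
qed


text \<open>The costs of a star with \<open>(\<delta> / 2) powr (1 / t) * d\<^sup>2\<close> leaves and of a clique on
  \<open>\<delta> powr (1 / (2 * t)) * d\<close> vertices, in units of \<open>d\<^sup>2 * ln n\<close>.\<close>

definition cost_rate :: "nat \<Rightarrow> real \<Rightarrow> real \<Rightarrow> real" where
  "cost_rate t \<alpha> \<delta> = min ((\<delta> / 2) powr (1 / real t) * \<alpha>) (1 / 2 * \<delta> powr (1 / real t) * (1 - \<alpha>))"

text \<open>The five \<epsilon>: two are reserved in the seed condition, one is lost in extracting
  the core, and two in \<open>core_dichotomy\<close>. The number \<open>u\<close> is the price of
  one unit of cost, so every relevant core has price at least u \<kappa> d^2.\<close>

lemma upper_tail_finite: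
  fixes n t l R N m :: nat and p d \<alpha> \<delta> \<epsilon> \<epsilon>3 \<rho> \<eta> q \<theta> K x y u :: real
  assumes n: "n \<ge> 1" and p: "0 < p" "p < 1" and t: "t \<ge> 2" and d: "d = real n * p" "d \<ge> 1"
    and \<alpha>: "0 < \<alpha>" "\<alpha> < 1" and \<epsilon>: "0 < \<epsilon>" "5 * \<epsilon> < \<delta>" "0 < \<epsilon>3"
    and R: "R = 2 * t * l" "l \<ge> 1" and \<rho>: "\<rho> = 2 * real R / d\<^sup>2" "\<rho> \<ge> 1"
    and \<eta>: "\<eta> = \<rho> ^ (t + 1) * d\<^sup>2 / real n" "\<eta> \<le> 1"
    and seed: "(1 + \<epsilon>3) ^ (2 * t) * (\<delta> - 2 * \<epsilon> + 1 + real (2 * t) * (5 ^ (2 * t) * \<eta>)) * d ^ (2 * t) +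
      (1 + 1 / \<epsilon>3) ^ (2 * t) * (real ((t + 1) ^ (2 * t + 1)) * (real n * d ^ t)) \<le> (1 + \<delta> - \<epsilon>) * d ^ (2 * t)"
    and q: "q = \<epsilon> * d ^ (2 * t) / (2 * real t * (2 * real R) ^ (t - 1))"
    and N: "N \<ge> 1" and \<theta>: "\<theta> > 0" and thr: "(d powr (real N * \<theta>))\<^sup>2 \<le> q"
    and mix: "2 ^ (2 * t) * ((2 * real R) ^ (t + 1) / q * d powr (- \<theta>)) \<le> \<epsilon> * d ^ (2 * t)"
    and K: "K \<ge> 0" "4 * real t * (2 * K) ^ t \<le> \<epsilon> * real N"
      "cost_rate t \<alpha> (\<delta> - 5 * \<epsilon>) \<le> min \<alpha> (1 - \<alpha>) * K"
    and m: "2 * real R / d powr \<theta> \<le> real m" and xy: "x > 0" "y > 0" and u: "u \<ge> 0"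
    and px: "p / x \<le> exp (- (u * (1 - \<alpha>)))" and py: "p * d powr (real N * \<theta>) / y \<le> exp (- (u * \<alpha>))"
  shows "subset_mean p (pairs {1..n}) (\<lambda>E. of_bool ((1 + \<delta>) * d ^ (2 * t) \<le> cycle_homs {1..n} t E)) \<le>
    real N * (exp (- (u * (cost_rate t \<alpha> (\<delta> - 5 * \<epsilon>) * d\<^sup>2))) * (exp 1 * (real n * real (2 * R)) ^ m *
      exp (x * ((2 * real R)\<^sup>2 / q) + y * (real n * (2 * real R) / q)))) + ((1 + \<delta> - \<epsilon>) / (1 + \<delta>)) ^ l"
proof -
  let ?I = "{1..n}"
  define D where "D = d ^ (2 * t)"
  have D: "D > 0" using d by (simp add: D_def)
  have I: "finite ?I" "?I \<noteq> {}" "card ?I = n" using n by auto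
  have R1: "R \<ge> 1" using R t by simp
  have q0: "q > 0" unfolding q using \<epsilon> d(2) R1 t by (intro divide_pos_pos mult_pos_pos) auto
  have p01: "0 \<le> p" "p \<le> 1" using p by auto
  let ?J = "{\<phi> \<in> {..<2 * t} \<rightarrow>\<^sub>E ?I. wedges (2 * t) \<phi> \<subseteq> pairs ?I}"
  define \<kappa> where "\<kappa> = cost_rate t \<alpha> (\<delta> - 5 * \<epsilon>)"
  define \<tau> where "\<tau> j = d powr (real (Suc j) * \<theta>)" for j
  define Q where "Q j G \<longleftrightarrow> \<kappa> * d\<^sup>2 \<le> (1 - \<alpha>) * real (card (G - low_edges G (\<tau> j))) + \<alpha> * real (card (low_edges G (\<tau> j)))" for j and G :: "nat set set"
  let ?C = "\<lambda>j E. \<exists>G\<subseteq>E. G \<in> cores ?I R q \<and> Q j G"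
  define W where "W = exp (- (u * (\<kappa> * d\<^sup>2))) * (exp 1 * (real n * real (2 * R)) ^ m *
      exp (x * ((2 * real R)\<^sup>2 / q) + y * (real n * (2 * real R) / q)))"
  have finJ: "finite ?J" by (intro finite_subset[OF _ finite_PiE[of "{..<2 * t}" "\<lambda>_. ?I"]]) auto
  have "subset_mean p (pairs ?I) (\<lambda>E. of_bool ((1 + \<delta>) * D \<le> cycle_homs ?I t E)) =
     subset_mean p (pairs ?I) (\<lambda>E. of_bool ((1 + \<delta>) * D \<le> (\<Sum>\<phi>\<in>?J. of_bool (wedges (2 * t) \<phi> \<subseteq> E))))"
  proof (rule subset_mean_cong)
    fix E assume E: "E \<subseteq> pairs ?I"
    have "cycle_homs ?I t E = (\<Sum>\<phi>\<in>?J. of_bool (wedges (2 * t) \<phi> \<subseteq> E))"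
      by (rule cycle_homs_walks[OF I(1) _ E]) (use t in simp)
    then show "of_bool ((1 + \<delta>) * D \<le> cycle_homs ?I t E) =
        (of_bool ((1 + \<delta>) * D \<le> (\<Sum>\<phi>\<in>?J. of_bool (wedges (2 * t) \<phi> \<subseteq> E))) :: real)"
      by (simp only:)
  qed
  also have "\<dots> \<le> subset_mean p (pairs ?I) (\<lambda>E. of_bool (\<exists>T\<subseteq>E. card T \<le> 2 * t * l \<and>
      (1 + \<delta> - \<epsilon>) * D < (\<Sum>\<phi>\<in>?J. p ^ card (wedges (2 * t) \<phi> - T)))) + ((1 + \<delta> - \<epsilon>) * D / ((1 + \<delta>) * D)) ^ l"
    using \<epsilon> D by (intro subset_mean_seed_tail finite_pairs I finJ p01 card_wedges_le) auto
  also have "(1 + \<delta> - \<epsilon>) * D / ((1 + \<delta>) * D) = (1 + \<delta> - \<epsilon>) / (1 + \<delta>)" using D by simp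
  also have "subset_mean p (pairs ?I) (\<lambda>E. of_bool (\<exists>T\<subseteq>E. card T \<le> 2 * t * l \<and>
      (1 + \<delta> - \<epsilon>) * D < (\<Sum>\<phi>\<in>?J. p ^ card (wedges (2 * t) \<phi> - T)))) \<le> subset_mean p (pairs ?I) (\<lambda>E. \<Sum>j<N. of_bool (?C j E))"
  proof (rule subset_mean_mono[OF p01])
    fix E assume E: "E \<subseteq> pairs ?I"
    show "of_bool (\<exists>T\<subseteq>E. card T \<le> 2 * t * l \<and>
      (1 + \<delta> - \<epsilon>) * D < (\<Sum>\<phi>\<in>?J. p ^ card (wedges (2 * t) \<phi> - T))) \<le> (\<Sum>j<N. of_bool (?C j E) :: real)"
    proof (cases "\<exists>T\<subseteq>E. card T \<le> 2 * t * l \<and> (1 + \<delta> - \<epsilon>) * D < (\<Sum>\<phi>\<in>?J. p ^ card (wedges (2 * t) \<phi> - T))")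
      case True
      then obtain T where T: "T \<subseteq> E" "card T \<le> R" "(1 + \<delta> - \<epsilon>) * D < (\<Sum>\<phi>\<in>?J. p ^ card (wedges (2 * t) \<phi> - T))"
        using R by auto
      have "\<exists>G\<subseteq>T. G \<in> cores ?I R (\<epsilon> * d ^ (2 * t) / (2 * real t * (2 * real R) ^ (t - 1))) \<and>
        (\<delta> - 2 * \<epsilon> - \<epsilon>) * d ^ (2 * t) \<le> cycle_homs ?I t G"
      proof (rule seed_gives_core[OF I(1,2) p01 t _ d(2) _ T(2) R1 \<rho> _ \<eta>(2) \<epsilon>(3,1)])
        show "(1 + \<epsilon>3) ^ (2 * t) * (\<delta> - 2 * \<epsilon> + 1 + real (2 * t) * (5 ^ (2 * t) * \<eta>)) * d ^ (2 * t) +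
          (1 + 1 / \<epsilon>3) ^ (2 * t) * (real ((t + 1) ^ (2 * t + 1)) * (real (card ?I) * d ^ t)) < (\<Sum>\<phi>\<in>?J. p ^ card (wedges (2 * t) \<phi> - T))"
          using seed T(3) unfolding I(3) D_def by linarith
      qed (use d \<eta> \<epsilon> T E in auto)
      then obtain G where G: "G \<subseteq> T" "G \<in> cores ?I R q" "(\<delta> - 3 * \<epsilon>) * d ^ (2 * t) \<le> cycle_homs ?I t G"
        by (auto simp: q algebra_simps)
      have "\<exists>j<N. Q j G"
      proof (cases "real (card G) \<le> K * d\<^sup>2")
        case True
        obtain j where j: "j < N" "(\<delta> - 3 * \<epsilon> - 2 * \<epsilon>) * d ^ (2 * t) \<le>
          2 * real (card (low_edges G (\<tau> j))) ^ t + (2 * real (card (G - low_edges G (\<tau> j)))) ^ t"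
          using core_dichotomy[OF I(1) t G(2) q0 d(2) N \<theta> thr mix K(1,2) True G(3)] unfolding \<tau>_def by blast
        have "\<delta> - 3 * \<epsilon> - 2 * \<epsilon> = \<delta> - 5 * \<epsilon>" by simp
        then have "(\<delta> - 5 * \<epsilon>) * d ^ (2 * t) \<le> 2 * real (card (low_edges G (\<tau> j))) ^ t + (2 * real (card (G - low_edges G (\<tau> j)))) ^ t"
          using j(2) by (simp only:)
        then have "Q j G" unfolding Q_def \<kappa>_def cost_rate_def
          using \<epsilon> d(2) \<alpha> t by (intro cost_lower_bound) auto
        then show ?thesis using j(1) by blast
      next
        \<comment> \<open>With more than K d^2 edges the required cost is exceeded however the edges
          are classified, so index 0 serves.\<close>
        case False
        have fG: "finite G" using G(2) finite_pairs[OF I(1)] finite_subset by (auto simp: cores_def)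
        have cG: "real (card G) = real (card (G - low_edges G (\<tau> 0))) + real (card (low_edges G (\<tau> 0)))"
        proof -
          have "card (G - low_edges G (\<tau> 0)) = card G - card (low_edges G (\<tau> 0))"
            using finite_subset[OF low_edges_subset fG] low_edges_subset by (rule card_Diff_subset)
          moreover have "card (low_edges G (\<tau> 0)) \<le> card G" by (rule card_mono[OF fG low_edges_subset])
          ultimately show ?thesis by simp
        qed
        have "\<kappa> * d\<^sup>2 \<le> min \<alpha> (1 - \<alpha>) * K * d\<^sup>2" using K(3) by (intro mult_right_mono) (auto simp: \<kappa>_def)
        also have "\<dots> \<le> min \<alpha> (1 - \<alpha>) * real (card G)"
          using False \<alpha> by (simp only: mult.assoc) (intro mult_left_mono, auto)
        also have "\<dots> \<le> (1 - \<alpha>) * real (card (G - low_edges G (\<tau> 0))) + \<alpha> * real (card (low_edges G (\<tau> 0)))"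
          unfolding cG distrib_left by (intro add_mono mult_right_mono) auto
        finally have "Q 0 G" by (simp add: Q_def)
        then show ?thesis using N by (intro exI[of _ 0]) auto
      qed
      then obtain j where "j < N" "?C j E" using G T(1) by blast
      then have "(1::real) \<le> (\<Sum>j<N. of_bool (?C j E))"
        using member_le_sum[of j "{..<N}" "\<lambda>j. of_bool (?C j E) :: real"] by simp
      then show ?thesis using True by simp
    qed (auto intro!: sum_nonneg)
  qed
  also have "subset_mean p (pairs ?I) (\<lambda>E. \<Sum>j<N. of_bool (?C j E)) \<le> (\<Sum>j<N. W)"
    unfolding subset_mean_sum
  proof (rule sum_mono)
    fix j assume j: "j \<in> {..<N}"
    have \<tau>0: "\<tau> j > 0" using d(2) by (simp add: \<tau>_def)
    have \<tau>N: "\<tau> j \<le> d powr (real N * \<theta>)"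
      unfolding \<tau>_def using j d \<theta> by (intro powr_mono mult_right_mono) auto
    have \<tau>q: "(\<tau> j)\<^sup>2 \<le> q" by (rule order_trans[OF power_mono[OF \<tau>N] thr]) (use \<tau>0 in simp)
    have \<tau>m: "2 * real R / \<tau> j \<le> real m"
    proof -
      have "d powr \<theta> \<le> \<tau> j"
        unfolding \<tau>_def using d \<theta> by (intro powr_mono) (auto simp: algebra_simps)
      then have "2 * real R / \<tau> j \<le> 2 * real R / d powr \<theta>" using \<tau>0 d(2) by (intro divide_left_mono mult_pos_pos) auto
      then show ?thesis using m by simp
    qed
    \<comment> \<open>The weight y / \<tau> j cancels the factor \<tau> j in the number of hub
      edges, so the bound does not depend on \<open>j\<close>. In exchange a hub edge loses up to
      d^(N \<theta>) of its price.\<close>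
    have "subset_mean p (pairs ?I) (\<lambda>E. of_bool (?C j E)) \<le> exp (- (u * (\<kappa> * d\<^sup>2))) * (exp 1 * (real (card ?I) * real (2 * R)) ^ m *
      exp (x * ((2 * real R)\<^sup>2 / q) + (y / \<tau> j) * (real (card ?I) * (2 * real R * \<tau> j / q))))"
    proof (rule core_union_bound[OF I(1,2) R1 \<tau>0 \<tau>q xy(1) _ \<tau>m p01])
      fix G assume G: "G \<in> cores ?I R q" "Q j G"
      define a where "a = card (G - low_edges G (\<tau> j))"
      define b where "b = card (low_edges G (\<tau> j))"
      have "p / (y / \<tau> j) \<le> p * d powr (real N * \<theta>) / y"
        using \<tau>N p xy by (simp add: divide_right_mono mult_left_mono)
      then have "p / (y / \<tau> j) \<le> exp (- (u * \<alpha>))" using py by simp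
      then have "(p / x) ^ a * (p / (y / \<tau> j)) ^ b \<le> exp (- (u * (1 - \<alpha>))) ^ a * exp (- (u * \<alpha>)) ^ b"
        using px p xy \<tau>0 by (intro mult_mono power_mono) auto
      also have "\<dots> = exp (- (u * ((1 - \<alpha>) * real a + \<alpha> * real b)))"
        by (simp add: exp_of_nat_mult[symmetric] exp_add[symmetric] algebra_simps)
      also have "\<dots> \<le> exp (- (u * (\<kappa> * d\<^sup>2)))"
        using G(2) u by (simp add: Q_def a_def b_def mult_left_mono)
      finally show "(p / x) ^ card (G - low_edges G (\<tau> j)) * (p / (y / \<tau> j)) ^ card (low_edges G (\<tau> j)) \<le> exp (- (u * (\<kappa> * d\<^sup>2)))"
        by (simp add: a_def b_def)
    qed (use xy \<tau>0 in auto)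
    also have "(y / \<tau> j) * (real (card ?I) * (2 * real R * \<tau> j / q)) = y * (real n * (2 * real R) / q)"
      using \<tau>0 by simp
    finally show "subset_mean p (pairs ?I) (\<lambda>E. of_bool (?C j E)) \<le> W" by (simp add: W_def)
  qed
  finally show ?thesis by (simp add: D_def W_def \<kappa>_def)
qed

subsection \<open>Asymptotics\<close>

lemma eventually_le_of_tendsto:
  "(f \<longlongrightarrow> (0::real)) F \<Longrightarrow> c > 0 \<Longrightarrow> \<forall>\<^sub>F n in F. f n \<le> c"
  by (drule order_tendstoD(2)[of f 0 F c]) (auto elim: eventually_mono)

section \<open>Consequences of the density hypothesis\<close>

locale sparse_graphs =
  fixes t :: nat and p d :: "nat \<Rightarrow> real"
  assumes t3: "t \<ge> 3"
    and p01: "\<And>n. n \<ge> 1 \<Longrightarrow> 0 < p n \<and> p n < 1"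
    and p_tendsto: "p \<longlonglongrightarrow> 0"
    and d_eq: "\<And>n. d n = real n * p n"
    and sparse: "(\<lambda>n. real n * d n ^ t / d n ^ (2 * t)) \<longlonglongrightarrow> 0"
begin

lemma d_pos: "n \<ge> 1 \<Longrightarrow> d n > 0"
  using p01[of n] by (simp add: d_eq)

text \<open>Cancelling d^t, the hypothesis says that n/d^t tends to 0. So d is at least n^(1/t)
  eventually, which lets negative powers of d beat logarithms.\<close>

lemma ev_pow_ge: "\<forall>\<^sub>F n in sequentially. real n \<le> d n ^ t"
  using eventually_le_of_tendsto[OF sparse zero_less_one] eventually_ge_at_top[of 1]
proof eventually_elim
  case (elim n)
  then show ?case using d_pos[of n] by (simp add: divide_simps mult_2 power_add)
qed

lemma ev_powr_le: "\<forall>\<^sub>F n in sequentially. real n powr (1 / real t) \<le> d n"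
  using ev_pow_ge eventually_ge_at_top[of 1]
proof eventually_elim
  case (elim n)
  have "real n powr (1 / real t) \<le> (d n ^ t) powr (1 / real t)"
    using elim by (intro powr_mono2) auto
  also have "d n ^ t = d n powr real t"
    using powr_realpow[of "d n" t] d_pos[of n] elim by simp
  also have "(d n powr real t) powr (1 / real t) = d n"
    using d_pos[of n] elim t3 by (simp add: powr_powr)
  finally show ?case .
qed

lemma d_at_top: "filterlim d at_top sequentially"
proof (rule filterlim_at_top_mono[OF _ ev_powr_le])
  show "filterlim (\<lambda>n. real n powr (1 / real t)) at_top sequentially"
    using t3 by real_asymp
qed

lemma ev_d_ge: "\<forall>\<^sub>F n in sequentially. c \<le> d n"
  using d_at_top by (simp add: filterlim_at_top)

lemma mean_tendsto: "(\<lambda>n. subset_mean (p n) (pairs {1..n}) (cycle_homs {1..n} t) / d n ^ (2 * t)) \<longlonglongrightarrow> 1"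
proof (rule order_tendstoI)
  fix a :: real assume a: "a < 1"
  have "(\<lambda>n. ((real n - 1) / real n) ^ (2 * t)) \<longlonglongrightarrow> 1" by real_asymp
  then have "\<forall>\<^sub>F n in sequentially. a < ((real n - 1) / real n) ^ (2 * t)"
    using a by (rule order_tendstoD)
  with eventually_ge_at_top[of 1]
  show "\<forall>\<^sub>F n in sequentially. a < subset_mean (p n) (pairs {1..n}) (cycle_homs {1..n} t) / d n ^ (2 * t)"
  proof eventually_elim
    case (elim n)
    have "((real n - 1) / real n) ^ (2 * t) = ((real n - 1) * p n) ^ (2 * t) / d n ^ (2 * t)"
      using p01[of n] elim by (simp add: d_eq power_mult_distrib power_divide)
    also have "\<dots> \<le> subset_mean (p n) (pairs {1..n}) (cycle_homs {1..n} t) / d n ^ (2 * t)"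
      using subset_mean_cycle_homs_ge[of "{1..n}" "p n" t] p01[of n] elim t3 d_pos[of n]
      by (intro divide_right_mono) auto
    finally show ?case using elim by simp
  qed
next
  fix a :: real assume a: "1 < a"
  have "((\<lambda>x::real. (1 + x) ^ (2 * t)) \<longlongrightarrow> (1 + 0) ^ (2 * t)) (at_right 0)"
    by (intro tendsto_intros)
  then have "\<forall>\<^sub>F x::real in at_right 0. (1 + x) ^ (2 * t) < (1 + a) / 2"
    by (rule order_tendstoD) (use a in auto)
  with eventually_at_right_less[of 0] have "\<forall>\<^sub>F x::real in at_right 0. 0 < x \<and> (1 + x) ^ (2 * t) < (1 + a) / 2"
    by eventually_elim auto
  then obtain \<epsilon> :: real where \<epsilon>: "0 < \<epsilon>" "(1 + \<epsilon>) ^ (2 * t) < (1 + a) / 2"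
    using eventually_happens'[OF trivial_limit_at_right_real] by blast
  define C where "C = (1 + 1 / \<epsilon>) ^ (2 * t) * real ((t + 1) ^ (2 * t + 1))"
  have "(\<lambda>n. C * (real n * d n ^ t / d n ^ (2 * t))) \<longlonglongrightarrow> C * 0"
    by (intro tendsto_intros sparse)
  then have "\<forall>\<^sub>F n in sequentially. C * (real n * d n ^ t / d n ^ (2 * t)) \<le> (a - 1) / 2"
    using a by (intro eventually_le_of_tendsto) auto
  with eventually_ge_at_top[of 1] ev_d_ge[of 1]
  show "\<forall>\<^sub>F n in sequentially. subset_mean (p n) (pairs {1..n}) (cycle_homs {1..n} t) / d n ^ (2 * t) < a"
  proof eventually_elim
    case (elim n)
    have D: "d n ^ (2 * t) > 0" using elim by simp
    have "subset_mean (p n) (pairs {1..n}) (cycle_homs {1..n} t) \<le> (1 + \<epsilon>) ^ (2 * t) * d n ^ (2 * t) + (1 + 1 / \<epsilon>) ^ (2 * t) *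
      (real ((t + 1) ^ (2 * t + 1)) * (real n * d n ^ t))"
      using subset_mean_cycle_homs_le[of "{1..n}" "p n" t \<epsilon>] p01[of n] elim t3 \<epsilon> by (simp add: d_eq)
    also have "\<dots> = ((1 + \<epsilon>) ^ (2 * t) + C * (real n * d n ^ t / d n ^ (2 * t))) * d n ^ (2 * t)"
    proof -
      have "C * (real n * d n ^ t / d n ^ (2 * t)) * d n ^ (2 * t) = C * (real n * d n ^ t)" using D by simp
      then show ?thesis by (simp only: distrib_right C_def mult.assoc)
    qed
    also have "\<dots> < a * d n ^ (2 * t)"
    proof (rule mult_strict_right_mono[OF _ D])
      show "(1 + \<epsilon>) ^ (2 * t) + C * (real n * d n ^ t / d n ^ (2 * t)) < a"
        using \<epsilon>(2) elim(3) by argo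
    qed
    finally show ?case using D by (simp add: pos_divide_less_eq)
  qed
qed

end

lemma cost_rate_pos: "0 < \<alpha> \<Longrightarrow> \<alpha> < 1 \<Longrightarrow> 0 < \<delta> \<Longrightarrow> 0 < cost_rate t \<alpha> \<delta>"
  by (simp add: cost_rate_def)

text \<open>For 0 < r <= 1 one has r <= r^(1/t). This replaces continuity of the rate in \<delta> by
  an explicit multiplicative loss.\<close>

lemma cost_rate_scale:
  assumes r: "0 < r" "r \<le> 1" and t: "t \<ge> 1" and \<delta>: "\<delta> > 0" and \<alpha>: "0 < \<alpha>" "\<alpha> < 1"
  shows "r * cost_rate t \<alpha> \<delta> \<le> cost_rate t \<alpha> (r * \<delta>)"
proof -
  have "r powr 1 \<le> r powr (1 / real t)" using r t by (intro powr_mono') auto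
  then have *: "r * y powr (1 / real t) \<le> (r * y) powr (1 / real t)" if "y > 0" for y
    using r that by (simp add: powr_mult mult_right_mono)
  have "r * ((\<delta> / 2) powr (1 / real t) * \<alpha>) \<le> (r * \<delta> / 2) powr (1 / real t) * \<alpha>"
    using *[of "\<delta> / 2"] \<delta> \<alpha> by (simp add: mult_right_mono mult.assoc[symmetric])
  moreover have "r * (1 / 2 * \<delta> powr (1 / real t) * (1 - \<alpha>)) \<le> 1 / 2 * (r * \<delta>) powr (1 / real t) * (1 - \<alpha>)"
    using mult_right_mono[OF *[of \<delta>], of "1 - \<alpha>"] \<delta> \<alpha> by simp
  moreover have "r * cost_rate t \<alpha> \<delta> \<le> r * ((\<delta> / 2) powr (1 / real t) * \<alpha>)"
    "r * cost_rate t \<alpha> \<delta> \<le> r * (1 / 2 * \<delta> powr (1 / real t) * (1 - \<alpha>))"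
    unfolding cost_rate_def using r by (intro mult_left_mono; simp)+
  ultimately show ?thesis unfolding cost_rate_def[of t \<alpha> "r * \<delta>"] by (intro min.boundedI) linarith+
qed

section \<open>Upper bound on the tail\<close>

locale localized_graphs = sparse_graphs +
  fixes c :: "nat \<Rightarrow> real" and \<alpha> :: real
  assumes c: "filterlim c at_top sequentially"
    and d_le: "\<forall>\<^sub>F n in sequentially. d n \<le> sqrt (real n) * ln (real n) powr (- c n)"
    and log_d: "(\<lambda>n. ln (d n) / ln (real n)) \<longlonglongrightarrow> \<alpha>"
begin

lemma ev_ln_ge: "\<forall>\<^sub>F n in sequentially. y \<le> ln (real n)"
  by real_asymp

lemma polylog_powr:
  assumes "e > 0"
  shows "(\<lambda>n. B * (ln (real n) ^ k * d n powr (- e))) \<longlonglongrightarrow> 0"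
proof (rule tendsto_mult_right_zero, rule Lim_null_comparison)
  have "e / real t > 0" using assms t3 by simp
  then show "(\<lambda>n. ln (real n) ^ k * real n powr (- (e / real t))) \<longlonglongrightarrow> 0" by real_asymp
  show "\<forall>\<^sub>F n in sequentially. norm (ln (real n) ^ k * d n powr (- e)) \<le> ln (real n) ^ k * real n powr (- (e / real t))"
    using ev_powr_le eventually_ge_at_top[of 1]
  proof eventually_elim
    case (elim n)
    have "d n powr (- e) \<le> (real n powr (1 / real t)) powr (- e)"
      using elim assms by (intro powr_mono2') auto
    then show ?case using elim by (simp add: powr_powr mult_left_mono)
  qed
qed

text \<open>The only direct use of the upper bound on \<open>d\<close>: since \<open>c\<close>
  eventually exceeds every constant, d^2/n decays faster than any fixed power of ln n grows.\<close>

lemma polylog_sq_over: "(\<lambda>n. B * (ln (real n) ^ k * (d n)\<^sup>2 / real n)) \<longlonglongrightarrow> 0"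
proof (rule tendsto_mult_right_zero, rule Lim_null_comparison)
  show "(\<lambda>n. 1 / ln (real n)) \<longlonglongrightarrow> 0" by real_asymp
  have "\<forall>\<^sub>F n in sequentially. real k + 1 \<le> c n" using c by (simp add: filterlim_at_top)
  with d_le ev_ln_ge[of 1] eventually_ge_at_top[of 1]
  show "\<forall>\<^sub>F n in sequentially. norm (ln (real n) ^ k * (d n)\<^sup>2 / real n) \<le> 1 / ln (real n)"
  proof eventually_elim
    case (elim n)
    define L where "L = ln (real n)"
    have L: "L \<ge> 1" using elim by (simp add: L_def)
    have "(d n)\<^sup>2 \<le> (sqrt (real n) * L powr (- c n))\<^sup>2"
      using elim d_pos[of n] by (intro power_mono) (auto simp: L_def)
    also have "\<dots> = real n * (L powr (- c n))\<^sup>2" by (simp add: power_mult_distrib)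
    also have "(L powr (- c n))\<^sup>2 \<le> L powr (- (real k + 1))"
    proof -
      have "(L powr (- c n))\<^sup>2 = L powr (- c n + - c n)" by (simp only: power2_eq_square powr_add)
      also have "\<dots> \<le> L powr (- (real k + 1))" using L elim by (intro powr_mono) auto
      finally show ?thesis .
    qed
    finally have "(d n)\<^sup>2 \<le> real n * L powr (- (real k + 1))" using elim by (simp add: mult_left_mono)
    then have "(d n)\<^sup>2 / real n \<le> L powr (- (real k + 1))" using elim by (simp add: field_simps)
    then have "L ^ k * ((d n)\<^sup>2 / real n) \<le> L ^ k * L powr (- (real k + 1))"
      using L by (intro mult_left_mono) auto
    also have "\<dots> = L powr (real k + - (real k + 1))"
      using L by (simp only: powr_add) (simp add: powr_realpow)
    also have "\<dots> = 1 / L" using L by (simp add: powr_minus_divide)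
    finally show ?case using L by (simp add: L_def)
  qed
qed

lemma \<alpha>_ge: "1 / real t \<le> \<alpha>"
proof (rule tendsto_lowerbound[OF log_d])
  show "\<forall>\<^sub>F n in sequentially. 1 / real t \<le> ln (d n) / ln (real n)"
    using ev_powr_le ev_ln_ge[of 1] eventually_ge_at_top[of 1]
  proof eventually_elim
    case (elim n)
    have "ln (real n powr (1 / real t)) \<le> ln (d n)" using elim by (intro ln_mono) auto
    moreover have "ln (real n) > 0" using elim by linarith
    ultimately show ?case using t3 elim by (simp add: ln_powr field_simps)
  qed
qed simp

lemma \<alpha>_le: "\<alpha> \<le> 1 / 2"
proof (rule tendsto_upperbound[OF log_d])
  have "\<forall>\<^sub>F n in sequentially. (ln (real n) ^ 0 * (d n)\<^sup>2 / real n) \<le> 1"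
    using polylog_sq_over[of 1 0] by (intro eventually_le_of_tendsto) auto
  with ev_ln_ge[of 1] eventually_ge_at_top[of 1]
  show "\<forall>\<^sub>F n in sequentially. ln (d n) / ln (real n) \<le> 1 / 2"
  proof eventually_elim
    case (elim n)
    have "ln ((d n)\<^sup>2) \<le> ln (real n)" using elim d_pos[of n] by (intro ln_mono) auto
    moreover have "ln (real n) > 0" using elim by linarith
    ultimately show ?case using elim d_pos[of n] by (simp add: ln_realpow field_simps)
  qed
qed simp

lemma \<alpha>01: "0 < \<alpha>" "\<alpha> < 1"
  using \<alpha>_ge \<alpha>_le t3 by (auto intro: less_le_trans[rotated])

lemma log_p: "(\<lambda>n. ln (p n) / ln (real n)) \<longlonglongrightarrow> \<alpha> - 1"
proof (rule Lim_transform_eventually)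
  show "(\<lambda>n. ln (d n) / ln (real n) - 1) \<longlonglongrightarrow> \<alpha> - 1" by (intro tendsto_intros log_d)
  show "\<forall>\<^sub>F n in sequentially. ln (d n) / ln (real n) - 1 = ln (p n) / ln (real n)"
    using ev_ln_ge[of 1] eventually_ge_at_top[of 1]
  proof eventually_elim
    case (elim n)
    then have "ln (real n) \<noteq> 0" by auto
    then show ?case using p01[of n] elim by (simp add: d_eq ln_mult field_simps)
  qed
qed

lemma ev_X: "\<forall>\<^sub>F n in sequentially. B \<le> (d n)\<^sup>2 * ln (real n)"
  using ev_ln_ge[of 1] ev_d_ge[of 1] ev_d_ge[of B]
proof eventually_elim
  case (elim n)
  have "d n * 1 \<le> d n * (d n * ln (real n))"
    using elim mult_mono[of 1 "d n" 1 "ln (real n)"] by (intro mult_left_mono) auto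
  then have "B \<le> d n * (d n * ln (real n))" using elim by linarith
  then show ?case by (simp add: power2_eq_square mult.assoc)
qed

text \<open>The relative error e is spent as follows: e/3 on replacing \<delta> by \<delta> -
  5\<epsilon>, e/6 on the price of an edge, e/8 on the number of degree records, e/8 on the number
  of edge sets, and e/4 on constants.\<close>

lemma upper_tail:
  assumes \<delta>: "\<delta> > 0" and e: "0 < e" "e < 1"
  shows "\<forall>\<^sub>F n in sequentially. subset_mean (p n) (pairs {1..n}) (\<lambda>E. of_bool ((1 + \<delta>) * d n ^ (2 * t) \<le> cycle_homs {1..n} t E)) \<le>
    exp (- ((1 - e) * cost_rate t \<alpha> \<delta> * ((d n)\<^sup>2 * ln (real n))))"
proof -
  define \<kappa> where "\<kappa> = cost_rate t \<alpha> \<delta>"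
  have \<kappa>: "\<kappa> > 0" unfolding \<kappa>_def by (intro cost_rate_pos \<alpha>01 \<delta>)
  define \<epsilon> where "\<epsilon> = e * \<delta> / 15"
  have \<epsilon>: "\<epsilon> > 0" "5 * \<epsilon> < \<delta>" using \<delta> e by (auto simp: \<epsilon>_def)
  define \<kappa>3 where "\<kappa>3 = cost_rate t \<alpha> (\<delta> - 5 * \<epsilon>)"
  have \<kappa>3: "(1 - e / 3) * \<kappa> \<le> \<kappa>3"
  proof -
    have "\<delta> - 5 * \<epsilon> = (1 - e / 3) * \<delta>" by (simp add: \<epsilon>_def algebra_simps)
    then show ?thesis unfolding \<kappa>_def \<kappa>3_def using cost_rate_scale[of "1 - e / 3" t \<delta> \<alpha>] e t3 \<delta> \<alpha>01 by simp
  qed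
  have \<kappa>3p: "\<kappa>3 > 0" unfolding \<kappa>3_def using \<epsilon> by (intro cost_rate_pos \<alpha>01) auto
  \<comment> \<open>Chosen so that A + \<epsilon>/4 + \<epsilon>/2 = 1 + \<delta> - \<epsilon>. The
    quarter inside \<open>A\<close> covers the error from \<eta>, the second quarter the factor with
    \<open>\<epsilon>3\<close>, and the half the noise.\<close>
  define A where "A = \<delta> - 2 * \<epsilon> + 1 + \<epsilon> / 4"
  have A: "A > 0" using \<epsilon> by (simp add: A_def)
  have "((\<lambda>x::real. (1 + x) ^ (2 * t) * A) \<longlongrightarrow> (1 + 0) ^ (2 * t) * A) (at_right 0)"
    by (intro tendsto_intros)
  then have "\<forall>\<^sub>F x::real in at_right 0. (1 + x) ^ (2 * t) * A < A + \<epsilon> / 4"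
    by (rule order_tendstoD) (use \<epsilon> in auto)
  with eventually_at_right_less[of 0] have "\<forall>\<^sub>F x::real in at_right 0. 0 < x \<and> (1 + x) ^ (2 * t) * A < A + \<epsilon> / 4"
    by eventually_elim auto
  then obtain \<epsilon>3 :: real where \<epsilon>3: "0 < \<epsilon>3" "(1 + \<epsilon>3) ^ (2 * t) * A < A + \<epsilon> / 4"
    using eventually_happens'[OF trivial_limit_at_right_real] by blast
  \<comment> \<open>With this constant the error of the moment method is at most exp(- \<kappa> d^2
    ln n), since 1 - \<epsilon>/(1+\<delta>) <= exp(- \<epsilon>/(1+\<delta>)).\<close>
  define c0 where "c0 = \<kappa> * (1 + \<delta>) / \<epsilon>"
  have c0: "c0 > 0" using \<kappa> \<delta> \<epsilon> by (simp add: c0_def)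
  define l where "l n = nat \<lceil>c0 * ((d n)\<^sup>2 * ln (real n))\<rceil>" for n
  define R where "R n = 2 * t * l n" for n
  define \<rho> where "\<rho> n = 2 * real (R n) / (d n)\<^sup>2" for n
  define C where "C = 4 * real t * c0 + 1"
  have C: "C > 0" using c0 by (simp add: C_def add_nonneg_pos)
  define K where "K = \<kappa>3 / min \<alpha> (1 - \<alpha>)"
  have mn: "min \<alpha> (1 - \<alpha>) > 0" using \<alpha>01 by simp
  then have mn0: "min \<alpha> (1 - \<alpha>) \<noteq> 0" by linarith
  have K: "K \<ge> 0" using \<kappa>3p mn by (simp add: K_def)
  obtain N0 :: nat where N0: "4 * real t * (2 * K) ^ t / \<epsilon> \<le> real N0" using real_arch_simple by blast
  define N where "N = Suc N0"
  have N: "N \<ge> 1" "4 * real t * (2 * K) ^ t \<le> \<epsilon> * real N" using N0 \<epsilon> by (auto simp: N_def field_simps)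
  \<comment> \<open>The top degree threshold is d^e6, a power small enough for hub edges to keep
    most of their price.\<close>
  define e6 where "e6 = e / 24"
  define \<theta> where "\<theta> = e6 / real N"
  have \<theta>: "\<theta> > 0" "real N * \<theta> = e6" using e N by (auto simp: \<theta>_def e6_def)
  \<comment> \<open>The factor n^(-e4) in both weights has to beat the powers of ln n in the edge
    counts. It is at most a fraction e/24 of either price exponent, \<alpha> or 1 -
    \<alpha>.\<close>
  define e4 where "e4 = e / 24 * min \<alpha> (1 - \<alpha>)"
  have e4: "e4 > 0" "e4 \<le> e / 24 * \<alpha>" "e4 \<le> e / 24 * (1 - \<alpha>)" unfolding e4_def using e mn
    by (simp, intro mult_left_mono, auto)
  define u where "u n = (1 - e / 6) * ln (real n)" for n
  define x where "x n = real n powr (- e4)" for n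
  \<comment> \<open>Up to n^e4 this makes p/y equal to 1/d, the price of a star edge.\<close>
  define y where "y n = (d n)\<^sup>2 * real n powr (- e4) / real n" for n
  define q where "q n = \<epsilon> * d n ^ (2 * t) / (2 * real t * (2 * real (R n)) ^ (t - 1))" for n
  define m where "m n = nat \<lceil>2 * real (R n) / d n powr \<theta>\<rceil>" for n
  define \<eta> where "\<eta> n = \<rho> n ^ (t + 1) * (d n)\<^sup>2 / real n" for n

  have ev_base: "\<forall>\<^sub>F n in sequentially. n \<ge> 1 \<and> ln (real n) \<ge> 1 \<and> d n \<ge> 1"
    using eventually_ge_at_top[of 1] ev_ln_ge[of 1] ev_d_ge[of 1] by eventually_elim auto
  have ev_\<rho>: "\<forall>\<^sub>F n in sequentially. 1 \<le> \<rho> n \<and> \<rho> n \<le> C * ln (real n)"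
    using ev_base ev_ln_ge[of "1 / (4 * real t * c0)"] ev_d_ge[of "4 * real t"]
  proof eventually_elim
    case (elim n)
    have d2: "(d n)\<^sup>2 > 0" "d n \<le> (d n)\<^sup>2" using elim by (auto simp: power2_eq_square)
    have X: "0 \<le> c0 * ((d n)\<^sup>2 * ln (real n))" using c0 elim by auto
    have l: "c0 * ((d n)\<^sup>2 * ln (real n)) \<le> real (l n)" "real (l n) \<le> c0 * ((d n)\<^sup>2 * ln (real n)) + 1"
      unfolding l_def using X by linarith+
    have \<rho>: "\<rho> n = 4 * real t * real (l n) / (d n)\<^sup>2" by (simp add: \<rho>_def R_def)
    have "1 \<le> 4 * real t * c0 * ln (real n)" using elim c0 t3 by (simp add: field_simps)
    also have "\<dots> = 4 * real t * (c0 * ((d n)\<^sup>2 * ln (real n))) / (d n)\<^sup>2" using d2 by simp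
    also have "\<dots> \<le> \<rho> n" unfolding \<rho> using l d2 by (intro divide_right_mono mult_left_mono) auto
    finally have 1: "1 \<le> \<rho> n" .
    have "\<rho> n \<le> 4 * real t * (c0 * ((d n)\<^sup>2 * ln (real n)) + 1) / (d n)\<^sup>2"
      unfolding \<rho> using l d2 by (intro divide_right_mono mult_left_mono) auto
    also have "\<dots> = 4 * real t * c0 * ln (real n) + 4 * real t / (d n)\<^sup>2" using d2 by (simp add: field_simps)
    also have "4 * real t / (d n)\<^sup>2 \<le> 1" using elim d2 by (simp add: field_simps)
    also have "1 \<le> ln (real n)" using elim by simp
    finally have "\<rho> n \<le> C * ln (real n)" by (simp add: C_def algebra_simps)
    with 1 show ?case by simp
  qed
  have \<rho>pow: "\<rho> n ^ k \<le> C ^ k * ln (real n) ^ k" if "1 \<le> \<rho> n \<and> \<rho> n \<le> C * ln (real n)" for n k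
    using power_mono[of "\<rho> n" "C * ln (real n)" k] that by (simp add: power_mult_distrib)
  have ev_\<eta>: "\<forall>\<^sub>F n in sequentially. \<eta> n \<le> y" if "y > 0" for y
    using ev_\<rho> ev_base eventually_le_of_tendsto[OF polylog_sq_over[of "C ^ (t + 1)" "t + 1"] that]
  proof eventually_elim
    case (elim n)
    have "\<eta> n \<le> (C ^ (t + 1) * ln (real n) ^ (t + 1)) * (d n)\<^sup>2 / real n"
      unfolding \<eta>_def using \<rho>pow[of n "t + 1"] elim by (intro divide_right_mono mult_right_mono) auto
    then show ?case using elim(3) by simp
  qed
  have ev_seed: "\<forall>\<^sub>F n in sequentially. (1 + \<epsilon>3) ^ (2 * t) * (\<delta> - 2 * \<epsilon> + 1 + real (2 * t) * (5 ^ (2 * t) * \<eta> n)) * d n ^ (2 * t) +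
      (1 + 1 / \<epsilon>3) ^ (2 * t) * (real ((t + 1) ^ (2 * t + 1)) * (real n * d n ^ t)) \<le> (1 + \<delta> - \<epsilon>) * d n ^ (2 * t)"
  proof -
    define B where "B = (1 + 1 / \<epsilon>3) ^ (2 * t) * real ((t + 1) ^ (2 * t + 1))"
    have "(\<lambda>n. B * (real n * d n ^ t / d n ^ (2 * t))) \<longlonglongrightarrow> B * 0" by (intro tendsto_intros sparse)
    then have "\<forall>\<^sub>F n in sequentially. B * (real n * d n ^ t / d n ^ (2 * t)) \<le> \<epsilon> / 2"
      using \<epsilon> by (intro eventually_le_of_tendsto) auto
    moreover have "\<forall>\<^sub>F n in sequentially. \<eta> n \<le> \<epsilon> / 4 / (real (2 * t) * 5 ^ (2 * t))"
      using \<epsilon> t3 by (intro ev_\<eta>) auto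
    ultimately show ?thesis using ev_base
    proof eventually_elim
      case (elim n)
      have D: "d n ^ (2 * t) > 0" using elim by auto
      have "real (2 * t) * (5 ^ (2 * t) * \<eta> n) \<le> \<epsilon> / 4" using elim(2) t3 by (simp add: field_simps)
      then have "(1 + \<epsilon>3) ^ (2 * t) * (\<delta> - 2 * \<epsilon> + 1 + real (2 * t) * (5 ^ (2 * t) * \<eta> n)) \<le> (1 + \<epsilon>3) ^ (2 * t) * A"
        using \<epsilon>3 by (intro mult_left_mono) (auto simp: A_def)
      also have "\<dots> \<le> A + \<epsilon> / 4" using \<epsilon>3 by simp
      finally have 1: "(1 + \<epsilon>3) ^ (2 * t) * (\<delta> - 2 * \<epsilon> + 1 + real (2 * t) * (5 ^ (2 * t) * \<eta> n)) * d n ^ (2 * t) \<le> (A + \<epsilon> / 4) * d n ^ (2 * t)"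
        using D by (intro mult_right_mono) auto
      have "B * (real n * d n ^ t) \<le> \<epsilon> / 2 * d n ^ (2 * t)" using elim(1) D by (simp add: field_simps)
      then have 2: "(1 + 1 / \<epsilon>3) ^ (2 * t) * (real ((t + 1) ^ (2 * t + 1)) * (real n * d n ^ t)) \<le> \<epsilon> / 2 * d n ^ (2 * t)"
        by (simp add: B_def mult.assoc)
      have "(A + \<epsilon> / 4) * d n ^ (2 * t) + \<epsilon> / 2 * d n ^ (2 * t) = (1 + \<delta> - \<epsilon>) * d n ^ (2 * t)"
        by (simp add: A_def algebra_simps)
      then show ?case using 1 2 by linarith
    qed
  qed
  \<comment> \<open>The degree product threshold is d^2 up to a power of \<rho>, which is a power of
    ln n.\<close>
  have qeq: "q n = \<epsilon> * (d n)\<^sup>2 / (2 * real t * \<rho> n ^ (t - 1))" and R2: "2 * real (R n) = \<rho> n * (d n)\<^sup>2"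
    if "d n \<ge> 1" for n
  proof -
    have d0: "d n \<noteq> 0" using that by auto
    show R2: "2 * real (R n) = \<rho> n * (d n)\<^sup>2" using d0 by (simp add: \<rho>_def)
    define P where "P = ((d n)\<^sup>2) ^ (t - 1)"
    have "2 * t = 2 + 2 * (t - 1)" using t3 by simp
    then have num: "d n ^ (2 * t) = (d n)\<^sup>2 * P" unfolding P_def power_mult[symmetric] by (simp only: power_add)
    have den: "(\<rho> n * (d n)\<^sup>2) ^ (t - 1) = \<rho> n ^ (t - 1) * P" by (simp only: P_def power_mult_distrib)
    have "P \<noteq> 0" using d0 by (simp add: P_def)
    then show "q n = \<epsilon> * (d n)\<^sup>2 / (2 * real t * \<rho> n ^ (t - 1))"
      unfolding q_def R2 num den by simp
  qed
  have ev_thr: "\<forall>\<^sub>F n in sequentially. (d n powr (real N * \<theta>))\<^sup>2 \<le> q n"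
  proof -
    have "2 - 2 * e6 > 0" using e by (simp add: e6_def)
    from eventually_le_of_tendsto[OF polylog_powr[OF this, of "2 * real t / \<epsilon> * C ^ (t - 1)" "t - 1"] zero_less_one]
    show ?thesis using ev_base ev_\<rho>
    proof eventually_elim
      case (elim n)
      have d1: "d n \<ge> 1" using elim by simp
      have P: "\<rho> n ^ (t - 1) > 0" using elim by simp
      have "2 * real t / \<epsilon> * (\<rho> n ^ (t - 1) * d n powr (- (2 - 2 * e6))) \<le> 2 * real t / \<epsilon> * ((C ^ (t - 1) * ln (real n) ^ (t - 1)) * d n powr (- (2 - 2 * e6)))"
        using \<rho>pow[of n "t - 1"] elim \<epsilon> by (intro mult_left_mono mult_right_mono) auto
      also have "\<dots> \<le> 1" using elim(1) by (simp add: mult_ac)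
      finally have le: "2 * real t / \<epsilon> * (\<rho> n ^ (t - 1) * d n powr (- (2 - 2 * e6))) \<le> 1" .
      have "(d n powr (real N * \<theta>))\<^sup>2 = d n powr (2 * e6)"
        unfolding \<theta>(2) by (simp add: power2_eq_square powr_add[symmetric])
      also have "2 * e6 = 2 + - (2 - 2 * e6)" by simp
      also have "d n powr \<dots> = (d n)\<^sup>2 * d n powr (- (2 - 2 * e6))"
        using d1 by (simp only: powr_add) simp
      also have "\<dots> \<le> (d n)\<^sup>2 * (\<epsilon> / (2 * real t * \<rho> n ^ (t - 1)))"
        using le P \<epsilon> t3 by (intro mult_left_mono) (auto simp: field_simps)
      also have "\<dots> = q n" using qeq[OF d1] by simp
      finally show ?case .
    qed
  qed
  have ratio: "(2 * real (R n)) ^ (k + 1) / q n = 2 * real t / \<epsilon> * (\<rho> n ^ (t + k) * d n ^ (2 * k))"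
    if "d n \<ge> 1" "1 \<le> \<rho> n" for n k
  proof -
    define a where "a = \<rho> n ^ (t - 1)"
    define P where "P = ((d n)\<^sup>2) ^ k"
    define v where "v = (d n)\<^sup>2"
    have Pv: "P = v ^ k" by (simp only: P_def v_def)
    have "a \<noteq> 0" "v \<noteq> 0" using that by (auto simp: a_def v_def)
    have e1: "(\<rho> n * (d n)\<^sup>2) ^ (k + 1) = \<rho> n ^ (k + 1) * (P * v)"
      by (simp add: P_def v_def power_mult_distrib)
    have "t + k = (t - 1) + (k + 1)" using t3 by simp
    then have e2: "\<rho> n ^ (t + k) = a * \<rho> n ^ (k + 1)" unfolding a_def by (simp only: power_add)
    have e3: "d n ^ (2 * k) = P" by (simp only: P_def power_mult)
    show ?thesis
      unfolding qeq[OF that(1)] R2[OF that(1)] e1 e2 e3 a_def[symmetric] v_def[symmetric]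
      using \<open>a \<noteq> 0\<close> \<open>v \<noteq> 0\<close> \<epsilon> t3 by (simp add: field_simps Pv)
  qed
  have ev_mix: "\<forall>\<^sub>F n in sequentially. 2 ^ (2 * t) * ((2 * real (R n)) ^ (t + 1) / q n * d n powr (- \<theta>)) \<le> \<epsilon> * d n ^ (2 * t)"
    using eventually_le_of_tendsto[OF polylog_powr[OF \<theta>(1), of "2 ^ (2 * t) * (2 * real t / \<epsilon>) * C ^ (2 * t)" "2 * t"] \<epsilon>(1)] ev_base ev_\<rho>
  proof eventually_elim
    case (elim n)
    have "2 ^ (2 * t) * ((2 * real (R n)) ^ (t + 1) / q n * d n powr (- \<theta>)) =
      2 ^ (2 * t) * (2 * real t / \<epsilon>) * (\<rho> n ^ (2 * t) * d n powr (- \<theta>)) * d n ^ (2 * t)"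
      using ratio[of n t] elim by (simp add: mult_2[symmetric] mult_ac)
    also have "\<dots> \<le> 2 ^ (2 * t) * (2 * real t / \<epsilon>) * ((C ^ (2 * t) * ln (real n) ^ (2 * t)) * d n powr (- \<theta>)) * d n ^ (2 * t)"
      using \<rho>pow[of n "2 * t"] elim \<epsilon> by (intro mult_left_mono mult_right_mono) auto
    also have "\<dots> \<le> \<epsilon> * d n ^ (2 * t)" using elim by (intro mult_right_mono) (auto simp: mult_ac)
    finally show ?case .
  qed
  have ev_px: "\<forall>\<^sub>F n in sequentially. p n / x n \<le> exp (- (u n * (1 - \<alpha>)))"
  proof -
    \<comment> \<open>The strict inequality leaves room for the o(1) in p = n^(\<alpha> - 1 +
      o(1)).\<close>
    have "\<alpha> - 1 < - ((1 - e / 6) * (1 - \<alpha>)) - e4"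
    proof -
      have "e / 24 * (1 - \<alpha>) < e / 6 * (1 - \<alpha>)" using e \<alpha>01 by (intro mult_strict_right_mono) auto
      moreover have "(1 - e / 6) * (1 - \<alpha>) = (1 - \<alpha>) - e / 6 * (1 - \<alpha>)" by (simp add: left_diff_distrib)
      ultimately show ?thesis using e4(3) by linarith
    qed
    from order_tendstoD(2)[OF log_p this] show ?thesis using ev_base
    proof eventually_elim
      case (elim n)
      have L: "0 < ln (real n)" using elim(2) by linarith
      have "ln (p n) \<le> (- ((1 - e / 6) * (1 - \<alpha>)) - e4) * ln (real n)"
        using elim(1) unfolding pos_divide_less_eq[OF L] by (rule less_imp_le)
      then have "ln (p n) + e4 * ln (real n) \<le> - (u n * (1 - \<alpha>))" by (simp add: u_def algebra_simps)
      then have "exp (ln (p n) + e4 * ln (real n)) \<le> exp (- (u n * (1 - \<alpha>)))" by simp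
      moreover have "exp (ln (p n) + e4 * ln (real n)) = p n / x n"
        using elim p01[of n] by (simp add: exp_add x_def powr_def exp_minus field_simps)
      ultimately show ?case by simp
    qed
  qed
  have ev_py: "\<forall>\<^sub>F n in sequentially. p n * d n powr (real N * \<theta>) / y n \<le> exp (- (u n * \<alpha>))"
  proof -
    have "(\<lambda>n. (e6 - 1) * (ln (d n) / ln (real n))) \<longlonglongrightarrow> (e6 - 1) * \<alpha>" by (intro tendsto_intros log_d)
    moreover have "(e6 - 1) * \<alpha> < - ((1 - e / 6) * \<alpha>) - e4"
    proof -
      have "e / 24 * \<alpha> + e / 24 * \<alpha> < e / 6 * \<alpha>" using e \<alpha>01 by simp
      then show ?thesis using e4(2) by (simp add: e6_def algebra_simps)
    qed
    ultimately have "\<forall>\<^sub>F n in sequentially. (e6 - 1) * (ln (d n) / ln (real n)) < - ((1 - e / 6) * \<alpha>) - e4"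
      by (rule order_tendstoD)
    then show ?thesis using ev_base
    proof eventually_elim
      case (elim n)
      have d0: "d n > 0" using elim by simp
      have L: "0 < ln (real n)" using elim(2) by linarith
      have "(e6 - 1) * ln (d n) \<le> (- ((1 - e / 6) * \<alpha>) - e4) * ln (real n)"
        using elim(1) unfolding times_divide_eq_right pos_divide_less_eq[OF L] by (rule less_imp_le)
      then have "(e6 - 1) * ln (d n) + e4 * ln (real n) \<le> - (u n * \<alpha>)" by (simp add: u_def algebra_simps)
      then have "exp ((e6 - 1) * ln (d n) + e4 * ln (real n)) \<le> exp (- (u n * \<alpha>))" by simp
      moreover have "exp ((e6 - 1) * ln (d n) + e4 * ln (real n)) = d n powr (e6 - 1) * real n powr e4"
        using elim d0 by (simp add: exp_add powr_def)
      moreover have "d n powr (e6 - 1) * real n powr e4 = p n * d n powr (real N * \<theta>) / y n"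
      proof -
        have "p n = d n / real n" using elim by (simp add: d_eq)
        then show ?thesis unfolding \<theta>(2) y_def using elim d0
          by (simp add: powr_diff powr_minus power2_eq_square field_simps)
      qed
      ultimately show ?case by simp
    qed
  qed
  have e\<kappa>: "e * \<kappa> / 16 > 0" using e \<kappa> by simp
  \<comment> \<open>A degree record has at most n^2 options for each of about \<rho> d^(2 -
    \<theta>) vertices, so the logarithm of their number is o(d^2 ln n).\<close>
  have ev_m: "\<forall>\<^sub>F n in sequentially. (real n * real (2 * R n)) ^ m n \<le> exp (e / 8 * \<kappa> * ((d n)\<^sup>2 * ln (real n)))"
    using ev_base ev_\<rho> eventually_le_of_tendsto[OF polylog_powr[OF \<theta>(1), of "2 * C" 1] e\<kappa>]
      ev_d_ge[of "2 / (e * \<kappa> / 16)"] eventually_le_of_tendsto[OF polylog_sq_over[of C 1] zero_less_one]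
  proof eventually_elim
    case (elim n)
    have d1: "d n \<ge> 1" and n1: "real n > 0" and L1: "ln (real n) \<ge> 1" using elim(1) by auto
    have d2: "(d n)\<^sup>2 > 0" "d n \<le> (d n)\<^sup>2" using d1 by (auto simp: power2_eq_square)
    have "real (2 * R n) = \<rho> n * (d n)\<^sup>2" using R2[OF d1] by simp
    also have "\<dots> \<le> C * ln (real n) * (d n)\<^sup>2" using elim(2) d2 by (intro mult_right_mono) auto
    also have "\<dots> \<le> real n"
    proof -
      have "(C * ln (real n) * (d n)\<^sup>2) / real n \<le> 1" using elim(5) by simp
      then show ?thesis unfolding pos_divide_le_eq[OF n1] by simp
    qed
    finally have "real n * real (2 * R n) \<le> real n * real n" by (intro mult_left_mono) auto
    also have "\<dots> = exp (2 * ln (real n))" by (simp only: mult_2 exp_add exp_ln[OF n1])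
    finally have "(real n * real (2 * R n)) ^ m n \<le> exp (2 * ln (real n)) ^ m n" by (intro power_mono) auto
    also have "\<dots> = exp (real (m n) * (2 * ln (real n)))" by (simp only: exp_of_nat_mult)
    also have "\<dots> \<le> exp (e / 8 * \<kappa> * ((d n)\<^sup>2 * ln (real n)))"
    proof -
      define w where "w = d n powr (- \<theta>)"
      have w: "w \<ge> 0" by (simp add: w_def)
      have "0 \<le> 2 * real (R n) / d n powr \<theta>" by simp
      then have m1: "real (m n) \<le> 2 * real (R n) / d n powr \<theta> + 1" unfolding m_def by linarith
      have "2 * real (R n) / d n powr \<theta> = \<rho> n * (d n)\<^sup>2 / d n powr \<theta>" by (simp only: R2[OF d1])
      also have "\<dots> = \<rho> n * w * (d n)\<^sup>2" by (simp add: w_def powr_minus_divide)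
      also have "\<dots> \<le> C * ln (real n) * w * (d n)\<^sup>2"
        using elim(2) w by (intro mult_right_mono) auto
      finally have "2 * real (m n) \<le> 2 * (C * ln (real n) * w * (d n)\<^sup>2) + 2" using m1 by linarith
      also have "2 * (C * ln (real n) * w * (d n)\<^sup>2) = (2 * C * (ln (real n) ^ 1 * d n powr (- \<theta>))) * (d n)\<^sup>2"
        by (simp add: w_def)
      also have "(2 * C * (ln (real n) ^ 1 * d n powr (- \<theta>))) * (d n)\<^sup>2 + 2 \<le> (e * \<kappa> / 16) * (d n)\<^sup>2 + (e * \<kappa> / 16) * (d n)\<^sup>2"
      proof (rule add_mono)
        show "(2 * C * (ln (real n) ^ 1 * d n powr (- \<theta>))) * (d n)\<^sup>2 \<le> (e * \<kappa> / 16) * (d n)\<^sup>2"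
          using elim(3) by (rule mult_right_mono) simp
        have "2 \<le> (e * \<kappa> / 16) * d n" using elim(4) unfolding pos_divide_le_eq[OF e\<kappa>] by (simp only: mult.commute)
        also have "\<dots> \<le> (e * \<kappa> / 16) * (d n)\<^sup>2" using d2 e\<kappa> by (intro mult_left_mono) auto
        finally show "2 \<le> (e * \<kappa> / 16) * (d n)\<^sup>2" .
      qed
      also have "\<dots> = e / 8 * \<kappa> * (d n)\<^sup>2" by simp
      finally have "2 * real (m n) * ln (real n) \<le> e / 8 * \<kappa> * (d n)\<^sup>2 * ln (real n)"
        by (rule mult_right_mono) (use L1 in simp)
      moreover have "real (m n) * (2 * ln (real n)) = 2 * real (m n) * ln (real n)" by (rule mult.left_commute[THEN trans]) (rule mult.assoc[symmetric])
      ultimately show ?thesis by (simp only: exp_le_cancel_iff mult.assoc)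
    qed
    finally show ?case .
  qed
  \<comment> \<open>Both terms are d^2 times a power of \<rho> times n^(-e4).\<close>
  have ev_xy: "\<forall>\<^sub>F n in sequentially. x n * ((2 * real (R n))\<^sup>2 / q n) + y n * (real n * (2 * real (R n)) / q n) \<le>
      e / 8 * \<kappa> * ((d n)\<^sup>2 * ln (real n))"
  proof -
    have "(\<lambda>n. (2 * real t / \<epsilon> * C ^ (t + 1)) * (ln (real n) ^ (t + 1) * real n powr (- e4))) \<longlonglongrightarrow> 0"
      by (rule tendsto_mult_right_zero) (use e4(1) in real_asymp)
    from eventually_le_of_tendsto[OF this e\<kappa>] ev_base ev_\<rho> show ?thesis
    proof eventually_elim
      case (elim n)
      have d1: "d n \<ge> 1" "1 \<le> \<rho> n" and n0: "real n > 0" using elim by auto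
      have d2: "(d n)\<^sup>2 > 0" using d1 by simp
      have "x n * ((2 * real (R n))\<^sup>2 / q n) = x n * ((2 * real (R n)) ^ (1 + 1) / q n)" by (simp add: power2_eq_square)
      also have "\<dots> = (2 * real t / \<epsilon>) * (\<rho> n ^ (t + 1) * x n) * (d n)\<^sup>2"
        unfolding ratio[OF d1] by (simp add: mult_ac)
      finally have a: "x n * ((2 * real (R n))\<^sup>2 / q n) = (2 * real t / \<epsilon>) * (\<rho> n ^ (t + 1) * x n) * (d n)\<^sup>2" .
      have "y n * (real n * (2 * real (R n)) / q n) = (d n)\<^sup>2 * x n * ((2 * real (R n)) ^ (0 + 1) / q n)"
        using n0 by (simp add: y_def x_def)
      also have "\<dots> = (2 * real t / \<epsilon>) * (\<rho> n ^ t * x n) * (d n)\<^sup>2"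
        unfolding ratio[OF d1] by (simp add: mult_ac)
      also have "\<dots> \<le> (2 * real t / \<epsilon>) * (\<rho> n ^ (t + 1) * x n) * (d n)\<^sup>2"
        using d1 \<epsilon> by (intro mult_right_mono mult_left_mono power_increasing) (auto simp: x_def)
      finally have b: "y n * (real n * (2 * real (R n)) / q n) \<le> (2 * real t / \<epsilon>) * (\<rho> n ^ (t + 1) * x n) * (d n)\<^sup>2" .
      have "(2 * real t / \<epsilon>) * (\<rho> n ^ (t + 1) * x n) * (d n)\<^sup>2 \<le>
         (2 * real t / \<epsilon>) * ((C ^ (t + 1) * ln (real n) ^ (t + 1)) * x n) * (d n)\<^sup>2"
        using \<rho>pow[of n "t + 1"] elim \<epsilon> by (intro mult_right_mono mult_left_mono) (auto simp: x_def)
      also have "\<dots> \<le> (e * \<kappa> / 16) * (d n)\<^sup>2"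
        using elim(1) by (intro mult_right_mono) (auto simp: x_def mult_ac)
      also have "\<dots> \<le> (e * \<kappa> / 16) * ((d n)\<^sup>2 * ln (real n))"
        using elim e\<kappa> d2 by (intro mult_left_mono) auto
      finally show ?case using a b by simp
    qed
  qed
  have ev_l: "\<forall>\<^sub>F n in sequentially. ((1 + \<delta> - \<epsilon>) / (1 + \<delta>)) ^ l n \<le> exp (- (\<kappa> * ((d n)\<^sup>2 * ln (real n))))"
    using ev_base
  proof eventually_elim
    case (elim n)
    define b where "b = \<epsilon> / (1 + \<delta>)"
    have b: "b > 0" using \<epsilon> \<delta> by (simp add: b_def)
    have X: "0 \<le> c0 * ((d n)\<^sup>2 * ln (real n))" using c0 elim by auto
    have l: "c0 * ((d n)\<^sup>2 * ln (real n)) \<le> real (l n)" unfolding l_def using X by linarith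
    have "(1 + \<delta> - \<epsilon>) / (1 + \<delta>) = 1 + - b" using \<delta> by (simp add: b_def field_simps)
    also have "\<dots> \<le> exp (- b)" by (rule exp_ge_add_one_self)
    finally have "((1 + \<delta> - \<epsilon>) / (1 + \<delta>)) ^ l n \<le> exp (- b) ^ l n"
      using \<epsilon> \<delta> by (intro power_mono) auto
    also have "\<dots> = exp (- (b * real (l n)))" by (simp add: exp_of_nat_mult[symmetric] mult.commute)
    also have "\<dots> \<le> exp (- (b * (c0 * ((d n)\<^sup>2 * ln (real n)))))" using mult_left_mono[OF l, of b] b by simp
    also have "b * (c0 * ((d n)\<^sup>2 * ln (real n))) = \<kappa> * ((d n)\<^sup>2 * ln (real n))"
    proof -
      have "b * c0 = \<kappa>" using \<delta> \<epsilon> by (simp add: b_def c0_def)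
      then show ?thesis by (simp only: mult.assoc[symmetric])
    qed
    finally show ?case .
  qed
  have "\<forall>\<^sub>F n in sequentially. (ln (real N) + 2) / (e / 4 * \<kappa>) \<le> (d n)\<^sup>2 * ln (real n)" by (rule ev_X)
  with ev_base ev_\<rho> ev_\<eta>[OF zero_less_one] ev_seed ev_thr ev_mix ev_px ev_py ev_m ev_xy ev_l
  show ?thesis
  proof eventually_elim
    case (elim n)
    have n1: "n \<ge> 1" and d1: "d n \<ge> 1" and L1: "ln (real n) \<ge> 1" and \<rho>1: "1 \<le> \<rho> n" using elim by auto
    define X where "X = (d n)\<^sup>2 * ln (real n)"
    have X0: "X \<ge> 0" unfolding X_def using L1 by simp
    have l1: "l n \<ge> 1"
    proof (rule ccontr)
      assume "\<not> ?thesis"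
      then have "\<rho> n = 0" by (simp add: \<rho>_def R_def)
      then show False using \<rho>1 by simp
    qed
    have "subset_mean (p n) (pairs {1..n}) (\<lambda>E. of_bool ((1 + \<delta>) * d n ^ (2 * t) \<le> cycle_homs {1..n} t E)) \<le>
      real N * (exp (- (u n * (cost_rate t \<alpha> (\<delta> - 5 * \<epsilon>) * (d n)\<^sup>2))) * (exp 1 * (real n * real (2 * R n)) ^ m n *
      exp (x n * ((2 * real (R n))\<^sup>2 / q n) + y n * (real n * (2 * real (R n)) / q n)))) + ((1 + \<delta> - \<epsilon>) / (1 + \<delta>)) ^ l n"
    proof -
      have pn: "0 < p n" "p n < 1" using p01[OF n1] by auto
      have K3: "cost_rate t \<alpha> (\<delta> - 5 * \<epsilon>) \<le> min \<alpha> (1 - \<alpha>) * K"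
        unfolding K_def \<kappa>3_def[symmetric] times_divide_eq_right nonzero_mult_div_cancel_left[OF mn0] ..
      have mm: "2 * real (R n) / d n powr \<theta> \<le> real (m n)" unfolding m_def by linarith
      have xy: "x n > 0" "y n > 0" using n1 d1 by (auto simp: x_def y_def)
      have u0: "u n \<ge> 0" using e L1 by (simp add: u_def)
      have t2: "2 \<le> t" using t3 by simp
      show ?thesis
        by (rule upper_tail_finite[OF n1 pn t2 d_eq[of n] d1 \<alpha>01 \<epsilon> \<epsilon>3(1) R_def[of n] l1 \<rho>_def[of n] \<rho>1
          \<eta>_def[of n] elim(3) elim(4) q_def[of n] N(1) \<theta>(1) elim(5) elim(6) K N(2) K3 mm xy u0 elim(7) elim(8)])
    qed
    also have "\<dots> \<le> real N * (exp (- ((1 - e / 2) * \<kappa> * X)) * (exp 1 * exp (e / 8 * \<kappa> * X) * exp (e / 8 * \<kappa> * X))) + exp (- (\<kappa> * X))"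
    proof -
      have "1 - e / 2 \<le> (1 - e / 6) * (1 - e / 3)" using e by (simp add: algebra_simps)
      from mult_right_mono[OF this less_imp_le[OF \<kappa>]]
      have "(1 - e / 2) * \<kappa> \<le> (1 - e / 6) * ((1 - e / 3) * \<kappa>)" by (simp only: mult.assoc)
      also have "\<dots> \<le> (1 - e / 6) * \<kappa>3" using \<kappa>3 e by (intro mult_left_mono) auto
      finally have "(1 - e / 2) * \<kappa> * X \<le> (1 - e / 6) * \<kappa>3 * X" using X0 by (rule mult_right_mono)
      moreover have "u n * (cost_rate t \<alpha> (\<delta> - 5 * \<epsilon>) * (d n)\<^sup>2) = (1 - e / 6) * \<kappa>3 * X"
        unfolding u_def X_def \<kappa>3_def by (simp only: mult_ac)
      ultimately have E1: "exp (- (u n * (cost_rate t \<alpha> (\<delta> - 5 * \<epsilon>) * (d n)\<^sup>2))) \<le> exp (- ((1 - e / 2) * \<kappa> * X))"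
        by (simp only: exp_le_cancel_iff neg_le_iff_le)
      have E2: "(real n * real (2 * R n)) ^ m n \<le> exp (e / 8 * \<kappa> * X)"
        using elim(9) unfolding X_def .
      have E3: "exp (x n * ((2 * real (R n))\<^sup>2 / q n) + y n * (real n * (2 * real (R n)) / q n)) \<le> exp (e / 8 * \<kappa> * X)"
        using elim(10) unfolding X_def exp_le_cancel_iff .
      have E4: "((1 + \<delta> - \<epsilon>) / (1 + \<delta>)) ^ l n \<le> exp (- (\<kappa> * X))"
        using elim(11) unfolding X_def .
      show ?thesis
        by (rule add_mono[OF mult_left_mono[OF mult_mono[OF E1 mult_mono[OF mult_left_mono[OF E2] E3]]] E4])
          (auto intro!: mult_nonneg_nonneg zero_le_power)
    qed
    also have "\<dots> = exp (ln (real N) + 1 - (1 - 3 * e / 4) * \<kappa> * X) + exp (- (\<kappa> * X))"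
    proof -
      have "real N * (exp (- ((1 - e / 2) * \<kappa> * X)) * (exp 1 * exp (e / 8 * \<kappa> * X) * exp (e / 8 * \<kappa> * X))) =
        exp (ln (real N)) * (exp (- ((1 - e / 2) * \<kappa> * X)) * (exp 1 * exp (e / 8 * \<kappa> * X) * exp (e / 8 * \<kappa> * X)))"
        using N(1) by (subst exp_ln) auto
      also have "\<dots> = exp (ln (real N) + (- ((1 - e / 2) * \<kappa> * X) + (1 + e / 8 * \<kappa> * X + e / 8 * \<kappa> * X)))"
        by (simp only: exp_add)
      also have "ln (real N) + (- ((1 - e / 2) * \<kappa> * X) + (1 + e / 8 * \<kappa> * X + e / 8 * \<kappa> * X)) = ln (real N) + 1 - (1 - 3 * e / 4) * \<kappa> * X"
        by (simp add: algebra_simps)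
      finally show ?thesis by simp
    qed
    also have "\<dots> \<le> exp (ln (real N) + 1 - (1 - 3 * e / 4) * \<kappa> * X) + exp (ln (real N) + 1 - (1 - 3 * e / 4) * \<kappa> * X)"
    proof -
      have "0 \<le> ln (real N)" using N by simp
      moreover have "0 \<le> 3 * e / 4 * \<kappa> * X" using e \<kappa> X0 by simp
      ultimately have "- (\<kappa> * X) \<le> ln (real N) + 1 - (1 - 3 * e / 4) * \<kappa> * X" by (simp add: algebra_simps)
      then show ?thesis by simp
    qed
    also have "\<dots> \<le> exp 1 * exp (ln (real N) + 1 - (1 - 3 * e / 4) * \<kappa> * X)"
      using exp_ge_add_one_self[of 1] by simp
    also have "\<dots> = exp (ln (real N) + 2 - (1 - 3 * e / 4) * \<kappa> * X)"
      unfolding exp_add[symmetric] by (rule arg_cong[of _ _ exp]) simp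
    also have "\<dots> \<le> exp (- ((1 - e) * \<kappa> * X))"
    proof -
      have "ln (real N) + 2 \<le> e / 4 * \<kappa> * X"
      proof -
        have "(ln (real N) + 2) / (e / 4 * \<kappa>) \<le> X" using elim(12) unfolding X_def .
        moreover have "e / 4 * \<kappa> > 0" using e \<kappa> by simp
        ultimately show ?thesis by (simp add: pos_divide_le_eq mult_ac)
      qed
      then show ?thesis by (simp add: algebra_simps)
    qed
    finally show ?case by (simp add: \<kappa>_def X_def)
  qed
qed

end

section \<open>Lower bound on the tail\<close>

context localized_graphs
begin

text \<open>The planted part supplies \<delta> + \<gamma> and the background 1 - \<gamma>. The
  exponent 4t arises because the background keeps average degree (1-x)^2 d, which is raised to the
  power 2t.\<close>

lemma lower_plant:
  assumes \<delta>: "\<delta> > 0" and \<gamma>: "\<gamma> > 0" and x: "0 < x" "x < 1" "1 - \<gamma> \<le> (1 - x) ^ (4 * t)"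
    and A: "\<forall>\<^sub>F n in sequentially. A n \<subseteq> pairs {1..n} \<and> real (card (A n)) \<le> x / 4 * (real n)\<^sup>2"
  shows "\<forall>\<^sub>F n in sequentially. subset_mean (p n) (A n) (\<lambda>E. of_bool ((\<delta> + \<gamma>) * d n ^ (2 * t) \<le> cycle_homs {1..n} t E)) / 2 \<le>
    subset_mean (p n) (pairs {1..n}) (\<lambda>E. of_bool ((1 + \<delta>) * d n ^ (2 * t) \<le> cycle_homs {1..n} t E))"
proof -
  have "\<forall>\<^sub>F n in sequentially. real n \<ge> 2 / x" by real_asymp
  with A eventually_ge_at_top[of 1] ev_d_ge[of "4 / (x\<^sup>2 * (1 - x))"] show ?thesis
  proof eventually_elim
    case (elim n)
    let ?I = "{1..n}"
    have I: "finite ?I" "?I \<noteq> {}" "card ?I = n" using elim by auto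
    have fA: "finite (A n)" using elim(1) finite_pairs[OF I(1)] finite_subset by blast
    have "subset_mean (p n) (A n) (\<lambda>E. of_bool ((\<delta> + \<gamma>) * d n ^ (2 * t) \<le> cycle_homs ?I t E)) / 2 \<le>
      subset_mean (p n) (pairs ?I) (\<lambda>E. of_bool ((\<delta> + \<gamma>) * d n ^ (2 * t) + (1 - \<gamma>) * d n ^ (2 * t) \<le> cycle_homs ?I t E))"
    proof (rule planting_lower_bound[OF I(1,2), of _ _ _ x])
      have "2 \<le> x * real n" using elim(4) x by (simp add: field_simps)
      then have "2 * real n \<le> x * real n * real n" by (intro mult_right_mono) auto
      then have "(1 - x) * (real n)\<^sup>2 / 2 \<le> real n * (real n - 1) / 2 - x / 4 * (real n)\<^sup>2"
      proof -
        assume "2 * real n \<le> x * real n * real n"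
        moreover have "(1 - x) * (real n)\<^sup>2 / 2 = real n * real n / 2 - x * real n * real n / 2"
          "real n * (real n - 1) / 2 - x / 4 * (real n)\<^sup>2 = real n * real n / 2 - real n / 2 - x * real n * real n / 4"
          by (simp_all add: power2_eq_square field_simps)
        ultimately show ?thesis by linarith
      qed
      also have "\<dots> \<le> real (card (pairs ?I)) - real (card (A n))"
        using elim(1) two_card_pairs[OF I(1)] I(3) by simp
      also have "\<dots> = real (card (pairs ?I - A n))"
        using elim(1) fA by (simp add: card_Diff_subset card_mono finite_pairs of_nat_diff)
      finally show "(1 - x) * (real (card ?I))\<^sup>2 / 2 \<le> real (card (pairs ?I - A n))" using I(3) by simp
      have "0 < x\<^sup>2 * (1 - x)" using x by simp
      then have "4 \<le> x\<^sup>2 * (1 - x) * d n" using elim(3) by (simp add: pos_divide_le_eq mult_ac)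
      also have "\<dots> = x\<^sup>2 * (1 - x) * d n * 1" by simp
      also have "\<dots> \<le> x\<^sup>2 * (1 - x) * d n * real n"
        using x elim d_pos[of n] by (intro mult_left_mono mult_nonneg_nonneg) auto
      also have "\<dots> = x\<^sup>2 * (1 - x) * (real (card ?I))\<^sup>2 * p n" using I(3) by (simp add: d_eq power2_eq_square)
      finally show "4 \<le> x\<^sup>2 * (1 - x) * (real (card ?I))\<^sup>2 * p n" .
      have "((1 - x)\<^sup>2 * (real n * p n)) ^ (2 * t) = (1 - x) ^ (4 * t) * d n ^ (2 * t)"
        by (simp add: d_eq power_mult_distrib flip: power_mult)
      moreover have "(1 - \<gamma>) * d n ^ (2 * t) \<le> (1 - x) ^ (4 * t) * d n ^ (2 * t)"
        using x elim d_pos[of n] by (intro mult_right_mono) auto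
      ultimately show "(1 - \<gamma>) * d n ^ (2 * t) \<le> ((1 - x)\<^sup>2 * (real (card ?I) * p n)) ^ (2 * t)"
        using I(3) by simp
    qed (use elim x t3 p01[of n] in auto)
    moreover have "(\<delta> + \<gamma>) * d n ^ (2 * t) + (1 - \<gamma>) * d n ^ (2 * t) = (1 + \<delta>) * d n ^ (2 * t)"
      by (simp add: algebra_simps)
    ultimately show ?case by simp
  qed
qed

lemma ev_sq_le:
  assumes "y > 0"
  shows "\<forall>\<^sub>F n in sequentially. B * (d n)\<^sup>2 \<le> y * real n"
  using eventually_le_of_tendsto[OF polylog_sq_over[of B 0] assms] eventually_ge_at_top[of 1]
proof eventually_elim
  case (elim n)
  then show ?case by (simp add: pos_divide_le_eq)
qed

context
  fixes \<delta> e :: real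
  assumes \<delta>: "\<delta> > 0" and e: "0 < e" "e < 1"
begin

text \<open>This factor is lost three times in each construction: in enlarging the structure, in
  rounding its size, and in the limit of the logarithmic price of an edge.\<close>

definition "slack = 1 + e / 16"

lemma slack: "slack > 1" using e by (simp add: slack_def)

lemma slack_pow: "slack ^ 3 \<le> 1 + e / 2"
proof -
  have e2: "e * e \<le> e" using e by (simp add: mult_left_le)
  have "slack ^ 2 = 1 + e / 8 + e * e / 256" by (simp add: slack_def power2_eq_square algebra_simps)
  then have "slack ^ 2 \<le> 1 + 3 * e / 16" using e2 e by linarith
  then have "slack ^ 2 * slack \<le> (1 + 3 * e / 16) * slack" using slack by (intro mult_right_mono) auto
  also have "\<dots> = 1 + e / 4 + 3 * (e * e) / 256" by (simp add: slack_def field_simps)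
  also have "\<dots> \<le> 1 + e / 2" using e2 e by linarith
  finally show ?thesis by (simp add: numeral_3_eq_3 power2_eq_square mult.assoc)
qed

text \<open>The surplus gained by using \<open>slack\<close> times as many planted edges, as the
  count scales with their \<open>t\<close>-th power. It makes up for the deficit of the
  background.\<close>

definition "gap = (slack ^ t - 1) * \<delta>"

lemma gap: "gap > 0" "\<delta> + gap = slack ^ t * \<delta>"
proof -
  have "1 < slack ^ t" using slack t3 by (intro one_less_power) auto
  then show "gap > 0" using \<delta> by (simp add: gap_def)
  show "\<delta> + gap = slack ^ t * \<delta>" by (simp add: gap_def algebra_simps)
qed

lemma root_pow: "y > 0 \<Longrightarrow> (y powr (1 / real t)) ^ t = y"
  using t3 powr_realpow[of "y powr (1 / real t)" t] by (simp add: powr_powr)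

lemma obtain_x:
  obtains x where "0 < x" "x < 1" "1 - gap \<le> (1 - x) ^ (4 * t)"
proof -
  have "((\<lambda>x::real. (1 - x) ^ (4 * t)) \<longlongrightarrow> (1 - 0) ^ (4 * t)) (at_right 0)"
    by (intro tendsto_intros)
  then have "\<forall>\<^sub>F x::real in at_right 0. 1 - gap < (1 - x) ^ (4 * t)"
    by (rule order_tendstoD) (use gap in auto)
  moreover have "\<forall>\<^sub>F x::real in at_right 0. 0 < x \<and> x < 1"
    by (rule eventually_at_right_real[of 0 1, simplified greaterThanLessThan_iff]) simp
  ultimately have "\<forall>\<^sub>F x::real in at_right 0. 0 < x \<and> x < 1 \<and> 1 - gap < (1 - x) ^ (4 * t)"
    by eventually_elim auto
  then obtain x :: real where "0 < x" "x < 1" "1 - gap < (1 - x) ^ (4 * t)"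
    using eventually_happens'[OF trivial_limit_at_right_real] by blast
  then show thesis using that[of x] by simp
qed

text \<open>The factor 1/2 from the background is harmless because d^2 ln n tends to
  infinity.\<close>

lemma lower_combine:
  assumes \<kappa>: "\<kappa> > 0"
    and "\<forall>\<^sub>F n in sequentially. exp (- ((1 + 3 * e / 4) * \<kappa> * ((d n)\<^sup>2 * ln (real n)))) / 2 \<le> P n"
  shows "\<forall>\<^sub>F n in sequentially. exp (- ((1 + e) * \<kappa> * ((d n)\<^sup>2 * ln (real n)))) \<le> P n"
  using assms(2) ev_X[of "1 / (e / 4 * \<kappa>)"]
proof eventually_elim
  case (elim n)
  define X where "X = (d n)\<^sup>2 * ln (real n)"
  have "e / 4 * \<kappa> > 0" using e \<kappa> by simp
  then have 1: "1 \<le> e / 4 * \<kappa> * X" using elim(2) by (simp add: X_def pos_divide_le_eq mult_ac)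
  have "exp (- ((1 + e) * \<kappa> * X)) = exp (- (e / 4 * \<kappa> * X)) * exp (- ((1 + 3 * e / 4) * \<kappa> * X))"
    by (simp add: exp_add[symmetric] algebra_simps)
  also have "\<dots> \<le> (1 / 2) * exp (- ((1 + 3 * e / 4) * \<kappa> * X))"
  proof (rule mult_right_mono)
    have "exp (- (e / 4 * \<kappa> * X)) \<le> exp (- 1)" using 1 by simp
    also have "\<dots> \<le> 1 / 2" using exp_ge_add_one_self[of 1] by (simp add: exp_minus field_simps)
    finally show "exp (- (e / 4 * \<kappa> * X)) \<le> 1 / 2" .
  qed simp
  finally show ?case using elim(1) by (simp add: X_def)
qed

lemma lower_tail_clique:
  "\<forall>\<^sub>F n in sequentially. exp (- ((1 + e) * (1 / 2 * \<delta> powr (1 / real t) * (1 - \<alpha>)) * ((d n)\<^sup>2 * ln (real n)))) \<le>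
    subset_mean (p n) (pairs {1..n}) (\<lambda>E. of_bool ((1 + \<delta>) * d n ^ (2 * t) \<le> cycle_homs {1..n} t E))"
proof (rule lower_combine)
  define \<kappa> where "\<kappa> = 1 / 2 * \<delta> powr (1 / real t) * (1 - \<alpha>)"
  show "1 / 2 * \<delta> powr (1 / real t) * (1 - \<alpha>) > 0" using \<delta> \<alpha>01 by simp
  obtain x where x: "0 < x" "x < 1" "1 - gap \<le> (1 - x) ^ (4 * t)" by (rule obtain_x)
  define b where "b = slack * \<delta> powr (1 / real t)"
  define c where "c = sqrt b"
  have b: "b > 0" "b ^ t = slack ^ t * \<delta>"
    using slack \<delta> by (auto simp: b_def power_mult_distrib root_pow)
  have c: "c > 0" "c\<^sup>2 = b" using b by (auto simp: c_def)
  have c2t: "c ^ (2 * t) = \<delta> + gap" unfolding gap(2) b(2)[symmetric] c(2)[symmetric] by (simp add: power_mult)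
  \<comment> \<open>The additional vertex makes the average degree of the clique, one less than its
    size, at least c d.\<close>
  define k where "k n = nat \<lceil>c * d n\<rceil> + 1" for n
  define K where "K n = {1..k n}" for n
  define s where "s = sqrt slack"
  have s: "s > 1" "s\<^sup>2 = slack" using slack by (auto simp: s_def)
  have ev1: "\<forall>\<^sub>F n in sequentially. n \<ge> 1 \<and> k n \<le> n \<and> c * d n \<le> real (k n) - 1 \<and>
      real (card (pairs (K n))) \<le> slack * b / 2 * (d n)\<^sup>2"
    using eventually_ge_at_top[of 1] ev_d_ge[of "2 / (c * (s - 1))"] ev_d_ge[of 1] ev_sq_le[OF zero_less_one, of "c + 2"]
  proof eventually_elim
    case (elim n)
    have "c * d n \<ge> 0" using c elim by simp
    then have k: "c * d n \<le> real (k n) - 1" "real (k n) \<le> c * d n + 2" unfolding k_def by linarith+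
    have "d n * 1 \<le> (d n)\<^sup>2" unfolding power2_eq_square using elim by (intro mult_left_mono) auto
    then have "(c + 2) * d n \<le> (c + 2) * (d n)\<^sup>2" using c by (intro mult_left_mono) auto
    then have "c * d n + 2 \<le> real n" using elim by (simp add: algebra_simps)
    then have kn: "k n \<le> n" using k by linarith
    have "2 \<le> c * (s - 1) * d n" using elim(2) c s by (simp add: pos_divide_le_eq mult_ac)
    then have sk: "real (k n) \<le> s * c * d n" using k by (simp add: algebra_simps)
    have "2 * real (card (pairs (K n))) = real (k n) * (real (k n) - 1)"
      using two_card_pairs[of "K n"] by (simp add: K_def)
    also have "\<dots> \<le> real (k n) * real (k n)" by (intro mult_left_mono) auto
    also have "\<dots> \<le> (s * c * d n) * (s * c * d n)" using sk by (intro mult_mono) auto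
    also have "\<dots> = s\<^sup>2 * c\<^sup>2 * (d n)\<^sup>2" by (simp add: power2_eq_square)
    finally have "real (card (pairs (K n))) \<le> slack * b / 2 * (d n)\<^sup>2" unfolding s c by simp
    then show ?case using elim k kn by blast
  qed
  have ev2: "\<forall>\<^sub>F n in sequentially. pairs (K n) \<subseteq> pairs {1..n} \<and> real (card (pairs (K n))) \<le> x / 4 * (real n)\<^sup>2"
  proof -
    have "x / 4 > 0" using x by simp
    from ev1 ev_sq_le[OF this, of "slack * b / 2"] show ?thesis
    proof eventually_elim
      case (elim n)
      have "x / 4 * (real n * 1) \<le> x / 4 * (real n * real n)" using x elim(1) by (intro mult_left_mono) auto
      then have "real (card (pairs (K n))) \<le> x / 4 * (real n)\<^sup>2"
        using elim(1,2) unfolding power2_eq_square[of "real n"] mult_1_right by linarith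
      moreover have "pairs (K n) \<subseteq> pairs {1..n}" using elim(1) by (auto simp: K_def pairs_def)
      ultimately show ?case by simp
    qed
  qed
  have "1 * (1 - \<alpha>) < slack * (1 - \<alpha>)" using slack \<alpha>01 by (intro mult_strict_right_mono) auto
  then have "- (slack * (1 - \<alpha>)) < \<alpha> - 1" by simp
  from order_tendstoD(1)[OF log_p this]
  show "\<forall>\<^sub>F n in sequentially. exp (- ((1 + 3 * e / 4) * (1 / 2 * \<delta> powr (1 / real t) * (1 - \<alpha>)) * ((d n)\<^sup>2 * ln (real n)))) / 2 \<le>
      subset_mean (p n) (pairs {1..n}) (\<lambda>E. of_bool ((1 + \<delta>) * d n ^ (2 * t) \<le> cycle_homs {1..n} t E))"
    using ev1 lower_plant[OF \<delta> gap(1) x ev2] ev_ln_ge[of 1]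
  proof eventually_elim
    case (elim n)
    define a where "a = card (pairs (K n))"
    have L: "ln (real n) > 0" using elim by linarith
    have p: "0 < p n" "p n < 1" using p01[of n] elim by auto
    have "p n ^ a \<le> subset_mean (p n) (pairs (K n)) (\<lambda>E. of_bool ((\<delta> + gap) * d n ^ (2 * t) \<le> cycle_homs {1..n} t E))"
      unfolding a_def
    proof (rule clique_probability)
      have "(\<delta> + gap) * d n ^ (2 * t) = (c * d n) ^ (2 * t)" by (simp add: power_mult_distrib c2t)
      also have "\<dots> \<le> (real (k n) - 1) ^ (2 * t)" using elim c d_pos[of n] by (intro power_mono) auto
      finally show "(\<delta> + gap) * d n ^ (2 * t) \<le> (real (card (K n)) - 1) ^ (2 * t)" by (simp add: K_def)
    qed (use elim p in \<open>auto simp: K_def k_def\<close>)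
    then have 1: "p n ^ a / 2 \<le> subset_mean (p n) (pairs {1..n}) (\<lambda>E. of_bool ((1 + \<delta>) * d n ^ (2 * t) \<le> cycle_homs {1..n} t E))"
      using elim(3) by linarith
    have lp: "- ln (p n) \<le> slack * (1 - \<alpha>) * ln (real n)" using elim(1) L by (simp add: field_simps)
    have lp0: "0 \<le> - ln (p n)" using p by simp
    have "real a * (- ln (p n)) \<le> (slack * b / 2 * (d n)\<^sup>2) * (slack * (1 - \<alpha>) * ln (real n))"
      using elim(2) lp lp0 slack b by (intro mult_mono) (auto simp: a_def)
    also have "\<dots> = slack ^ 3 * (\<kappa> * ((d n)\<^sup>2 * ln (real n)))"
      by (simp add: b_def \<kappa>_def numeral_3_eq_3 mult_ac)
    also have "\<dots> \<le> (1 + 3 * e / 4) * (\<kappa> * ((d n)\<^sup>2 * ln (real n)))"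
      using slack_pow e L \<delta> \<alpha>01 by (intro mult_right_mono) (auto simp: \<kappa>_def)
    finally have "exp (- ((1 + 3 * e / 4) * (\<kappa> * ((d n)\<^sup>2 * ln (real n))))) \<le> exp (real a * ln (p n))" by simp
    also have "\<dots> = p n ^ a" using p by (simp add: exp_of_nat_mult)
    finally show ?case using 1 by (simp add: \<kappa>_def mult.assoc)
  qed
qed

lemma lower_tail_star:
  "\<forall>\<^sub>F n in sequentially. exp (- ((1 + e) * ((\<delta> / 2) powr (1 / real t) * \<alpha>) * ((d n)\<^sup>2 * ln (real n)))) \<le>
    subset_mean (p n) (pairs {1..n}) (\<lambda>E. of_bool ((1 + \<delta>) * d n ^ (2 * t) \<le> cycle_homs {1..n} t E))"
proof (rule lower_combine)
  define \<kappa> where "\<kappa> = (\<delta> / 2) powr (1 / real t) * \<alpha>"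
  show \<kappa>p: "(\<delta> / 2) powr (1 / real t) * \<alpha> > 0" using \<delta> \<alpha>01 by simp
  obtain x where x: "0 < x" "x < 1" "1 - gap \<le> (1 - x) ^ (4 * t)" by (rule obtain_x)
  define b where "b = slack * (\<delta> / 2) powr (1 / real t)"
  have b: "b > 0" "2 * b ^ t = slack ^ t * \<delta>"
    using slack \<delta> by (auto simp: b_def power_mult_distrib root_pow)
  define m where "m n = nat \<lceil>b * (d n)\<^sup>2\<rceil>" for n
  define A where "A n = (\<lambda>w. {1, w}) ` ({1..n} - {1})" for n :: nat
  have ev1: "\<forall>\<^sub>F n in sequentially. n \<ge> 2 \<and> m n \<ge> 1 \<and> m n \<le> n - 1 \<and> b * (d n)\<^sup>2 \<le> real (m n) \<and> real (m n) \<le> slack * b * (d n)\<^sup>2"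
    using eventually_ge_at_top[of 2] ev_d_ge[of "1 / (b * (slack - 1))"] ev_d_ge[of 1] ev_sq_le[OF zero_less_one, of "slack * b + 1"]
  proof eventually_elim
    case (elim n)
    have d2: "d n \<le> (d n)\<^sup>2" "1 \<le> (d n)\<^sup>2" using elim by (auto simp: power2_eq_square intro: order_trans[OF elim(3)])
    have "b * (d n)\<^sup>2 > 0" using b(1) d2(2) by (intro mult_pos_pos) linarith+
    then have m: "b * (d n)\<^sup>2 \<le> real (m n)" "real (m n) \<le> b * (d n)\<^sup>2 + 1" "m n \<ge> 1"
      unfolding m_def by linarith+
    have "1 \<le> b * (slack - 1) * d n" using elim(2) b slack by (simp add: pos_divide_le_eq mult_ac)
    also have "\<dots> \<le> b * (slack - 1) * (d n)\<^sup>2" using d2 b slack by (intro mult_left_mono) auto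
    finally have mm: "real (m n) \<le> slack * b * (d n)\<^sup>2" using m by (simp add: algebra_simps)
    have "slack * b * (d n)\<^sup>2 + 1 \<le> real n" using elim(4) d2 by (simp add: algebra_simps)
    then have "m n \<le> n - 1" using mm elim by linarith
    then show ?case using elim m mm by blast
  qed
  have A: "A n \<subseteq> pairs {1..n}" "card (A n) = n - 1"
    "k \<le> n - 1 \<Longrightarrow> z \<le> 2 * real k ^ t \<Longrightarrow> real (n - 1 choose k) * (p n ^ k * (1 - p n) ^ (n - 1 - k)) \<le>
      subset_mean (p n) (A n) (\<lambda>E. of_bool (z \<le> cycle_homs {1..n} t E))" if "n \<ge> 1" for n k z
    using star_probability[of "{1..n}" 1 "p n" t 0 0] star_probability[of "{1..n}" 1 "p n" t k z] that p01[of n] t3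
    unfolding A_def by auto
  have ev2: "\<forall>\<^sub>F n in sequentially. A n \<subseteq> pairs {1..n} \<and> real (card (A n)) \<le> x / 4 * (real n)\<^sup>2"
  proof -
    have "\<forall>\<^sub>F n in sequentially. real n \<le> x / 4 * (real n)\<^sup>2" using x(1) by real_asymp
    with eventually_ge_at_top[of 1] show ?thesis
    proof eventually_elim
      case (elim n)
      then show ?case using A(1,2)[of n] by auto
    qed
  qed
  \<comment> \<open>With at most slack * b * d^2 leaves and n - 1 >= n/2 candidates, (n-1) p / m is
    at least 1/(C d), which is the price per leaf.\<close>
  define C where "C = 2 * (slack * b)"
  have C: "C > 0" using slack b by (simp add: C_def)
  have evC: "\<forall>\<^sub>F n in sequentially. ln (C * d n) \<le> slack * \<alpha> * ln (real n)"
  proof -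
    have "(\<lambda>n. ln C / ln (real n)) \<longlonglongrightarrow> 0" by real_asymp
    then have "(\<lambda>n. ln C / ln (real n) + ln (d n) / ln (real n)) \<longlonglongrightarrow> 0 + \<alpha>" by (intro tendsto_intros log_d)
    moreover have "0 + \<alpha> < slack * \<alpha>" using slack \<alpha>01 by simp
    ultimately have "\<forall>\<^sub>F n in sequentially. ln C / ln (real n) + ln (d n) / ln (real n) < slack * \<alpha>" by (rule order_tendstoD)
    with ev_ln_ge[of 1] eventually_ge_at_top[of 1] show ?thesis
    proof eventually_elim
      case (elim n)
      have "ln (real n) > 0" using elim by linarith
      then show ?case using elim C d_pos[of n] by (simp add: ln_mult add_divide_distrib[symmetric] field_simps)
    qed
  qed
  have evp: "\<forall>\<^sub>F n in sequentially. p n \<le> 1 / 2"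
    by (rule eventually_le_of_tendsto[OF p_tendsto]) simp
  show "\<forall>\<^sub>F n in sequentially. exp (- ((1 + 3 * e / 4) * ((\<delta> / 2) powr (1 / real t) * \<alpha>) * ((d n)\<^sup>2 * ln (real n)))) / 2 \<le>
      subset_mean (p n) (pairs {1..n}) (\<lambda>E. of_bool ((1 + \<delta>) * d n ^ (2 * t) \<le> cycle_homs {1..n} t E))"
    using ev1 lower_plant[OF \<delta> gap(1) x ev2] ev_ln_ge[of 1] evC evp ev_d_ge[of 1] ev_d_ge[of "1 / C"] ev_d_ge[of "16 / (e * \<kappa>)"]
  proof eventually_elim
    case (elim n)
    define L where "L = ln (real n)"
    have L: "L \<ge> 1" using elim by (simp add: L_def)
    have p: "0 < p n" "p n < 1" using p01[of n] elim by auto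
    have d1: "d n \<ge> 1" "(d n)\<^sup>2 > 0" using elim by auto
    have m: "m n \<ge> 1" "m n \<le> n - 1" "b * (d n)\<^sup>2 \<le> real (m n)" "real (m n) \<le> slack * b * (d n)\<^sup>2" using elim(1) by auto
    have Cd: "C * d n \<ge> 1" using elim C by (simp add: field_simps)
    have "(\<delta> + gap) * d n ^ (2 * t) = 2 * (b * (d n)\<^sup>2) ^ t"
      using b(2) gap(2) by (simp add: power_mult_distrib power_mult)
    also have "\<dots> \<le> 2 * real (m n) ^ t" using m b by (intro mult_left_mono power_mono) auto
    finally have z: "(\<delta> + gap) * d n ^ (2 * t) \<le> 2 * real (m n) ^ t" .
    have choose: "(real (n - 1) / real (m n)) ^ m n \<le> real (n - 1 choose m n)"
      using binomial_ge_n_over_k_pow_k[OF m(2), where 'a = real] .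
    have base: "1 / (C * d n) \<le> real (n - 1) / real (m n) * p n"
    proof -
      have "real n / 2 \<le> real (n - 1)" using elim by simp
      then have "d n / 2 \<le> real (n - 1) * p n" using p mult_right_mono[of "real n / 2" "real (n - 1)" "p n"] by (simp add: d_eq)
      then have "(d n / 2) / (slack * b * (d n)\<^sup>2) \<le> real (n - 1) * p n / real (m n)"
        using m d1 p by (intro frac_le) auto
      moreover have "(d n / 2) / (slack * b * (d n)\<^sup>2) = 1 / (C * d n)"
        using d1 by (simp add: C_def power2_eq_square)
      ultimately show ?thesis by simp
    qed
    have "exp (- (real (m n) * ln (C * d n))) = (1 / (C * d n)) ^ m n"
    proof -
      have "exp (- (real (m n) * ln (C * d n))) = inverse (exp (ln (C * d n)) ^ m n)"
        by (simp only: exp_minus exp_of_nat_mult)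
      also have "exp (ln (C * d n)) = C * d n" using Cd by simp
      finally show ?thesis by (simp add: power_one_over inverse_eq_divide)
    qed
    also have "\<dots> \<le> (real (n - 1) / real (m n) * p n) ^ m n" using base Cd by (intro power_mono) auto
    also have "\<dots> = (real (n - 1) / real (m n)) ^ m n * p n ^ m n" by (rule power_mult_distrib)
    also have "\<dots> \<le> real (n - 1 choose m n) * p n ^ m n" using choose p by (intro mult_right_mono) auto
    finally have e1: "exp (- (real (m n) * ln (C * d n))) \<le> real (n - 1 choose m n) * p n ^ m n" .
    \<comment> \<open>The absence of the other edges at the centre costs at most exp(-2d),
      negligible against d^2 ln n.\<close>
    have e2: "exp (- (2 * d n)) \<le> (1 - p n) ^ (n - 1 - m n)"
    proof -
      have "p n * p n \<le> (1 / 2) * p n" using p elim by (intro mult_right_mono) auto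
      then have "- (2 * p n) \<le> - p n - 2 * (p n)\<^sup>2" by (simp add: power2_eq_square)
      also have "\<dots> \<le> ln (1 - p n)" using p elim by (intro ln_one_minus_pos_lower_bound) auto
      finally have "exp (- (2 * p n)) \<le> 1 - p n" using p by (simp add: ln_ge_iff)
      then have "exp (- (2 * p n)) ^ n \<le> (1 - p n) ^ n" by (intro power_mono) auto
      also have "\<dots> \<le> (1 - p n) ^ (n - 1 - m n)" using p by (intro power_decreasing) auto
      finally show ?thesis by (simp add: exp_of_nat_mult[symmetric] d_eq mult_ac)
    qed
    have "exp (- (real (m n) * ln (C * d n))) * exp (- (2 * d n)) \<le> real (n - 1 choose m n) * p n ^ m n * (1 - p n) ^ (n - 1 - m n)"
      using e1 e2 p by (intro mult_mono) auto
    also have "\<dots> \<le> subset_mean (p n) (A n) (\<lambda>E. of_bool ((\<delta> + gap) * d n ^ (2 * t) \<le> cycle_homs {1..n} t E))"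
      using A(3)[of n "m n", OF _ m(2) z] elim(1) by (simp add: mult.assoc)
    finally have lo: "exp (- (real (m n) * ln (C * d n))) * exp (- (2 * d n)) / 2 \<le>
       subset_mean (p n) (pairs {1..n}) (\<lambda>E. of_bool ((1 + \<delta>) * d n ^ (2 * t) \<le> cycle_homs {1..n} t E))"
      using elim(2) by linarith
    have "real (m n) * ln (C * d n) \<le> (slack * b * (d n)\<^sup>2) * (slack * \<alpha> * L)"
      using m elim(4) Cd slack b by (intro mult_mono) (auto simp: L_def)
    also have "\<dots> = slack ^ 3 * (\<kappa> * ((d n)\<^sup>2 * L))"
      by (simp add: b_def \<kappa>_def numeral_3_eq_3 mult_ac)
    also have "\<dots> \<le> (1 + e / 2) * (\<kappa> * ((d n)\<^sup>2 * L))"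
      using slack_pow L \<kappa>p by (intro mult_right_mono) (auto simp: \<kappa>_def)
    finally have a: "real (m n) * ln (C * d n) \<le> (1 + e / 2) * (\<kappa> * ((d n)\<^sup>2 * L))" .
    have e\<kappa>: "e * \<kappa> > 0" using e \<kappa>p by (simp add: \<kappa>_def)
    have "16 \<le> e * \<kappa> * d n" using elim e\<kappa> by (simp add: pos_divide_le_eq mult_ac)
    then have "16 * d n \<le> e * \<kappa> * d n * d n" using d1 by (intro mult_right_mono) auto
    then have "2 * d n \<le> e / 4 * (\<kappa> * (d n)\<^sup>2)" using d1 by (simp add: power2_eq_square)
    also have "\<dots> \<le> e / 4 * (\<kappa> * (d n)\<^sup>2) * L"
    proof -
      have "0 \<le> e / 4 * (\<kappa> * (d n)\<^sup>2)" using e \<kappa>p by (simp add: \<kappa>_def)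
      from mult_left_mono[OF L this] show ?thesis by simp
    qed
    finally have "exp (- ((1 + 3 * e / 4) * (\<kappa> * ((d n)\<^sup>2 * L)))) \<le> exp (- (real (m n) * ln (C * d n)) + - (2 * d n))"
      using a by (simp add: algebra_simps)
    then have "exp (- ((1 + 3 * e / 4) * (\<kappa> * ((d n)\<^sup>2 * L)))) \<le> exp (- (real (m n) * ln (C * d n))) * exp (- (2 * d n))"
      by (simp only: exp_add)
    moreover have "(1 + 3 * e / 4) * ((\<delta> / 2) powr (1 / real t) * \<alpha>) * ((d n)\<^sup>2 * ln (real n)) =
        (1 + 3 * e / 4) * (\<kappa> * ((d n)\<^sup>2 * L))"
      by (simp only: \<kappa>_def L_def mult.assoc)
    ultimately have "exp (- ((1 + 3 * e / 4) * ((\<delta> / 2) powr (1 / real t) * \<alpha>) * ((d n)\<^sup>2 * ln (real n)))) \<le>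
        exp (- (real (m n) * ln (C * d n))) * exp (- (2 * d n))"
      by (simp only:)
    then show ?case by (rule order_trans[OF divide_right_mono lo]) simp
  qed
qed

lemma lower_tail:
  "\<forall>\<^sub>F n in sequentially. exp (- ((1 + e) * cost_rate t \<alpha> \<delta> * ((d n)\<^sup>2 * ln (real n)))) \<le>
    subset_mean (p n) (pairs {1..n}) (\<lambda>E. of_bool ((1 + \<delta>) * d n ^ (2 * t) \<le> cycle_homs {1..n} t E))"
  using lower_tail_clique lower_tail_star
  by eventually_elim (simp add: cost_rate_def min_def)

end

lemma rate_limit:
  assumes \<delta>: "\<delta> > 0"
  shows "(\<lambda>n. - (ln (subset_mean (p n) (pairs {1..n}) (\<lambda>E. of_bool ((1 + \<delta>) * d n ^ (2 * t) \<le> cycle_homs {1..n} t E))) /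
    ((d n)\<^sup>2 * ln (1 / p n)))) \<longlonglongrightarrow> cost_rate t \<alpha> \<delta> / (1 - \<alpha>)"
proof -
  define P where "P n = subset_mean (p n) (pairs {1..n}) (\<lambda>E. of_bool ((1 + \<delta>) * d n ^ (2 * t) \<le> cycle_homs {1..n} t E))" for n
  define X where "X n = (d n)\<^sup>2 * ln (real n)" for n
  define \<kappa> where "\<kappa> = cost_rate t \<alpha> \<delta>"
  have \<kappa>: "\<kappa> > 0" unfolding \<kappa>_def by (intro cost_rate_pos \<alpha>01 \<delta>)
  have bounds: "\<forall>\<^sub>F n in sequentially. (1 - e) * \<kappa> \<le> - ln (P n) / X n \<and> - ln (P n) / X n \<le> (1 + e) * \<kappa>"
    if e: "0 < e" "e < 1" for e
    using lower_tail[OF \<delta> e] upper_tail[OF \<delta> e] ev_X[of 1]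
  proof eventually_elim
    case (elim n)
    have X: "X n > 0" using elim(3) by (simp add: X_def)
    have lo: "exp (- ((1 + e) * \<kappa> * X n)) \<le> P n" and up: "P n \<le> exp (- ((1 - e) * \<kappa> * X n))"
      using elim by (auto simp: P_def X_def \<kappa>_def)
    have P: "P n > 0" using lo by (meson exp_gt_zero less_le_trans)
    have "- ((1 + e) * \<kappa> * X n) \<le> ln (P n)" using lo P by (simp add: ln_ge_iff)
    moreover have "ln (P n) \<le> - ((1 - e) * \<kappa> * X n)" using up P by (metis ln_exp ln_mono)
    ultimately show ?case using X by (simp add: field_simps)
  qed
  have lim: "(\<lambda>n. - ln (P n) / X n) \<longlonglongrightarrow> \<kappa>"
  proof (rule order_tendstoI)
    fix a assume a: "a < \<kappa>"
    define e where "e = min (1 / 2) ((\<kappa> - a) / (2 * \<kappa>))"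
    have e: "0 < e" "e < 1" using a \<kappa> by (auto simp: e_def)
    have "e * \<kappa> \<le> (\<kappa> - a) / (2 * \<kappa>) * \<kappa>" using \<kappa> by (intro mult_right_mono) (auto simp: e_def)
    also have "(\<kappa> - a) / (2 * \<kappa>) * \<kappa> = (\<kappa> - a) / 2" using \<kappa> by simp
    finally have "e * \<kappa> \<le> (\<kappa> - a) / 2" .
    moreover have "(1 - e) * \<kappa> = \<kappa> - e * \<kappa>" by (simp add: algebra_simps)
    moreover have "(\<kappa> - a) / 2 < \<kappa> - a" using a by simp
    ultimately have "a < (1 - e) * \<kappa>" by linarith
    with bounds[OF e] show "\<forall>\<^sub>F n in sequentially. a < - ln (P n) / X n" by (auto elim: eventually_mono)
  next
    fix a assume a: "\<kappa> < a"
    define e where "e = min (1 / 2) ((a - \<kappa>) / (2 * \<kappa>))"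
    have e: "0 < e" "e < 1" using a \<kappa> by (auto simp: e_def)
    have "e * \<kappa> \<le> (a - \<kappa>) / (2 * \<kappa>) * \<kappa>" using \<kappa> by (intro mult_right_mono) (auto simp: e_def)
    also have "(a - \<kappa>) / (2 * \<kappa>) * \<kappa> = (a - \<kappa>) / 2" using \<kappa> by simp
    finally have "e * \<kappa> \<le> (a - \<kappa>) / 2" .
    moreover have "(1 + e) * \<kappa> = \<kappa> + e * \<kappa>" by (simp add: algebra_simps)
    moreover have "(a - \<kappa>) / 2 < a - \<kappa>" using a by simp
    ultimately have "(1 + e) * \<kappa> < a" by linarith
    with bounds[OF e] show "\<forall>\<^sub>F n in sequentially. - ln (P n) / X n < a" by (auto elim: eventually_mono)
  qed
  \<comment> \<open>Change the unit from ln n to ln(1/p), which is (1 - \<alpha> + o(1)) ln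
    n.\<close>
  have "(\<lambda>n. (- ln (P n) / X n) / (- (ln (p n) / ln (real n)))) \<longlonglongrightarrow> \<kappa> / (- (\<alpha> - 1))"
    using \<alpha>01 by (intro tendsto_intros lim log_p) auto
  moreover have "\<forall>\<^sub>F n in sequentially. (- ln (P n) / X n) / (- (ln (p n) / ln (real n))) = - (ln (P n) / ((d n)\<^sup>2 * ln (1 / p n)))"
    using ev_ln_ge[of 1] eventually_ge_at_top[of 1]
  proof eventually_elim
    case (elim n)
    have "ln (real n) \<noteq> 0" "ln (1 / p n) = - ln (p n)" using elim p01[of n] by (auto simp: ln_div)
    then show ?case by (simp add: X_def)
  qed
  ultimately have "(\<lambda>n. - (ln (P n) / ((d n)\<^sup>2 * ln (1 / p n)))) \<longlonglongrightarrow> \<kappa> / (- (\<alpha> - 1))"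
    by (rule Lim_transform_eventually)
  then show ?thesis by (simp add: P_def \<kappa>_def)
qed

end

text \<open>The star term is rewritten by (\<delta>/2)^(1/t) = (1/2) \<delta>^(1/t) 2^(1 - 1/t); the
  clique term becomes the 1 in the minimum.\<close>

lemma cost_rate_eq:
  assumes "0 < \<delta>" "\<alpha> < 1" "t \<ge> 1"
  shows "cost_rate t \<alpha> \<delta> / (1 - \<alpha>) =
    1 / 2 * \<delta> powr (1 / real t) * min (2 powr (1 - 1 / real t) * (\<alpha> / (1 - \<alpha>))) 1"
proof -
  define z where "z = 1 / 2 * \<delta> powr (1 / real t)"
  have z: "z > 0" using assms by (simp add: z_def)
  have k: "(\<delta> / 2) powr (1 / real t) = z * 2 powr (1 - 1 / real t)"
    using assms by (simp add: z_def powr_divide powr_diff)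
  have "cost_rate t \<alpha> \<delta> = min (z * (2 powr (1 - 1 / real t) * \<alpha>)) (z * (1 - \<alpha>))"
    unfolding cost_rate_def k z_def[symmetric] by (simp only: mult.assoc)
  also have "\<dots> = z * min (2 powr (1 - 1 / real t) * \<alpha>) (1 - \<alpha>)"
    using z by (simp add: min_mult_distrib_left)
  also have "\<dots> / (1 - \<alpha>) = z * (min (2 powr (1 - 1 / real t) * \<alpha>) (1 - \<alpha>) / (1 - \<alpha>))" by simp
  also have "min (2 powr (1 - 1 / real t) * \<alpha>) (1 - \<alpha>) / (1 - \<alpha>) = min (2 powr (1 - 1 / real t) * (\<alpha> / (1 - \<alpha>))) 1"
    using assms by (simp add: min_divide_distrib_right)
  finally show ?thesis by (simp add: z_def)
qed

section \<open>Transfer to the given probability spaces\<close>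

theorem theorem1p5:
  fixes t :: nat
    and p d :: "nat \<Rightarrow> real"
    and M :: "nat \<Rightarrow> 'w measure"
    and G :: "nat \<Rightarrow> 'w \<Rightarrow> nat graph"
  assumes "t \<ge> 3"
    and "\<And>n. n \<ge> 1 \<Longrightarrow> 0 < p n \<and> p n < 1"
    and "p \<longlonglongrightarrow> 0"
    and "\<And>n. d n = real n * p n"
    and "(\<lambda>n. real n * d n ^ t) \<lless> (\<lambda>n. d n ^ (2 * t))"
    and "\<And>n. n \<ge> 1 \<Longrightarrow> prob_space (M n)"
    and "\<And>n. n \<ge> 1 \<Longrightarrow> G n \<in> measurable (M n) (count_space UNIV)"
    and "\<And>n. n \<ge> 1 \<Longrightarrow> distr (M n) (count_space UNIV) (G n) = measure_pmf (erdos_renyi n (p n))"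
  shows "(\<exists>\<epsilon>. \<epsilon> \<longlonglongrightarrow> 0 \<and>
           (\<forall>n\<ge>1. prob_space.expectation (M n) (\<lambda>\<omega>. Hom (cycle_graph (2 * t)) (G n \<omega>))
                    = (1 + \<epsilon> n) * d n ^ (2 * t))) \<and>
         (\<forall>\<alpha>::real.
           (\<exists>c. filterlim c at_top sequentially \<and>
              (\<forall>\<^sub>F n in sequentially. d n \<le> sqrt (real n) * ln (real n) powr (- c n))) \<longrightarrow>
           (\<lambda>n. ln (d n) / ln (real n)) \<longlonglongrightarrow> \<alpha> \<longrightarrow>
           (\<forall>\<delta>>0.
             (\<lambda>n. - (ln (measure (M n)
                       {\<omega> \<in> space (M n).
                          Hom (cycle_graph (2 * t)) (G n \<omega>) \<ge> (1 + \<delta>) * d n ^ (2 * t)})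
                     / ((d n)\<^sup>2 * ln (1 / p n))))
             \<longlonglongrightarrow> 1 / 2 * \<delta> powr (1 / real t)
                 * min (2 powr (1 - 1 / real t) * (\<alpha> / (1 - \<alpha>))) 1))"
proof -
  interpret sparse_graphs t p d
    using assms by unfold_locales (auto simp: much_less_def)
  let ?H = "Hom (cycle_graph (2 * t)) :: nat graph \<Rightarrow> real"
  have H: "?H ({1..n}, E) = cycle_homs {1..n} t E" for n E
    using t3 by (intro Hom_eq_cycle_homs) auto
  have mean: "prob_space.expectation (M n) (\<lambda>\<omega>. f (G n \<omega>)) = subset_mean (p n) (pairs {1..n}) (\<lambda>E. f ({1..n}, E))"
    if n: "n \<ge> 1" for n and f :: "nat graph \<Rightarrow> real"
  proof -
    have "prob_space.expectation (M n) (\<lambda>\<omega>. f (G n \<omega>)) = integral\<^sup>L (distr (M n) (count_space UNIV) (G n)) f"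
      by (rule integral_distr[symmetric]) (use assms(7)[OF n] in auto)
    then show ?thesis using p01[OF n] by (simp add: assms(8)[OF n] erdos_renyi_expectation)
  qed
  have prob: "measure (M n) {\<omega> \<in> space (M n). z \<le> ?H (G n \<omega>)} = subset_mean (p n) (pairs {1..n}) (\<lambda>E. of_bool (z \<le> cycle_homs {1..n} t E))"
    if n: "n \<ge> 1" for n z
  proof -
    interpret prob_space "M n" by (rule assms(6)[OF n])
    have "{\<omega> \<in> space (M n). z \<le> ?H (G n \<omega>)} \<in> sets (M n)"
      using measurable_sets[OF assms(7)[OF n], of "{g. z \<le> ?H g}"] by (simp add: vimage_def Int_def conj_commute)
    then have "measure (M n) {\<omega> \<in> space (M n). z \<le> ?H (G n \<omega>)} = expectation (indicator {\<omega> \<in> space (M n). z \<le> ?H (G n \<omega>)})"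
      by simp
    also have "\<dots> = expectation (\<lambda>\<omega>. of_bool (z \<le> ?H (G n \<omega>)))"
      by (rule Bochner_Integration.integral_cong) auto
    also have "\<dots> = subset_mean (p n) (pairs {1..n}) (\<lambda>E. of_bool (z \<le> cycle_homs {1..n} t E))"
      unfolding mean[OF n, of "\<lambda>g. of_bool (z \<le> ?H g)"] H ..
    finally show ?thesis .
  qed
  show ?thesis
  proof (intro conjI allI impI)
    define \<epsilon> where "\<epsilon> n = subset_mean (p n) (pairs {1..n}) (cycle_homs {1..n} t) / d n ^ (2 * t) - 1" for n
    have "\<epsilon> \<longlonglongrightarrow> 1 - 1" unfolding \<epsilon>_def by (intro tendsto_intros mean_tendsto)
    moreover have "prob_space.expectation (M n) (\<lambda>\<omega>. ?H (G n \<omega>)) = (1 + \<epsilon> n) * d n ^ (2 * t)" if "n \<ge> 1" for n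
    proof -
      have "prob_space.expectation (M n) (\<lambda>\<omega>. ?H (G n \<omega>)) = subset_mean (p n) (pairs {1..n}) (cycle_homs {1..n} t)"
        using mean[OF that, of ?H] unfolding H .
      then show ?thesis using d_pos[OF that] by (simp add: \<epsilon>_def)
    qed
    ultimately show "\<exists>\<epsilon>. \<epsilon> \<longlonglongrightarrow> 0 \<and> (\<forall>n\<ge>1. prob_space.expectation (M n) (\<lambda>\<omega>. ?H (G n \<omega>)) = (1 + \<epsilon> n) * d n ^ (2 * t))"
      by auto
  next
    fix \<alpha> \<delta> :: real
    assume "\<exists>c. filterlim c at_top sequentially \<and> (\<forall>\<^sub>F n in sequentially. d n \<le> sqrt (real n) * ln (real n) powr (- c n))"
      and \<alpha>: "(\<lambda>n. ln (d n) / ln (real n)) \<longlonglongrightarrow> \<alpha>" and \<delta>: "\<delta> > 0"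
    then obtain c where c: "filterlim c at_top sequentially" "\<forall>\<^sub>F n in sequentially. d n \<le> sqrt (real n) * ln (real n) powr (- c n)"
      by blast
    interpret localized_graphs t p d c \<alpha> by unfold_locales (fact c \<alpha>)+
    have t1: "t \<ge> 1" using t3 by simp
    \<comment> \<open>The probability is identified for n >= 1 only, since nothing is assumed about
      \<open>M 0\<close>; the limits agree because the sequences agree eventually.\<close>
    show "(\<lambda>n. - (ln (measure (M n) {\<omega> \<in> space (M n). ?H (G n \<omega>) \<ge> (1 + \<delta>) * d n ^ (2 * t)}) / ((d n)\<^sup>2 * ln (1 / p n))))
       \<longlonglongrightarrow> 1 / 2 * \<delta> powr (1 / real t) * min (2 powr (1 - 1 / real t) * (\<alpha> / (1 - \<alpha>))) 1"
      unfolding cost_rate_eq[OF \<delta> \<alpha>01(2) t1, symmetric]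
      by (rule Lim_transform_eventually[OF rate_limit[OF \<delta>]]) (use prob in \<open>auto intro: eventually_sequentiallyI[of 1]\<close>)
  qed
qed

end
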